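(* Let $\Delta$ and $\Gamma$ be finite simplicial graphs with $n=|V(\Delta)|$. If $\mathrm{Th}_\exists(\mathbb{G}(\Delta))\subseteq\mathrm{Th}_\exists(\mathbb{G}(\Gamma))$, then there exists a tame embedding $\varphi:\mathbb{G}(\Delta)\to\mathbb{G}(\Gamma_n)$.
   Context: $\mathbb{G}(\Gamma)=\langle V(\Gamma)\mid [x,y]=1 \text{ for } (x,y)\in E(\Gamma)\rangle$. $\mathrm{Th}_\exists(G)$ is the set of existential sentences in the language of groups true in $G$. The $n$-inflation $\Gamma_n$ has vertices $v_1,\dots,v_n$ for each $v\in V(\Gamma)$; $v_i,v_j$ adjacent for $i\ne j$, and $v_i,w_k$ ($v\ne w$) adjacent iff $(v,w)\in E(\Gamma)$. An embedding $\varphi:\mathbb{G}(\Delta)\to\mathbb{G}(\Lambda)$ is tame if for each $x_i\in V(\Delta)$, $\varphi(x_i)=y_{i1}\cdots y_{ir_i}$ where $y_{ij}=g_{ij}^{-1}x_{ij}'^{\,n_{ij}}g_{ij}$ with $x'_{ij}\in V(\Lambda)$, $n_{ij}\in\mathbb{Z}$, $g_{ij}\in\mathbb{G}(\Lambda)$, the $y_{i1},\dots,y_{ir_i}$ pairwise commute, and the conjugates $g_{ij}^{-1}x'_{ij}g_{ij}$ are pairwise distinct over all pairs $(i,j)$. *)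

theory Defs
  imports "HOL-Algebra.Group"
begin

definition simple_graph :: "'v set \<Rightarrow> ('v \<times> 'v) set \<Rightarrow> bool" where
  "simple_graph V E \<longleftrightarrow> finite V \<and> E \<subseteq> V \<times> V \<and> sym E \<and> (\<forall>x. (x, x) \<notin> E)"

text \<open>Words are lists of letters (v, b); (v, True) is the generator v and
(v, False) its inverse.\<close>

inductive raag_step :: "('v \<times> 'v) set \<Rightarrow> ('v \<times> bool) list \<Rightarrow> ('v \<times> bool) list \<Rightarrow> bool"
  for E where
  cancel: "raag_step E (u @ [(x, b), (x, \<not> b)] @ w) (u @ w)"
| commute: "(x, y) \<in> E \<Longrightarrow> raag_step E (u @ [(x, b), (y, c)] @ w) (u @ [(y, c), (x, b)] @ w)"

definition raag_rel :: "'v set \<Rightarrow> ('v \<times> 'v) set \<Rightarrow> (('v \<times> bool) list \<times> ('v \<times> bool) list) set" where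
  "raag_rel V E = {(u, w). u \<in> lists (V \<times> UNIV) \<and> w \<in> lists (V \<times> UNIV) \<and>
      (u, w) \<in> ({(a, c). raag_step E a c} \<union> {(a, c). raag_step E a c}\<inverse>)\<^sup>*}"

definition RAAG :: "'v set \<Rightarrow> ('v \<times> 'v) set \<Rightarrow> ('v \<times> bool) list set monoid" where
  "RAAG V E = \<lparr> carrier = lists (V \<times> UNIV) // raag_rel V E,
      mult = (\<lambda>A B. raag_rel V E `` {a @ b | a b. a \<in> A \<and> b \<in> B}),
      one = raag_rel V E `` {[]} \<rparr>"

definition raag_gen :: "'v set \<Rightarrow> ('v \<times> 'v) set \<Rightarrow> 'v \<Rightarrow> ('v \<times> bool) list set" where
  "raag_gen V E v = raag_rel V E `` {[(v, True)]}"

datatype gterm = Var nat | One | Mul gterm gterm | Inv gterm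

fun teval :: "('g, 'm) monoid_scheme \<Rightarrow> (nat \<Rightarrow> 'g) \<Rightarrow> gterm \<Rightarrow> 'g" where
  "teval G a (Var i) = a i"
| "teval G a One = \<one>\<^bsub>G\<^esub>"
| "teval G a (Mul s t) = teval G a s \<otimes>\<^bsub>G\<^esub> teval G a t"
| "teval G a (Inv t) = inv\<^bsub>G\<^esub> (teval G a t)"

datatype qf = Eq gterm gterm | Neg qf | Conj qf qf | Disj qf qf

fun qf_holds :: "('g, 'm) monoid_scheme \<Rightarrow> (nat \<Rightarrow> 'g) \<Rightarrow> qf \<Rightarrow> bool" where
  "qf_holds G a (Eq s t) = (teval G a s = teval G a t)"
| "qf_holds G a (Neg p) = (\<not> qf_holds G a p)"
| "qf_holds G a (Conj p q) = (qf_holds G a p \<and> qf_holds G a q)"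
| "qf_holds G a (Disj p q) = (qf_holds G a p \<or> qf_holds G a q)"

text \<open>A quantifier-free formula p stands for the existential sentence
obtained by existentially quantifying all of its variables.\<close>

definition ex_holds :: "('g, 'm) monoid_scheme \<Rightarrow> qf \<Rightarrow> bool" where
  "ex_holds G p \<longleftrightarrow> (\<exists>a. (\<forall>i. a i \<in> carrier G) \<and> qf_holds G a p)"

definition Th_ex :: "('g, 'm) monoid_scheme \<Rightarrow> qf set" where
  "Th_ex G = {p. ex_holds G p}"

definition inflation_V :: "'v set \<Rightarrow> nat \<Rightarrow> ('v \<times> nat) set" where
  "inflation_V V n = V \<times> {1..n}"

definition inflation_E :: "'v set \<Rightarrow> ('v \<times> 'v) set \<Rightarrow> nat \<Rightarrow> (('v \<times> nat) \<times> ('v \<times> nat)) set" where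
  "inflation_E V E n = {((v, i), (w, j)). (v, i) \<in> inflation_V V n \<and> (w, j) \<in> inflation_V V n \<and>
      ((v = w \<and> i \<noteq> j) \<or> (v \<noteq> w \<and> (v, w) \<in> E))}"

definition tame_embedding ::
  "'a set \<Rightarrow> ('a \<times> 'a) set \<Rightarrow> 'b set \<Rightarrow> ('b \<times> 'b) set
   \<Rightarrow> (('a \<times> bool) list set \<Rightarrow> ('b \<times> bool) list set) \<Rightarrow> bool" where
  "tame_embedding VD ED VL EL \<phi> \<longleftrightarrow>
     \<phi> \<in> hom (RAAG VD ED) (RAAG VL EL) \<and> inj_on \<phi> (carrier (RAAG VD ED)) \<and>
     (\<exists>(r :: 'a \<Rightarrow> nat) (x' :: 'a \<Rightarrow> nat \<Rightarrow> 'b) (k :: 'a \<Rightarrow> nat \<Rightarrow> int)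
        (g :: 'a \<Rightarrow> nat \<Rightarrow> ('b \<times> bool) list set).
       let L = RAAG VL EL;
           y = (\<lambda>v j. inv\<^bsub>L\<^esub> (g v j) \<otimes>\<^bsub>L\<^esub> (raag_gen VL EL (x' v j) [^]\<^bsub>L\<^esub> k v j) \<otimes>\<^bsub>L\<^esub> g v j);
           c = (\<lambda>v j. inv\<^bsub>L\<^esub> (g v j) \<otimes>\<^bsub>L\<^esub> raag_gen VL EL (x' v j) \<otimes>\<^bsub>L\<^esub> g v j)
       in (\<forall>v\<in>VD. \<forall>j<r v. x' v j \<in> VL \<and> g v j \<in> carrier L)
        \<and> (\<forall>v\<in>VD. \<phi> (raag_gen VD ED v) = foldr (\<lambda>j acc. y v j \<otimes>\<^bsub>L\<^esub> acc) [0..<r v] \<one>\<^bsub>L\<^esub>)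
        \<and> (\<forall>v\<in>VD. \<forall>j<r v. \<forall>j'<r v. y v j \<otimes>\<^bsub>L\<^esub> y v j' = y v j' \<otimes>\<^bsub>L\<^esub> y v j)
        \<and> inj_on (\<lambda>(v, j). c v j) {(v, j). v \<in> VD \<and> j < r v})"

end

theory Submission
  imports Defs "HOL-Library.Multiset" "HOL-Library.Nat_Bijection"
begin

text \<open>The existential theory yields, for every \<open>N\<close>, a homomorphism from the group of \<open>\<Delta>\<close> to that of \<open>\<Gamma>\<close>
  that is injective on words of length at most \<open>N\<close>. The image of each generator splits into commuting
  blocks: conjugates of cyclically reduced elements whose support is connected in the complement graph.
  Two commuting blocks either have the same centraliser or commute because their parabolic closures
  do. Replacing every block by a generic conjugate of a generator inside its parabolic closure keeps
  all commutation and non-commutation relations. Hence the homomorphism factors through a partially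
  commutative group on the blocks, and since there are only finitely many possible commutation
  graphs of blocks, one of them receives an embedding of the group of \<open>\<Delta>\<close>. Taking the \<open>v\<close>-th copies of
  the conjugates in the inflation makes them distinct for distinct \<open>v\<close>, and suitable powers of
  finitely many distinct conjugates of generators generate the partially commutative group on their
  commutation graph, as one sees by passing to iterated cyclic covers.\<close>

section \<open>Words\<close>

text \<open>The homomorphisms obtained for different \<open>N\<close> are unrelated and their values
  have no bounded length, so no limit of them is available. What stays bounded is the set of pairs
  \<open>(J, R)\<close>: blocks are indexed by a generator of \<Delta> and a vertex of \<Gamma>, and
  injectivity on short words passes to the group on \<open>R\<close> because the homomorphism
  factors through it. Generic conjugates chosen independently could fail to commute although their
  blocks share a centraliser; blocks with equal centraliser and support therefore receive one common
  conjugate. This merging is what calls for the inflation: blocks of different generators may end up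
  with the same conjugate, and one copy of each vertex per generator of \<Delta>, hence
  \<open>n\<close> copies, separates them. Blocks of a single generator have disjoint supports and
  are separated by their vertices. Powers enter because pairwise non-commutation is weaker than
  freeness: in the free group on x and y, the elements x, y and y^-1 x y do not generate a free
  group of rank 3.\<close>

definition linv :: "'v \<times> bool \<Rightarrow> 'v \<times> bool" where
  "linv \<alpha> = (fst \<alpha>, \<not> snd \<alpha>)"

definition winv :: "('v \<times> bool) list \<Rightarrow> ('v \<times> bool) list" where
  "winv w = rev (map linv w)"

definition wpow :: "'l list \<Rightarrow> nat \<Rightarrow> 'l list" where
  "wpow w k = concat (replicate k w)"

text \<open>Conjugation acts from the right, so conjugators compose as in
  \<open>wconj k (wconj h w) = wconj (h @ k) w\<close>; the form agrees with the conjugates in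
  \<open>tame_embedding\<close>.\<close>

definition wconj :: "('v \<times> bool) list \<Rightarrow> ('v \<times> bool) list \<Rightarrow> ('v \<times> bool) list" where
  "wconj h w = winv h @ w @ h"

definition wsubst :: "('v \<Rightarrow> ('w \<times> bool) list) \<Rightarrow> ('v \<times> bool) list \<Rightarrow> ('w \<times> bool) list" where
  "wsubst \<sigma> w = concat (map (\<lambda>(x, b). if b then \<sigma> x else winv (\<sigma> x)) w)"

definition verts :: "('v \<times> bool) list \<Rightarrow> 'v set" where
  "verts w = fst ` set w"

definition restrict_word :: "'v set \<Rightarrow> ('v \<times> bool) list \<Rightarrow> ('v \<times> bool) list" where
  "restrict_word X w = filter (\<lambda>\<alpha>. fst \<alpha> \<in> X) w"

lemma linv_simps [simp]: "linv (x, b) = (x, \<not> b)" "linv (linv \<alpha>) = \<alpha>" "fst (linv \<alpha>) = fst \<alpha>"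
  "linv \<alpha> \<noteq> \<alpha>" "\<alpha> \<noteq> linv \<alpha>"
  by (auto simp: linv_def prod_eq_iff)

lemma winv_simps [simp]: "winv [] = []" "winv (u @ w) = winv w @ winv u"
  "winv (\<alpha> # w) = winv w @ [linv \<alpha>]" "winv (winv w) = w" "length (winv w) = length w"
  by (auto simp: winv_def rev_map o_def)

lemma wpow_simps [simp]: "wpow w 0 = []" "wpow w (Suc k) = w @ wpow w k" "wpow [] k = []"
  by (auto simp: wpow_def)

lemma wpow_add: "wpow w (i + j) = wpow w i @ wpow w j"
  by (simp add: wpow_def replicate_add)

lemma wpow_commutes: "wpow w k @ w = w @ wpow w k"
  by (induction k) auto

lemma wpow_mult: "wpow w (i * j) = wpow (wpow w i) j"
  by (induction j) (auto simp: wpow_add)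

lemma wpow_one [simp]: "wpow w (Suc 0) = w" "wpow w 1 = w"
  by (auto simp: wpow_def)

lemma winv_wpow: "winv (wpow w k) = wpow (winv w) k"
  by (induction k) (auto simp: wpow_commutes)

lemma length_wpow [simp]: "length (wpow w k) = k * length w"
  by (induction k) auto

lemma filter_wpow: "filter P (wpow w k) = wpow (filter P w) k"
  by (induction k) auto

lemma set_wpow: "set (wpow w k) \<subseteq> set w"
  by (induction k) auto

lemma verts_simps [simp]: "verts [] = {}" "verts (u @ w) = verts u \<union> verts w"
  "verts (\<alpha> # w) = insert (fst \<alpha>) (verts w)" "verts (winv w) = verts w"
  by (auto simp: verts_def winv_def image_image)

lemma verts_wpow: "verts (wpow w k) \<subseteq> verts w"
  using set_wpow[of w k] by (auto simp: verts_def)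

lemma verts_empty_iff [simp]: "verts w = {} \<longleftrightarrow> w = []"
  by (simp add: verts_def)

lemma finite_verts [simp]: "finite (verts w)"
  by (simp add: verts_def)

lemma verts_restrict_word: "verts (restrict_word X w) = verts w \<inter> X"
  by (auto simp: verts_def restrict_word_def)

lemma verts_subset_lists: "w \<in> lists (V \<times> UNIV) \<longleftrightarrow> verts w \<subseteq> V"
  by (induction w) auto

lemma wsubst_simps [simp]: "wsubst \<sigma> [] = []" "wsubst \<sigma> (u @ w) = wsubst \<sigma> u @ wsubst \<sigma> w"
  "wsubst \<sigma> (\<alpha> # w) = (if snd \<alpha> then \<sigma> (fst \<alpha>) else winv (\<sigma> (fst \<alpha>))) @ wsubst \<sigma> w"
  by (auto simp: wsubst_def split: prod.splits)

lemma wsubst_winv: "wsubst \<sigma> (winv w) = winv (wsubst \<sigma> w)"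
  by (induction w) auto

lemma wsubst_wconj: "wsubst \<sigma> (wconj h w) = wconj (wsubst \<sigma> h) (wsubst \<sigma> w)"
  by (simp add: wconj_def wsubst_winv)

lemma wsubst_wsubst: "wsubst \<sigma> (wsubst \<tau> w) = wsubst (\<lambda>x. wsubst \<sigma> (\<tau> x)) w"
  by (induction w) (auto simp: wsubst_winv)

lemma wsubst_cong: "(\<And>x. x \<in> verts w \<Longrightarrow> \<sigma> x = \<tau> x) \<Longrightarrow> wsubst \<sigma> w = wsubst \<tau> w"
  by (induction w) auto

lemma verts_wsubst: "verts (wsubst \<sigma> w) \<subseteq> (\<Union>x\<in>verts w. verts (\<sigma> x))"
  by (induction w) auto

lemma restrict_word_simps [simp]: "restrict_word X [] = []"
  "restrict_word X (u @ w) = restrict_word X u @ restrict_word X w"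
  "restrict_word X (\<alpha> # w) = (if fst \<alpha> \<in> X then \<alpha> # restrict_word X w else restrict_word X w)"
  by (auto simp: restrict_word_def)

lemma restrict_word_winv: "restrict_word X (winv w) = winv (restrict_word X w)"
  by (induction w) auto

lemma restrict_word_wpow: "restrict_word X (wpow w k) = wpow (restrict_word X w) k"
  by (simp add: restrict_word_def filter_wpow)

lemma restrict_word_wconj: "restrict_word X (wconj h w) = wconj (restrict_word X h) (restrict_word X w)"
  by (simp add: wconj_def restrict_word_winv)

lemma restrict_word_id: "verts w \<subseteq> X \<Longrightarrow> restrict_word X w = w"
  by (induction w) auto

lemma restrict_word_disjoint: "verts w \<inter> X = {} \<Longrightarrow> restrict_word X w = []"
  by (induction w) auto

text \<open>The vertex set is dropped: the chains in \<open>raag_rel\<close> may pass through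
  arbitrary letters, so there \<open>V\<close> restricts only the two end words.\<close>

definition raag_eq :: "('v \<times> 'v) set \<Rightarrow> ('v \<times> bool) list \<Rightarrow> ('v \<times> bool) list \<Rightarrow> bool" where
  "raag_eq E u w \<longleftrightarrow> (u, w) \<in> ({(a, c). raag_step E a c} \<union> {(a, c). raag_step E a c}\<inverse>)\<^sup>*"

definition wcomm :: "('v \<times> 'v) set \<Rightarrow> ('v \<times> bool) list \<Rightarrow> ('v \<times> bool) list \<Rightarrow> bool" where
  "wcomm E u w \<longleftrightarrow> raag_eq E (u @ w) (w @ u)"

lemma raag_eq_refl [simp, intro]: "raag_eq E u u"
  by (simp add: raag_eq_def)

lemma raag_eq_trans [trans]: "raag_eq E u v \<Longrightarrow> raag_eq E v w \<Longrightarrow> raag_eq E u w"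
  unfolding raag_eq_def by (rule rtrancl_trans)

lemma raag_eq_sym: "raag_eq E u w \<Longrightarrow> raag_eq E w u"
  unfolding raag_eq_def
  by (rule symD[OF sym_rtrancl]) (auto simp: sym_def)

lemma raag_eq_step: "raag_step E u w \<Longrightarrow> raag_eq E u w"
  unfolding raag_eq_def by blast

lemma raag_eq_invariant:
  assumes "raag_eq E u w" and "\<And>u w. raag_step E u w \<Longrightarrow> P u w"
    and "reflp P" and "symp P" and "transp P"
  shows "P u w"
  using assms(1) unfolding raag_eq_def
proof (induction rule: rtrancl_induct)
  case base
  then show ?case using assms(3) by (simp add: reflpD)
next
  case (step y z)
  then have "P y z" using assms(2) assms(4) by (auto dest: sympD)
  then show ?case using step.IH assms(5) by (meson transpD)
qed

lemma raag_eq_transfer: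
  assumes "raag_eq E u w" and "\<And>u w. raag_step E u w \<Longrightarrow> raag_eq E' (F u) (F w)"
  shows "raag_eq E' (F u) (F w)"
  by (rule raag_eq_invariant[OF assms(1), where P = "\<lambda>u w. raag_eq E' (F u) (F w)"])
     (auto intro: assms(2) reflpI sympI transpI raag_eq_sym raag_eq_trans)

lemma raag_step_context: "raag_step E u w \<Longrightarrow> raag_step E (a @ u @ b) (a @ w @ b)"
proof (induction rule: raag_step.induct)
  case (cancel u x b' w)
  show ?case using raag_step.cancel[of E "a @ u" x b' "w @ b"] by simp
next
  case (commute x y u b' c w)
  then show ?case using raag_step.commute[of x y E "a @ u" b' c "w @ b"] by simp
qed

lemma raag_eq_append: "raag_eq E u u' \<Longrightarrow> raag_eq E w w' \<Longrightarrow> raag_eq E (u @ w) (u' @ w')"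
proof -
  assume 1: "raag_eq E u u'" and 2: "raag_eq E w w'"
  have "raag_eq E (u @ w) (u' @ w)"
    by (rule raag_eq_transfer[OF 1, where F = "\<lambda>u. u @ w"])
       (metis append_Nil raag_eq_step raag_step_context)
  also have "raag_eq E (u' @ w) (u' @ w')"
    by (rule raag_eq_transfer[OF 2, where F = "\<lambda>w. u' @ w"])
       (metis append_Nil2 raag_eq_step raag_step_context)
  finally show ?thesis .
qed

lemma raag_eq_context: "raag_eq E u w \<Longrightarrow> raag_eq E (a @ u @ b) (a @ w @ b)"
  by (intro raag_eq_append) auto

lemma raag_eq_Cons: "raag_eq E u w \<Longrightarrow> raag_eq E (\<alpha> # u) (\<alpha> # w)"
  using raag_eq_context[of E u w "[\<alpha>]" "[]"] by simp

lemma raag_eq_cancel_letter: "raag_eq E (\<alpha> # linv \<alpha> # w) w"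
  using raag_step.cancel[of E "[]" "fst \<alpha>" "snd \<alpha>" w] by (auto simp: linv_def intro: raag_eq_step)

lemma raag_eq_winv_right: "raag_eq E (w @ winv w) []"
proof (induction w)
  case (Cons \<alpha> w)
  have "raag_eq E ([\<alpha>] @ (w @ winv w) @ [linv \<alpha>]) ([\<alpha>] @ [] @ [linv \<alpha>])"
    by (intro raag_eq_context Cons.IH)
  also have "raag_eq E ([\<alpha>] @ [] @ [linv \<alpha>]) []"
    using raag_eq_cancel_letter[of E \<alpha> "[]"] by simp
  finally show ?case by simp
qed simp

lemma raag_eq_winv_left: "raag_eq E (winv w @ w) []"
  using raag_eq_winv_right[of E "winv w"] by simp

lemma raag_eq_cancel_right: "raag_eq E (u @ w @ winv w @ v) (u @ v)"
  using raag_eq_context[OF raag_eq_winv_right, of E u w v] by simp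

lemma raag_eq_cancel_left: "raag_eq E (u @ winv w @ w @ v) (u @ v)"
  using raag_eq_context[OF raag_eq_winv_left, of E u w v] by simp

lemma raag_eq_left_cancel: "raag_eq E (a @ u) (a @ w) \<longleftrightarrow> raag_eq E u w"
proof
  assume "raag_eq E (a @ u) (a @ w)"
  then have "raag_eq E (winv a @ a @ u) (winv a @ a @ w)" by (rule raag_eq_append[OF raag_eq_refl])
  then show "raag_eq E u w"
    using raag_eq_cancel_left[of E "[]" a u] raag_eq_cancel_left[of E "[]" a w]
    by (metis append_Nil raag_eq_sym raag_eq_trans)
qed (auto intro: raag_eq_append)

lemma raag_eq_right_cancel: "raag_eq E (u @ a) (w @ a) \<longleftrightarrow> raag_eq E u w"
proof
  assume "raag_eq E (u @ a) (w @ a)"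
  then have "raag_eq E ((u @ a) @ winv a) ((w @ a) @ winv a)" by (rule raag_eq_append) auto
  then show "raag_eq E u w"
    using raag_eq_cancel_right[of E u a "[]"] raag_eq_cancel_right[of E w a "[]"]
    by (metis append_Nil2 append_assoc raag_eq_sym raag_eq_trans)
qed (auto intro: raag_eq_append)

lemma raag_eq_winv: "raag_eq E u w \<Longrightarrow> raag_eq E (winv u) (winv w)"
proof -
  assume *: "raag_eq E u w"
  have "raag_eq E (winv u @ u) (winv u @ w)" using * by (simp add: raag_eq_left_cancel)
  then have "raag_eq E (winv u @ w) []"
    by (meson raag_eq_sym raag_eq_trans raag_eq_winv_left)
  then have "raag_eq E (winv u @ w) (winv w @ w)"
    by (meson raag_eq_sym raag_eq_trans raag_eq_winv_left)
  then show ?thesis by (simp add: raag_eq_right_cancel)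
qed

lemma raag_eq_wpow: "raag_eq E u w \<Longrightarrow> raag_eq E (wpow u k) (wpow w k)"
  by (induction k) (auto intro: raag_eq_append)

lemma raag_eq_iff_cancel: "raag_eq E (winv u @ w) [] \<longleftrightarrow> raag_eq E u w"
  by (metis append_Nil2 raag_eq_left_cancel raag_eq_sym raag_eq_trans raag_eq_winv_left)

section \<open>Commutation and conjugation\<close>

lemma wcomm_sym: "wcomm E u w \<longleftrightarrow> wcomm E w u"
  by (auto simp: wcomm_def intro: raag_eq_sym)

lemma wcomm_cong: "raag_eq E u u' \<Longrightarrow> raag_eq E w w' \<Longrightarrow> wcomm E u w \<longleftrightarrow> wcomm E u' w'"
  unfolding wcomm_def by (meson raag_eq_append raag_eq_sym raag_eq_trans)

lemma wcomm_refl [simp]: "wcomm E u u"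
  by (simp add: wcomm_def)

lemma wcomm_Nil [simp]: "wcomm E u []" "wcomm E [] u"
  by (auto simp: wcomm_def)

lemma wcomm_append: "wcomm E u v \<Longrightarrow> wcomm E u w \<Longrightarrow> wcomm E u (v @ w)"
proof -
  assume 1: "wcomm E u v" and 2: "wcomm E u w"
  have "raag_eq E (u @ v @ w) (v @ u @ w)"
    using 1 raag_eq_right_cancel[of E "u @ v" w "v @ u"] by (simp add: wcomm_def)
  also have "raag_eq E (v @ u @ w) (v @ w @ u)"
    using 2 by (simp only: raag_eq_left_cancel wcomm_def)
  finally show ?thesis by (simp add: wcomm_def)
qed

lemma wcomm_append2: "wcomm E v u \<Longrightarrow> wcomm E w u \<Longrightarrow> wcomm E (v @ w) u"
  using wcomm_append wcomm_sym by metis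

lemma wcomm_winv: "wcomm E u w \<Longrightarrow> wcomm E u (winv w)"
proof -
  assume "wcomm E u w"
  then have "raag_eq E (winv w @ (u @ w) @ winv w) (winv w @ (w @ u) @ winv w)"
    unfolding wcomm_def by (rule raag_eq_context)
  moreover have "raag_eq E (winv w @ (u @ w) @ winv w) (winv w @ u)"
    using raag_eq_cancel_right[of E "winv w @ u" w "[]"] by simp
  moreover have "raag_eq E (winv w @ (w @ u) @ winv w) (u @ winv w)"
    using raag_eq_cancel_left[of E "[]" w "u @ winv w"] by simp
  ultimately show ?thesis unfolding wcomm_def by (meson raag_eq_sym raag_eq_trans)
qed

lemma wcomm_winv_iff [simp]: "wcomm E u (winv w) \<longleftrightarrow> wcomm E u w" "wcomm E (winv u) w \<longleftrightarrow> wcomm E u w"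
  by (metis wcomm_winv wcomm_sym winv_simps(4))+

lemma wcomm_wpow: "wcomm E u w \<Longrightarrow> wcomm E u (wpow w k)"
  by (induction k) (auto intro: wcomm_append)

lemma wcomm_wpow2: "wcomm E u w \<Longrightarrow> wcomm E (wpow u i) (wpow w k)"
  by (metis wcomm_sym wcomm_wpow)

lemma wcomm_letters:
  "(\<And>\<alpha>. \<alpha> \<in> set w \<Longrightarrow> wcomm E u [(fst \<alpha>, True)]) \<Longrightarrow> wcomm E u w"
proof (induction w)
  case (Cons \<alpha> w)
  have "wcomm E u [\<alpha>]"
  proof (cases "snd \<alpha>")
    case True
    then show ?thesis using Cons.prems[of \<alpha>] by (metis list.set_intros(1) prod.collapse)
  next
    case False
    then have "[\<alpha>] = winv [(fst \<alpha>, True)]" by (simp add: prod_eq_iff)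
    then show ?thesis using Cons.prems[of \<alpha>] by (metis list.set_intros(1) wcomm_winv)
  qed
  then show ?case using Cons wcomm_append[of E u "[\<alpha>]" w] by auto
qed simp

lemma wcomm_edge: "(x, y) \<in> E \<Longrightarrow> wcomm E [(x, b)] [(y, c)]"
  using raag_step.commute[of x y E "[]" b c "[]"] by (auto simp: wcomm_def intro: raag_eq_step)

lemma wcomm_verts:
  assumes "\<And>x y. x \<in> verts u \<Longrightarrow> y \<in> verts w \<Longrightarrow> (x, y) \<in> E"
  shows "wcomm E u w"
proof (rule wcomm_letters)
  fix \<alpha> assume "\<alpha> \<in> set w"
  then have w: "fst \<alpha> \<in> verts w" by (auto simp: verts_def)
  have "wcomm E [(fst \<alpha>, True)] u"
    by (rule wcomm_letters) (use assms w in \<open>force simp: verts_def wcomm_sym intro: wcomm_edge\<close>)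
  then show "wcomm E u [(fst \<alpha>, True)]" by (simp add: wcomm_sym)
qed

lemma wpow_append_commuting:
  "wcomm E u w \<Longrightarrow> raag_eq E (wpow (u @ w) k) (wpow u k @ wpow w k)"
proof (induction k)
  case (Suc k)
  have "raag_eq E (u @ w @ wpow (u @ w) k) (u @ w @ wpow u k @ wpow w k)"
    using Suc by (simp add: raag_eq_left_cancel)
  also have "raag_eq E (u @ w @ wpow u k @ wpow w k) (u @ wpow u k @ w @ wpow w k)"
  proof -
    have "raag_eq E (w @ wpow u k) (wpow u k @ w)"
      using wcomm_wpow[of E w u k] Suc.prems by (simp add: wcomm_sym[of E u] flip: wcomm_def)
    from raag_eq_context[OF this, of u "wpow w k"] show ?thesis by simp
  qed
  finally show ?case by simp
qed simp

lemma wconj_simps: "wconj [] w = w" "wconj h [] = winv h @ h" "wconj k (wconj h w) = wconj (h @ k) w"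
  "winv (wconj h w) = wconj h (winv w)"
  by (auto simp: wconj_def)

lemma verts_wconj: "verts (wconj h w) = verts h \<union> verts w"
  by (auto simp: wconj_def)

lemma wconj_cong: "raag_eq E h k \<Longrightarrow> raag_eq E u w \<Longrightarrow> raag_eq E (wconj h u) (wconj k w)"
  unfolding wconj_def by (intro raag_eq_append raag_eq_winv)

lemma wconj_append: "raag_eq E (wconj h (u @ w)) (wconj h u @ wconj h w)"
  using raag_eq_cancel_right[of E "winv h @ u" h "w @ h"] by (auto simp: wconj_def intro: raag_eq_sym)

lemma wconj_wpow: "raag_eq E (wconj h (wpow u k)) (wpow (wconj h u) k)"
proof (induction k)
  case 0
  then show ?case by (simp add: wconj_simps raag_eq_winv_left)
next
  case (Suc k)
  then show ?case
    using raag_eq_trans[OF wconj_append raag_eq_append[OF raag_eq_refl Suc]] by simp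
qed

lemma wconj_winv_cancel: "raag_eq E (wconj (winv h) (wconj h u)) u" "raag_eq E (wconj h (wconj (winv h) u)) u"
proof -
  have *: "raag_eq E (wconj k (wconj (winv k) u)) u" for k
  proof -
    have "raag_eq E (winv k @ k @ (u @ winv k @ k)) (u @ winv k @ k)"
      using raag_eq_cancel_left[of E "[]" k] by simp
    also have "raag_eq E (u @ winv k @ k) u"
      using raag_eq_cancel_left[of E u k "[]"] by simp
    finally show ?thesis by (simp add: wconj_def)
  qed
  show "raag_eq E (wconj h (wconj (winv h) u)) u" by (rule *)
  show "raag_eq E (wconj (winv h) (wconj h u)) u" using *[of "winv h"] by simp
qed

lemma raag_eq_wconj_iff: "raag_eq E (wconj h u) (wconj h w) \<longleftrightarrow> raag_eq E u w"
  by (simp add: wconj_def raag_eq_left_cancel raag_eq_right_cancel)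

lemma raag_eq_wconj_move: "raag_eq E (wconj h u) w \<longleftrightarrow> raag_eq E u (wconj (winv h) w)"
proof -
  have "raag_eq E (wconj h u) w \<longleftrightarrow> raag_eq E (wconj h u) (wconj h (wconj (winv h) w))"
    using wconj_winv_cancel(2)[of E h w] raag_eq_sym raag_eq_trans by blast
  then show ?thesis by (simp only: raag_eq_wconj_iff)
qed

lemma wcomm_wconj_iff: "wcomm E (wconj h u) (wconj h w) \<longleftrightarrow> wcomm E u w"
proof -
  have "wcomm E (wconj h u) (wconj h w) \<longleftrightarrow> raag_eq E (wconj h (u @ w)) (wconj h (w @ u))"
    unfolding wcomm_def
    using wconj_append[of E h u w] wconj_append[of E h w u] raag_eq_sym raag_eq_trans by blast
  then show ?thesis by (simp only: raag_eq_wconj_iff wcomm_def)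
qed

lemma wcomm_wconj_move: "wcomm E (wconj h u) w \<longleftrightarrow> wcomm E u (wconj (winv h) w)"
  using wcomm_cong[OF raag_eq_refl[of E "wconj h u"] wconj_winv_cancel(2)[of E h w]]
  by (simp only: wcomm_wconj_iff)

lemma wconj_commuting: "wcomm E h u \<Longrightarrow> raag_eq E (wconj h u) u"
  unfolding wconj_def wcomm_def
proof -
  assume "raag_eq E (h @ u) (u @ h)"
  then have "raag_eq E (winv h @ u @ h) (winv h @ h @ u)"
    by (simp add: raag_eq_left_cancel raag_eq_sym)
  also have "raag_eq E (winv h @ h @ u) u"
    using raag_eq_cancel_left[of E "[]" h u] by simp
  finally show "raag_eq E (winv h @ u @ h) u" .
qed

lemma wcomm_iff_wconj: "wcomm E h u \<longleftrightarrow> raag_eq E (wconj h u) u"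
proof
  assume "raag_eq E (wconj h u) u"
  then have "raag_eq E (h @ winv h @ u @ h) (h @ u)"
    by (simp add: raag_eq_left_cancel wconj_def)
  then show "wcomm E h u"
    unfolding wcomm_def
    using raag_eq_cancel_right[of E "[]" h "u @ h"] by (metis append_Nil raag_eq_sym raag_eq_trans)
qed (rule wconj_commuting)

lemma wcomm_transfer:
  assumes "\<And>u w. raag_eq E u w \<Longrightarrow> raag_eq E' (F u) (F w)" and "\<And>u w. F (u @ w) = F u @ F w"
    and "wcomm E u w"
  shows "wcomm E' (F u) (F w)"
  using assms unfolding wcomm_def by metis

section \<open>Homomorphisms\<close>

lemma raag_eq_wsubst:
  assumes "\<And>x y. (x, y) \<in> E \<Longrightarrow> wcomm E' (\<sigma> x) (\<sigma> y)" and "raag_eq E u w"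
  shows "raag_eq E' (wsubst \<sigma> u) (wsubst \<sigma> w)"
proof (rule raag_eq_transfer[OF assms(2)])
  fix u w assume "raag_step E u w"
  then show "raag_eq E' (wsubst \<sigma> u) (wsubst \<sigma> w)"
  proof cases
    case (cancel u' x b w')
    have "raag_eq E' (wsubst \<sigma> [(x, b), (x, \<not> b)]) []"
      using raag_eq_winv_left raag_eq_winv_right by (cases b) auto
    from raag_eq_context[OF this, of "wsubst \<sigma> u'" "wsubst \<sigma> w'"] show ?thesis
      using cancel by simp
  next
    case (commute x y u' b c w')
    let ?s = "\<lambda>\<alpha>. if snd \<alpha> then \<sigma> (fst \<alpha>) else winv (\<sigma> (fst \<alpha>))"
    have "wcomm E' (?s (x, b)) (?s (y, c))"
      using assms(1)[OF commute(3)] by auto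
    then have "raag_eq E' (?s (x, b) @ ?s (y, c)) (?s (y, c) @ ?s (x, b))"
      by (simp add: wcomm_def)
    from raag_eq_context[OF this, of "wsubst \<sigma> u'" "wsubst \<sigma> w'"] show ?thesis
      using commute by simp
  qed
qed

lemma wcomm_wsubst:
  assumes "\<And>x y. (x, y) \<in> E \<Longrightarrow> wcomm E' (\<sigma> x) (\<sigma> y)" and "wcomm E u w"
  shows "wcomm E' (wsubst \<sigma> u) (wsubst \<sigma> w)"
  by (rule wcomm_transfer[where F = "wsubst \<sigma>", OF raag_eq_wsubst wsubst_simps(2) assms(2)])
     (use assms(1) in auto)

lemma wsubst_raag_eq_cong:
  assumes "\<And>x. x \<in> verts w \<Longrightarrow> raag_eq E (\<sigma> x) (\<tau> x)"
  shows "raag_eq E (wsubst \<sigma> w) (wsubst \<tau> w)"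
  using assms by (induction w) (auto intro!: raag_eq_append raag_eq_winv)

text \<open>Deleting the letters outside \<open>X\<close> is a retraction onto the subgroup
  generated by \<open>X\<close>: each step either survives the deletion or turns into an
  equality.\<close>

lemma raag_eq_restrict_word:
  assumes "raag_eq E u w"
  shows "raag_eq E (restrict_word X u) (restrict_word X w)"
proof (rule raag_eq_transfer[OF assms])
  fix u w assume "raag_step E u w"
  then show "raag_eq E (restrict_word X u) (restrict_word X w)"
  proof cases
    case (cancel u' x b w')
    then show ?thesis
      using raag_step.cancel[of E "restrict_word X u'" x b "restrict_word X w'"]
      by (auto intro: raag_eq_step)
  next
    case (commute x y u' b c w')
    then show ?thesis
      using raag_step.commute[of x y E "restrict_word X u'" b c "restrict_word X w'"]
      by (auto intro: raag_eq_step)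
  qed
qed

lemma restrict_word_retract: "raag_eq E u w \<Longrightarrow> verts w \<subseteq> X \<Longrightarrow> raag_eq E (restrict_word X u) w"
  using raag_eq_restrict_word[of E u w X] by (simp add: restrict_word_id)

definition exponent :: "'v \<Rightarrow> ('v \<times> bool) list \<Rightarrow> int" where
  "exponent x w = (\<Sum>\<alpha>\<leftarrow>w. if fst \<alpha> = x then (if snd \<alpha> then 1 else -1) else 0)"

lemma exponent_simps [simp]: "exponent x [] = 0" "exponent x (u @ w) = exponent x u + exponent x w"
  "exponent x (\<alpha> # w) = (if fst \<alpha> = x then (if snd \<alpha> then 1 else -1) else 0) + exponent x w"
  by (auto simp: exponent_def)

lemma exponent_winv [simp]: "exponent x (winv w) = - exponent x w"
  by (induction w) (auto simp: linv_def)

lemma exponent_wpow [simp]: "exponent x (wpow w k) = int k * exponent x w"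
  by (induction k) (auto simp: algebra_simps)

lemma exponent_wconj [simp]: "exponent x (wconj h w) = exponent x w"
  by (simp add: wconj_def)

lemma raag_eq_exponent: "raag_eq E u w \<Longrightarrow> exponent x u = exponent x w"
  by (rule raag_eq_invariant[where P = "\<lambda>u w. exponent x u = exponent x w"])
     (auto elim!: raag_step.cases intro: reflpI sympI transpI)

section \<open>Traces and normal forms\<close>

text \<open>A trace (a word modulo commutations of adjacent letters) is determined by its projections
  to the pairs of letters that do not commute.\<close>

definition proj :: "'l \<Rightarrow> 'l \<Rightarrow> 'l list \<Rightarrow> 'l list" where
  "proj \<alpha> \<beta> w = filter (\<lambda>\<gamma>. \<gamma> = \<alpha> \<or> \<gamma> = \<beta>) w"

definition teq :: "('v \<times> 'v) set \<Rightarrow> ('v \<times> bool) list \<Rightarrow> ('v \<times> bool) list \<Rightarrow> bool" where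
  "teq E u w \<longleftrightarrow> (\<forall>\<alpha> \<beta>. (fst \<alpha>, fst \<beta>) \<notin> E \<longrightarrow> proj \<alpha> \<beta> u = proj \<alpha> \<beta> w)"

text \<open>Pulls the first \<open>\<beta>\<close> to the front past commuting letters and deletes
  it; \<open>None\<close> means that a letter blocks the way or that \<open>\<beta>\<close> does not
  occur.\<close>

fun strip :: "('v \<times> 'v) set \<Rightarrow> 'v \<times> bool \<Rightarrow> ('v \<times> bool) list \<Rightarrow> ('v \<times> bool) list option" where
  "strip E \<beta> [] = None"
| "strip E \<beta> (\<gamma> # w) = (if \<gamma> = \<beta> then Some w
     else if (fst \<beta>, fst \<gamma>) \<in> E then map_option ((#) \<gamma>) (strip E \<beta> w) else None)"

text \<open>Left multiplication by a letter on reduced traces. As in van der Waerden's argument, the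
  defining relations are checked for this action, which makes \<open>nf\<close> an invariant of
  group elements up to \<open>teq\<close>.\<close>

definition act :: "('v \<times> 'v) set \<Rightarrow> 'v \<times> bool \<Rightarrow> ('v \<times> bool) list \<Rightarrow> ('v \<times> bool) list" where
  "act E \<alpha> w = (case strip E (linv \<alpha>) w of None \<Rightarrow> \<alpha> # w | Some z \<Rightarrow> z)"

definition nf :: "('v \<times> 'v) set \<Rightarrow> ('v \<times> bool) list \<Rightarrow> ('v \<times> bool) list" where
  "nf E w = foldr (act E) w []"

definition red :: "('v \<times> 'v) set \<Rightarrow> ('v \<times> bool) list \<Rightarrow> bool" where
  "red E w \<longleftrightarrow> \<not> (\<exists>u \<beta> z. teq E w (u @ \<beta> # linv \<beta> # z))"

definition geo :: "('v \<times> 'v) set \<Rightarrow> ('v \<times> bool) list \<Rightarrow> bool" where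
  "geo E u \<longleftrightarrow> (\<forall>w. raag_eq E w u \<longrightarrow> length u \<le> length w)"

lemma proj_simps [simp]: "proj \<alpha> \<beta> [] = []" "proj \<alpha> \<beta> (u @ w) = proj \<alpha> \<beta> u @ proj \<alpha> \<beta> w"
  "proj \<alpha> \<beta> (\<gamma> # w) = (if \<gamma> = \<alpha> \<or> \<gamma> = \<beta> then \<gamma> # proj \<alpha> \<beta> w else proj \<alpha> \<beta> w)"
  by (auto simp: proj_def)

lemma teqD: "teq E u w \<Longrightarrow> (fst \<alpha>, fst \<beta>) \<notin> E \<Longrightarrow> proj \<alpha> \<beta> u = proj \<alpha> \<beta> w"
  unfolding teq_def by blast

lemma teq_refl [simp, intro]: "teq E u u"
  by (simp add: teq_def)

lemma teq_sym: "teq E u w \<Longrightarrow> teq E w u"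
  by (simp add: teq_def)

lemma teq_trans [trans]: "teq E u v \<Longrightarrow> teq E v w \<Longrightarrow> teq E u w"
  by (simp add: teq_def)

lemma teq_left_cancel [simp]: "teq E (a @ u) (a @ w) \<longleftrightarrow> teq E u w"
  by (simp add: teq_def)

lemma teq_Cons_cancel [simp]: "teq E (\<alpha> # u) (\<alpha> # w) \<longleftrightarrow> teq E u w"
  using teq_left_cancel[of E "[\<alpha>]"] by simp

section \<open>Normal forms from the action of letters on reduced traces\<close>

locale pc_graph =
  fixes E :: "('v \<times> 'v) set"
  assumes sym_E: "sym E" and irrefl_E: "(x, x) \<notin> E"
begin

lemma teq_swap: "(fst \<beta>, fst \<gamma>) \<in> E \<Longrightarrow> teq E (\<beta> # \<gamma> # w) (\<gamma> # \<beta> # w)"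
  using sym_E irrefl_E by (auto simp: teq_def dest: symD)

lemma teq_mset: "teq E u w \<Longrightarrow> mset u = mset w"
proof (rule multiset_eqI)
  fix \<alpha> assume "teq E u w"
  then have "proj \<alpha> \<alpha> u = proj \<alpha> \<alpha> w" using irrefl_E teqD by blast
  moreover have "count (mset v) \<alpha> = length (proj \<alpha> \<alpha> v)" for v
    by (induction v) auto
  ultimately show "count (mset u) \<alpha> = count (mset w) \<alpha>" by simp
qed

lemma teq_length: "teq E u w \<Longrightarrow> length u = length w"
  by (metis size_mset teq_mset)

lemma teq_length_filter: "teq E u w \<Longrightarrow> length (filter P u) = length (filter P w)"
  by (metis mset_filter size_mset teq_mset)

lemma strip_Some_teq: "strip E \<beta> w = Some z \<Longrightarrow> teq E w (\<beta> # z)"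
proof (induction w arbitrary: z)
  case (Cons \<gamma> w)
  show ?case
  proof (cases "\<gamma> = \<beta>")
    case False
    then obtain z' where z': "strip E \<beta> w = Some z'" "z = \<gamma> # z'" and e: "(fst \<beta>, fst \<gamma>) \<in> E"
      using Cons.prems by (auto split: if_splits)
    have "teq E (\<gamma> # w) (\<gamma> # \<beta> # z')" using Cons.IH[OF z'(1)] by simp
    also have "teq E (\<gamma> # \<beta> # z') (\<beta> # \<gamma> # z')"
      by (rule teq_swap) (use e sym_E in \<open>auto dest: symD\<close>)
    finally show ?thesis using z'(2) by simp
  qed (use Cons.prems in auto)
qed simp

text \<open>A letter in front of the first \<open>\<beta>\<close> that does not commute with it
  would come first in the projection to the pair, which starts with \<open>\<beta>\<close> by
  assumption.\<close>

lemma strip_exists: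
  assumes "\<And>\<gamma>. (fst \<beta>, fst \<gamma>) \<notin> E \<Longrightarrow> \<exists>r. proj \<beta> \<gamma> w = \<beta> # r"
  shows "\<exists>z. strip E \<beta> w = Some z"
  using assms
proof (induction w)
  case Nil
  then show ?case using irrefl_E by fastforce
next
  case (Cons \<gamma> w)
  consider "\<gamma> = \<beta>" | "\<gamma> \<noteq> \<beta>" "(fst \<beta>, fst \<gamma>) \<in> E" | "\<gamma> \<noteq> \<beta>" "(fst \<beta>, fst \<gamma>) \<notin> E" by blast
  then show ?case
  proof cases
    case 2
    have "\<exists>r. proj \<beta> \<delta> w = \<beta> # r" if "(fst \<beta>, fst \<delta>) \<notin> E" for \<delta>
    proof -
      have "\<gamma> \<noteq> \<delta>" using 2 that by auto
      then show ?thesis using Cons.prems[OF that] 2 by auto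
    qed
    then show ?thesis using Cons.IH 2 by auto
  next
    case 3
    then show ?thesis using Cons.prems[OF 3(2)] by auto
  qed auto
qed

lemma teq_strip:
  assumes "teq E w (\<beta> # z)"
  obtains z' where "strip E \<beta> w = Some z'" "teq E z' z"
proof -
  have "\<exists>r. proj \<beta> \<gamma> w = \<beta> # r" if "(fst \<beta>, fst \<gamma>) \<notin> E" for \<gamma>
    using teqD[OF assms that] by auto
  then obtain z' where z': "strip E \<beta> w = Some z'" using strip_exists by blast
  have "teq E (\<beta> # z') (\<beta> # z)" using strip_Some_teq[OF z'] assms by (meson teq_sym teq_trans)
  then show ?thesis using that z' by simp
qed

lemma teq_strip_Some:
  assumes "teq E u w" "strip E \<beta> u = Some z"
  obtains z' where "strip E \<beta> w = Some z'" "teq E z z'"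
proof -
  have "teq E w (\<beta> # z)" using teq_trans[OF teq_sym[OF assms(1)] strip_Some_teq[OF assms(2)]] .
  then obtain z' where "strip E \<beta> w = Some z'" "teq E z' z" by (rule teq_strip)
  then show ?thesis using that teq_sym by blast
qed

lemma teq_strip_None: "teq E u w \<Longrightarrow> strip E \<beta> u = None \<Longrightarrow> strip E \<beta> w = None"
  by (cases "strip E \<beta> w") (auto elim: teq_strip_Some[OF teq_sym])

lemma strip_commuting: "(fst \<alpha>, fst \<gamma>) \<in> E \<Longrightarrow> strip E \<alpha> (\<gamma> # w) = map_option ((#) \<gamma>) (strip E \<alpha> w)"
  using irrefl_E by auto

lemma strip_append:
  "strip E \<alpha> (u @ w) = (case strip E \<alpha> u of Some u' \<Rightarrow> Some (u' @ w)
     | None \<Rightarrow> if \<forall>\<gamma>\<in>set u. (fst \<alpha>, fst \<gamma>) \<in> E then map_option ((@) u) (strip E \<alpha> w) else None)"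
proof (induction u)
  case Nil
  then show ?case by (cases "strip E \<alpha> w") auto
next
  case (Cons \<gamma> u)
  then show ?case by (cases "strip E \<alpha> w") (auto split: option.splits)
qed

lemma teq_raag_eq: "teq E u w \<Longrightarrow> raag_eq E u w"
proof (induction u arbitrary: w)
  case Nil
  then show ?case using teq_length[of "[]" w] by simp
next
  case (Cons \<beta> u)
  have strip_eq: "strip E \<beta> w = Some z \<Longrightarrow> raag_eq E w (\<beta> # z)" for w z
  proof (induction w arbitrary: z)
    case (Cons \<gamma> w)
    show ?case
    proof (cases "\<gamma> = \<beta>")
      case False
      then obtain z' where z': "strip E \<beta> w = Some z'" "z = \<gamma> # z'" and e: "(fst \<beta>, fst \<gamma>) \<in> E"
        using Cons.prems by (auto split: if_splits)
      have "raag_eq E (\<gamma> # w) (\<gamma> # \<beta> # z')" using Cons.IH[OF z'(1)] by (rule raag_eq_Cons)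
      also have "raag_eq E (\<gamma> # \<beta> # z') (\<beta> # \<gamma> # z')"
        using raag_eq_append[OF wcomm_edge[of "fst \<gamma>" "fst \<beta>" E "snd \<gamma>" "snd \<beta>", unfolded wcomm_def] raag_eq_refl[of E z']]
          e sym_E by (auto dest: symD)
      finally show ?thesis using z'(2) by simp
    qed (use Cons.prems in auto)
  qed simp
  obtain z where z: "strip E \<beta> w = Some z" "teq E z u"
    using teq_strip Cons.prems teq_sym by blast
  have "raag_eq E (\<beta> # u) (\<beta> # z)" using Cons.IH z(2) teq_sym raag_eq_Cons by blast
  then show ?case using strip_eq[OF z(1)] raag_eq_sym raag_eq_trans by blast
qed

lemma act_teq: "teq E u w \<Longrightarrow> teq E (act E \<alpha> u) (act E \<alpha> w)"
proof (cases "strip E (linv \<alpha>) u")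
  case None
  assume "teq E u w"
  then show ?thesis using None teq_strip_None[of u w "linv \<alpha>"] by (simp add: act_def)
next
  case (Some z)
  assume *: "teq E u w"
  obtain z' where "strip E (linv \<alpha>) w = Some z'" "teq E z z'"
    using teq_strip_Some[OF * Some] .
  then show ?thesis using Some by (simp add: act_def)
qed

lemma act_red:
  assumes "red E w"
  shows "red E (act E \<alpha> w)"
proof (cases "strip E (linv \<alpha>) w")
  case None
  \<comment> \<open>\<open>\<alpha>\<close> heads the trace on the right, so it sits in
    \<open>u\<close>, equals \<open>\<beta>\<close>, or sits in \<open>z\<close> and commutes with
    \<open>\<beta>\<close>. The first and last case leave the cancelling pair in \<open>w\<close>;
    the middle one makes \<open>linv \<alpha>\<close> strippable from \<open>w\<close>.\<close>
  have False if h: "teq E (\<alpha> # w) (u @ \<beta> # linv \<beta> # z)" for u \<beta> z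
  proof -
    obtain z' where z': "strip E \<alpha> (u @ \<beta> # linv \<beta> # z) = Some z'" "teq E z' w"
      using teq_strip[OF teq_sym[OF h]] .
    show False
    proof (cases "strip E \<alpha> u")
      case (Some u')
      then have "teq E w (u' @ \<beta> # linv \<beta> # z)" using z' by (auto simp: strip_append intro: teq_sym)
      then show False using assms unfolding red_def by blast
    next
      case N: None
      then have all: "\<forall>\<gamma>\<in>set u. (fst \<alpha>, fst \<gamma>) \<in> E"
        and s: "map_option ((@) u) (strip E \<alpha> (\<beta> # linv \<beta> # z)) = Some z'"
        using z'(1) by (auto simp: strip_append split: if_splits)
      show False
      proof (cases "\<beta> = \<alpha>")
        case True
        then have "teq E w (u @ linv \<alpha> # z)" using s z'(2) by (auto intro: teq_sym)
        moreover have "strip E (linv \<alpha>) (u @ linv \<alpha> # z) \<noteq> None"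
          using all by (auto simp: strip_append split: option.splits)
        ultimately show False using teq_strip_None[OF _ None] by simp
      next
        case False
        then have e: "(fst \<alpha>, fst \<beta>) \<in> E" using s by (auto split: if_splits)
        then have "strip E \<alpha> (\<beta> # linv \<beta> # z) = map_option (\<lambda>z. \<beta> # linv \<beta> # z) (strip E \<alpha> z)"
          by (simp add: strip_commuting option.map_comp comp_def del: strip.simps)
        then obtain z2 where "z' = u @ \<beta> # linv \<beta> # z2" using s by auto
        then show False using z'(2) assms teq_sym unfolding red_def by blast
      qed
    qed
  qed
  then show ?thesis using None by (auto simp: act_def red_def)
next
  case (Some z)
  have "teq E w (linv \<alpha> # z)" using strip_Some_teq[OF Some] .
  moreover have "\<not> teq E z (u @ \<beta> # linv \<beta> # y)" for u \<beta> y
  proof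
    assume "teq E z (u @ \<beta> # linv \<beta> # y)"
    then have "teq E (linv \<alpha> # z) ((linv \<alpha> # u) @ \<beta> # linv \<beta> # y)" by simp
    then show False using assms calculation teq_trans unfolding red_def by blast
  qed
  ultimately show ?thesis using Some by (simp add: act_def red_def)
qed

lemma act_linv: "red E w \<Longrightarrow> teq E (act E \<alpha> (act E (linv \<alpha>) w)) w"
proof (cases "strip E \<alpha> w")
  case None
  then show ?thesis by (simp add: act_def)
next
  case (Some z)
  assume r: "red E w"
  have w: "teq E w (\<alpha> # z)" using strip_Some_teq[OF Some] .
  have "strip E (linv \<alpha>) z = None"
  proof (rule ccontr)
    assume "strip E (linv \<alpha>) z \<noteq> None"
    then obtain y where "teq E z (linv \<alpha> # y)" using strip_Some_teq by blast
    then have "teq E w ([] @ \<alpha> # linv \<alpha> # y)" using w teq_trans by fastforce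
    then show False using r unfolding red_def by blast
  qed
  then show ?thesis using Some w teq_sym by (simp add: act_def)
qed

lemma act_commute:
  assumes e: "(fst \<alpha>, fst \<beta>) \<in> E"
  shows "teq E (act E \<alpha> (act E \<beta> w)) (act E \<beta> (act E \<alpha> w))"
proof -
  have e': "(fst \<beta>, fst \<alpha>) \<in> E" using e sym_E by (auto dest: symD)
  have mixed: "teq E (act E \<alpha> (act E \<beta> w)) (act E \<beta> (act E \<alpha> w))"
    if e: "(fst \<alpha>, fst \<beta>) \<in> E" and e': "(fst \<beta>, fst \<alpha>) \<in> E"
      and z: "strip E (linv \<beta>) w = Some z" and n: "strip E (linv \<alpha>) w = None" for \<alpha> \<beta> z
  proof -
    have "strip E (linv \<alpha>) (linv \<beta> # z) = None"
      using teq_strip_None[OF strip_Some_teq[OF z] n] .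
    then have "strip E (linv \<alpha>) z = None" using e by (simp add: strip_commuting del: strip.simps)
    moreover have "strip E (linv \<beta>) (\<alpha> # w) = Some (\<alpha> # z)"
      using e' z by (simp add: strip_commuting del: strip.simps)
    ultimately show ?thesis using z n by (simp add: act_def)
  qed
  consider "strip E (linv \<alpha>) w = None" "strip E (linv \<beta>) w = None"
    | z where "strip E (linv \<alpha>) w = None" "strip E (linv \<beta>) w = Some z"
    | y where "strip E (linv \<alpha>) w = Some y" "strip E (linv \<beta>) w = None"
    | y z where "strip E (linv \<alpha>) w = Some y" "strip E (linv \<beta>) w = Some z"
    by fastforce
  then show ?thesis
  proof cases
    case 1
    then have "strip E (linv \<alpha>) (\<beta> # w) = None" "strip E (linv \<beta>) (\<alpha> # w) = None"
      using e e' by (simp_all add: strip_commuting del: strip.simps)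
    then show ?thesis using 1 teq_swap[OF e] by (simp add: act_def)
  next
    case 2
    then show ?thesis using mixed[OF e e'] by blast
  next
    case 3
    then show ?thesis using mixed[OF e' e] teq_sym by blast
  next
    case 4
    have wy: "teq E w (linv \<alpha> # y)" and wz: "teq E w (linv \<beta> # z)"
      using 4 strip_Some_teq by auto
    have "strip E (linv \<alpha>) (linv \<beta> # z) \<noteq> None" "strip E (linv \<beta>) (linv \<alpha> # y) \<noteq> None"
      using teq_strip_None[OF teq_sym[OF wz]] teq_strip_None[OF teq_sym[OF wy]] 4
      by (metis option.distinct(1))+
    then obtain z2 y2 where s: "strip E (linv \<alpha>) z = Some z2" "strip E (linv \<beta>) y = Some y2"
      using e e' by (auto simp: strip_commuting simp del: strip.simps)
    have "teq E w (linv \<beta> # linv \<alpha> # z2)" "teq E w (linv \<alpha> # linv \<beta> # y2)"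
      using teq_trans[OF wz, of "linv \<beta> # linv \<alpha> # z2"] teq_trans[OF wy, of "linv \<alpha> # linv \<beta> # y2"]
        strip_Some_teq[OF s(1)] strip_Some_teq[OF s(2)] by simp_all
    moreover have "teq E (linv \<beta> # linv \<alpha> # z2) (linv \<alpha> # linv \<beta> # z2)"
      by (rule teq_swap) (use e' in simp)
    ultimately have "teq E (linv \<alpha> # linv \<beta> # z2) (linv \<alpha> # linv \<beta> # y2)"
      by (meson teq_sym teq_trans)
    then show ?thesis using 4 s by (simp add: act_def)
  qed
qed

lemma foldr_act_teq: "teq E r s \<Longrightarrow> teq E (foldr (act E) u r) (foldr (act E) u s)"
  by (induction u) (auto intro: act_teq)

lemma red_nf: "red E (nf E w)"
proof (induction w)
  case Nil
  have "\<not> teq E [] (u @ \<beta> # linv \<beta> # z)" for u \<beta> z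
    using teq_length[of "[]" "u @ \<beta> # linv \<beta> # z"] by auto
  then show ?case by (simp add: nf_def red_def)
next
  case (Cons \<alpha> w)
  then show ?case using act_red by (simp add: nf_def)
qed

lemma nf_teq: 
  assumes "raag_eq E u w"
  shows "teq E (nf E u) (nf E w)"
proof (rule raag_eq_invariant[OF assms, where P = "\<lambda>u w. teq E (nf E u) (nf E w)"])
  fix u w assume "raag_step E u w"
  then show "teq E (nf E u) (nf E w)"
  proof cases
    case (cancel u' x b w')
    then show ?thesis
      using foldr_act_teq[OF act_linv[OF red_nf[of w'], of "(x, b)"], of u'] by (simp add: nf_def)
  next
    case (commute x y u' b c w')
    then show ?thesis
      using foldr_act_teq[OF act_commute[of "(x, b)" "(y, c)" "nf E w'"], of u'] by (simp add: nf_def)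
  qed
qed (auto intro!: reflpI sympI transpI intro: teq_sym teq_trans)

lemma nf_Cons: "nf E (\<alpha> # w) = act E \<alpha> (nf E w)"
  by (simp add: nf_def)

lemma act_raag_eq: "raag_eq E (act E \<alpha> w) (\<alpha> # w)"
proof (cases "strip E (linv \<alpha>) w")
  case (Some z)
  have "raag_eq E (\<alpha> # w) (\<alpha> # linv \<alpha> # z)"
    using teq_raag_eq[OF strip_Some_teq[OF Some]] by (rule raag_eq_Cons)
  then have "raag_eq E z (\<alpha> # w)"
    by (rule raag_eq_sym[OF raag_eq_trans[OF _ raag_eq_cancel_letter]])
  then show ?thesis using Some by (simp add: act_def)
qed (simp add: act_def)

lemma nf_raag_eq: "raag_eq E (nf E w) w"
proof (induction w)
  case (Cons \<alpha> w)
  then show ?case unfolding nf_Cons by (intro raag_eq_trans[OF act_raag_eq] raag_eq_Cons)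
qed (simp add: nf_def)

lemma length_filter_act: "length (filter P (act E \<alpha> w)) \<le> length (filter P (\<alpha> # w))"
proof (cases "strip E (linv \<alpha>) w")
  case (Some z)
  then show ?thesis using teq_length_filter[OF strip_Some_teq[OF Some], of P] by (auto simp: act_def)
qed (simp add: act_def)

lemma length_filter_nf: "length (filter P (nf E w)) \<le> length (filter P w)"
proof (induction w)
  case (Cons \<alpha> w)
  then show ?case using length_filter_act[of P \<alpha> "nf E w"] by (auto simp: nf_Cons split: if_splits)
qed (simp add: nf_def)

lemma length_nf: "length (nf E w) \<le> length w"
  using length_filter_nf[of "\<lambda>_. True" w] by simp

lemma set_nf: "set (nf E w) \<subseteq> set w"
proof
  fix \<alpha> assume "\<alpha> \<in> set (nf E w)"
  then have "0 < length (filter ((=) \<alpha>) (nf E w))" by (auto simp: filter_empty_conv)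
  then have "0 < length (filter ((=) \<alpha>) w)" using length_filter_nf[of "(=) \<alpha>" w] by linarith
  then show "\<alpha> \<in> set w" by (auto simp: filter_empty_conv)
qed

lemma verts_nf: "verts (nf E w) \<subseteq> verts w"
  using set_nf by (auto simp: verts_def)

lemma geo_nf_self: "geo E w \<Longrightarrow> nf E w = w"
proof (induction w)
  case (Cons \<alpha> w)
  have "geo E w"
    unfolding geo_def
  proof (intro allI impI)
    fix v assume "raag_eq E v w"
    then show "length w \<le> length v" using Cons.prems raag_eq_Cons[of E v w \<alpha>] by (auto simp: geo_def)
  qed
  then have w: "nf E w = w" using Cons.IH by simp
  have "strip E (linv \<alpha>) w = None"
  proof (rule ccontr)
    assume "strip E (linv \<alpha>) w \<noteq> None"
    then obtain z where z: "strip E (linv \<alpha>) w = Some z" by blast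
    then have "raag_eq E z (\<alpha> # w)" using act_raag_eq[of \<alpha> w] by (simp add: act_def)
    then show False using Cons.prems teq_length[OF strip_Some_teq[OF z]] by (auto simp: geo_def)
  qed
  then show ?case by (simp add: nf_Cons w act_def)
qed (simp add: nf_def)

lemma geo_nf: "geo E (nf E w)"
  unfolding geo_def
proof (intro allI impI)
  fix v assume "raag_eq E v (nf E w)"
  then have "raag_eq E v w" using nf_raag_eq raag_eq_trans by blast
  then have "length (nf E v) = length (nf E w)" using nf_teq teq_length by blast
  then show "length (nf E w) \<le> length v" using length_nf[of v] by simp
qed

lemma geo_iff_nf: "geo E w \<longleftrightarrow> nf E w = w"
  by (metis geo_nf geo_nf_self)

lemma geo_teq: "geo E u \<Longrightarrow> geo E w \<Longrightarrow> raag_eq E u w \<Longrightarrow> teq E u w"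
  using nf_teq geo_nf_self by metis

text \<open>A geodesic minimises the count of every class of letters at once, since
  \<open>nf\<close> only deletes letters and geodesics of one element are equal as traces.\<close>

lemma geo_length_filter: "geo E u \<Longrightarrow> raag_eq E u w \<Longrightarrow> length (filter P u) \<le> length (filter P w)"
  using nf_teq[of u w] geo_nf_self[of u] length_filter_nf[of P w] teq_length_filter[of u "nf E w" P] by simp

lemma geo_if_length: "raag_eq E u w \<Longrightarrow> geo E w \<Longrightarrow> length u \<le> length w \<Longrightarrow> geo E u"
proof -
  assume eq: "raag_eq E u w" and w: "geo E w" and l: "length u \<le> length w"
  show ?thesis
    unfolding geo_def using w raag_eq_trans[OF _ eq] l by (meson geo_def le_trans)
qed

lemma geo_infix: "geo E (a @ u @ b) \<Longrightarrow> geo E u"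
  unfolding geo_def
proof (intro allI impI)
  fix w assume "\<forall>w. raag_eq E w (a @ u @ b) \<longrightarrow> length (a @ u @ b) \<le> length w" and "raag_eq E w u"
  then have "length (a @ u @ b) \<le> length (a @ w @ b)" using raag_eq_context by blast
  then show "length u \<le> length w" by simp
qed

lemma geo_prefix: "geo E (u @ b) \<Longrightarrow> geo E u" and geo_suffix: "geo E (a @ u) \<Longrightarrow> geo E u"
  using geo_infix[of "[]" u b] geo_infix[of a u "[]"] by auto

lemma geo_Nil [simp]: "geo E []"
  by (simp add: geo_def)

lemma geo_winv: "geo E u \<Longrightarrow> geo E (winv u)"
proof -
  assume u: "geo E u"
  have "length u \<le> length w" if "raag_eq E w (winv u)" for w
    using u raag_eq_winv[OF that] by (auto simp: geo_def dest: spec[of _ "winv w"])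
  then show ?thesis by (simp add: geo_def)
qed

lemma geo_eq_Nil: "geo E u \<Longrightarrow> raag_eq E u [] \<Longrightarrow> u = []"
  unfolding geo_def using raag_eq_sym[of E u "[]"] by (auto dest: spec[of _ "[]"])

lemma strip_nth:
  "strip E \<beta> w = Some z \<Longrightarrow> \<exists>j<length w. w ! j = \<beta> \<and> (\<forall>l<j. (fst \<beta>, fst (w ! l)) \<in> E)"
proof (induction w arbitrary: z)
  case (Cons \<gamma> w)
  show ?case
  proof (cases "\<gamma> = \<beta>")
    case False
    then obtain z' where "strip E \<beta> w = Some z'" and e: "(fst \<beta>, fst \<gamma>) \<in> E"
      using Cons.prems by (auto split: if_splits)
    then obtain j where "j < length w" "w ! j = \<beta>" "\<forall>l<j. (fst \<beta>, fst (w ! l)) \<in> E"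
      using Cons.IH by blast
    then show ?thesis using e by (intro exI[of _ "Suc j"]) (auto simp: less_Suc_eq_0_disj)
  qed auto
qed simp

text \<open>In the shortest non-geodesic suffix the tail is its own normal form, so
  \<open>act\<close> must cancel the head letter; its partner is the letter removed by
  \<open>strip\<close>.\<close>

lemma not_geo_pair:
  "\<not> geo E w \<Longrightarrow> \<exists>i j. i < j \<and> j < length w \<and> w ! j = linv (w ! i) \<and>
     (\<forall>l. i < l \<and> l < j \<longrightarrow> (fst (w ! i), fst (w ! l)) \<in> E)"
proof (induction w)
  case (Cons \<alpha> w)
  show ?case
  proof (cases "geo E w")
    case False
    then obtain i j where ij: "i < j" "j < length w" "w ! j = linv (w ! i)"
      "\<forall>l. i < l \<and> l < j \<longrightarrow> (fst (w ! i), fst (w ! l)) \<in> E" using Cons.IH by blast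
    show ?thesis
    proof (intro exI conjI allI impI)
      show "Suc i < Suc j" "Suc j < length (\<alpha> # w)" "(\<alpha> # w) ! Suc j = linv ((\<alpha> # w) ! Suc i)"
        using ij by auto
      fix l assume "Suc i < l \<and> l < Suc j"
      then show "(fst ((\<alpha> # w) ! Suc i), fst ((\<alpha> # w) ! l)) \<in> E"
        using ij(4) by (cases l) auto
    qed
  next
    case True
    then have "nf E (\<alpha> # w) = act E \<alpha> w" by (simp add: nf_Cons geo_nf_self)
    then have "strip E (linv \<alpha>) w \<noteq> None" using Cons.prems by (auto simp: geo_iff_nf act_def split: option.splits)
    then obtain z where "strip E (linv \<alpha>) w = Some z" by blast
    from strip_nth[OF this]
    obtain j where j: "j < length w" "w ! j = linv \<alpha>" "\<forall>l<j. (fst \<alpha>, fst (w ! l)) \<in> E"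
      by auto
    show ?thesis
    proof (intro exI conjI allI impI)
      show "0 < Suc j" "Suc j < length (\<alpha> # w)" "(\<alpha> # w) ! Suc j = linv ((\<alpha> # w) ! 0)"
        using j by auto
      fix l assume "0 < l \<and> l < Suc j"
      then show "(fst ((\<alpha> # w) ! 0), fst ((\<alpha> # w) ! l)) \<in> E"
        using j(3) by (cases l) auto
    qed
  qed
qed simp

end

section \<open>Commuting words in a free monoid\<close>

lemma commuting_words_powers:
  assumes "X @ Y = Y @ X"
  obtains z i j where "X = wpow z i" "Y = wpow z j"
  using comm_append_are_replicate[OF assms] unfolding wpow_def by metis

lemma commuting_words_wpow_eq:
  assumes "X @ Y = Y @ X" and "length X * l = length Y * k"
  shows "wpow X l = wpow Y k"
proof -
  obtain z i j where z: "X = wpow z i" "Y = wpow z j" using commuting_words_powers[OF assms(1)] .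
  show ?thesis
  proof (cases "z = []")
    case False
    then have "i * l = j * k" using assms(2) z by (auto simp: algebra_simps)
    then show ?thesis using z by (simp flip: wpow_mult)
  qed (use z in simp)
qed

lemma commuting_words_count:
  assumes "X @ Y = Y @ X"
  shows "length (filter P X) * length (filter Q Y) = length (filter Q X) * length (filter P Y)"
proof -
  obtain z i j where z: "X = wpow z i" "Y = wpow z j" using commuting_words_powers[OF assms(1)] .
  then show ?thesis by (simp add: filter_wpow)
qed

text \<open>\<open>X\<close> commutes with a power of \<open>Y\<close> longer than
  \<open>X @ Y\<close>; then \<open>X @ Y\<close> and \<open>Y @ X\<close> are both prefixes of that
  power, of equal length.\<close>

lemma commuting_with_wpow:
  assumes "X @ wpow Y b = wpow Y b @ X" and "b > 0"
  shows "X @ Y = Y @ X"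
proof (cases "Y = []")
  case False
  define n where "n = b * (length X + length Y)"
  have comm: "X @ wpow Y n = wpow Y n @ X"
  proof -
    have "X @ wpow (wpow Y b) k = wpow (wpow Y b) k @ X" for k
    proof (induction k)
      case (Suc k)
      have "X @ wpow (wpow Y b) (Suc k) = (X @ wpow Y b) @ wpow (wpow Y b) k" by simp
      also have "\<dots> = wpow Y b @ wpow (wpow Y b) k @ X" using assms(1) Suc by simp
      finally show ?case by simp
    qed simp
    then show ?thesis by (simp add: n_def wpow_mult)
  qed
  have "length X + length Y \<le> n" using assms(2) by (simp add: n_def)
  also have "n \<le> n * length Y" using False by (cases Y) auto
  finally have len: "length X + length Y \<le> length (wpow Y n)" by simp
  then obtain n' where n': "n = Suc n'" using False by (cases n) auto
  have "X @ Y = take (length X + length Y) (X @ wpow Y n)" by (simp add: n')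
  also have "\<dots> = take (length X + length Y) (wpow Y n)" using comm len by simp
  finally have 1: "X @ Y = take (length X + length Y) (wpow Y n)" .
  have "X = take (length X) (X @ wpow Y n)" by simp
  also have "\<dots> = take (length X) (wpow Y n)" using comm len by simp
  finally have "Y @ X = take (length X + length Y) (Y @ wpow Y n)" by simp
  also have "Y @ wpow Y n = wpow Y n @ Y" by (simp add: wpow_commutes)
  finally have "Y @ X = take (length X + length Y) (wpow Y n)" using len by simp
  then show ?thesis using 1 by simp
qed simp

section \<open>Cyclically reduced words and centralisers\<close>

text \<open>Stated through powers because the later arguments compare growth:
  \<open>wpow u k\<close> has length exactly \<open>k * length u\<close> in the group.\<close>

definition cyc_red :: "('v \<times> 'v) set \<Rightarrow> ('v \<times> bool) list \<Rightarrow> bool" where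
  "cyc_red E u \<longleftrightarrow> (\<forall>k. geo E (wpow u k))"

text \<open>Connectedness of the complement graph on \<open>B\<close>, phrased by cuts because it
  serves to spread a property along non-edges.\<close>

definition coconnected :: "('v \<times> 'v) set \<Rightarrow> 'v set \<Rightarrow> bool" where
  "coconnected E B \<longleftrightarrow> B \<noteq> {} \<and>
     (\<forall>X. X \<subseteq> B \<and> X \<noteq> {} \<and> X \<noteq> B \<longrightarrow> (\<exists>x\<in>X. \<exists>y\<in>B - X. (x, y) \<notin> E))"

definition link :: "('v \<times> 'v) set \<Rightarrow> 'v set \<Rightarrow> 'v set" where
  "link E B = {z. \<forall>x\<in>B. (x, z) \<in> E}"

lemma split_at_two:
  assumes "i < j" "j < length w"
  shows "w = take i w @ w ! i # take (j - Suc i) (drop (Suc i) w) @ w ! j # drop (Suc j) w"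
proof -
  have "drop (Suc i) w = take (j - Suc i) (drop (Suc i) w) @ drop (Suc i) w ! (j - Suc i) # drop (Suc (j - Suc i)) (drop (Suc i) w)"
    by (rule id_take_nth_drop) (use assms in simp)
  then have "drop (Suc i) w = take (j - Suc i) (drop (Suc i) w) @ w ! j # drop (Suc j) w"
    using assms by simp
  moreover have "w = take i w @ w ! i # drop (Suc i) w"
    by (rule id_take_nth_drop) (use assms in simp)
  ultimately show ?thesis by simp
qed

lemma wpow_cancel:
  "raag_eq E (wpow u k @ wpow (winv u) m) (if k \<ge> m then wpow u (k - m) else wpow (winv u) (m - k))"
proof -
  have cancel: "raag_eq E (wpow u i @ wpow (winv u) i) []" for i
    using raag_eq_winv_right[of E "wpow u i"] by (simp add: winv_wpow)
  show ?thesis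
  proof (cases "k \<ge> m")
    case True
    then have "wpow u k = wpow u (k - m) @ wpow u m" by (simp flip: wpow_add)
    then show ?thesis using raag_eq_append[OF raag_eq_refl cancel[of m], of "wpow u (k - m)"] True by simp
  next
    case False
    then have "wpow (winv u) m = wpow (winv u) k @ wpow (winv u) (m - k)" by (simp flip: wpow_add)
    then show ?thesis using raag_eq_append[OF cancel[of k] raag_eq_refl, of "wpow (winv u) (m - k)"] False by simp
  qed
qed

section \<open>Cyclic reduction and commutation at the level of traces\<close>

context pc_graph
begin

lemma edge_sym: "(x, y) \<in> E \<Longrightarrow> (y, x) \<in> E"
  using sym_E by (auto dest: symD)

lemma link_disjoint: "B \<inter> link E B = {}"
  using irrefl_E by (auto simp: link_def)

lemma wcomm_letter_commuting:
  assumes "\<And>\<gamma>. \<gamma> \<in> set m \<Longrightarrow> (fst \<alpha>, fst \<gamma>) \<in> E"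
  shows "wcomm E [\<alpha>] m"
  by (rule wcomm_verts) (use assms in \<open>auto simp: verts_def\<close>)

text \<open>Converse of \<open>not_geo_pair\<close>: the letter slides up to its inverse and the two
  cancel.\<close>

lemma pair_not_geo:
  assumes "i < j" "j < length w" "w ! j = linv (w ! i)"
    and "\<And>l. i < l \<Longrightarrow> l < j \<Longrightarrow> (fst (w ! i), fst (w ! l)) \<in> E"
  shows "\<not> geo E w"
proof
  assume geo: "geo E w"
  let ?m = "take (j - Suc i) (drop (Suc i) w)"
  have "wcomm E [w ! i] ?m"
  proof (rule wcomm_letter_commuting)
    fix \<gamma> assume "\<gamma> \<in> set ?m"
    then obtain l where "l < j - Suc i" "\<gamma> = w ! (Suc i + l)"
      using assms(1,2) by (auto simp: in_set_conv_nth)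
    then show "(fst (w ! i), fst \<gamma>) \<in> E" using assms(4)[of "Suc i + l"] by auto
  qed
  then have "raag_eq E ([w ! i] @ ?m) (?m @ [w ! i])" by (simp add: wcomm_def)
  from raag_eq_append[OF this raag_eq_refl, of "[w ! j]"]
  have "raag_eq E (w ! i # ?m @ [w ! j]) (?m @ w ! i # linv (w ! i) # [])" using assms by simp
  also have "raag_eq E (?m @ w ! i # linv (w ! i) # []) (?m @ [])"
    by (rule raag_eq_append[OF raag_eq_refl raag_eq_cancel_letter])
  finally have "raag_eq E (take i w @ (w ! i # ?m @ [w ! j]) @ drop (Suc j) w) (take i w @ (?m @ []) @ drop (Suc j) w)"
    by (rule raag_eq_context)
  then have "raag_eq E w (take i w @ ?m @ drop (Suc j) w)" using split_at_two[OF assms(1,2)] by simp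
  then have "length w \<le> length (take i w @ ?m @ drop (Suc j) w)" using geo raag_eq_sym unfolding geo_def by blast
  then show False using assms by simp
qed

lemma cyc_red_wpow: "cyc_red E u \<Longrightarrow> cyc_red E (wpow u b)"
  by (simp add: cyc_red_def flip: wpow_mult)

lemma cyc_red_winv: "cyc_red E u \<Longrightarrow> cyc_red E (winv u)"
  by (simp add: cyc_red_def geo_winv flip: winv_wpow)

text \<open>A shortest word in its conjugacy class has geodesic powers: a cancelling pair in a power
  would straddle two neighbouring copies and could be removed by a conjugation.\<close>

lemma cyc_red_exists:
  obtains h u where "cyc_red E u" "raag_eq E w (wconj h u)" "verts h \<subseteq> verts w" "verts u \<subseteq> verts w"
proof -
  \<comment> \<open>The conjugator is kept over the vertices of \<open>w\<close> as well, so that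
    the blocks in \<open>block_family\<close> stay over \<open>VG\<close>.\<close>
  define P where "P = (\<lambda>(h, u). raag_eq E w (wconj h u) \<and> verts h \<subseteq> verts w \<and> verts u \<subseteq> verts w)"
  have "P ([], w)" by (simp add: P_def wconj_simps)
  from ex_has_least_nat[of P, OF this, of "\<lambda>(h, u). length u"]
  obtain h u where hu: "P (h, u)" and "\<forall>y. P y \<longrightarrow> length u \<le> (case y of (h, u) \<Rightarrow> length u)" by auto
  then have least: "\<And>h' u'. P (h', u') \<Longrightarrow> length u \<le> length u'" by force
  have eq: "raag_eq E w (wconj h u)" and vs: "verts h \<subseteq> verts w" "verts u \<subseteq> verts w"
    using hu by (auto simp: P_def)
  have "P (h, nf E u)"
    unfolding P_def using vs verts_nf[of u] raag_eq_trans[OF eq wconj_cong[OF raag_eq_refl raag_eq_sym[OF nf_raag_eq]]] by auto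
  then have geo: "geo E u"
    using geo_if_length[OF raag_eq_sym[OF nf_raag_eq] geo_nf] least by blast
  define n where "n = length u"
  have "geo E (wpow u k)" for k
  proof (induction k)
    case (Suc k)
    show ?case
    proof (rule ccontr)
      let ?W = "u @ wpow u k"
      assume "\<not> geo E (wpow u (Suc k))"
      then obtain i j where ij: "i < j" "j < length ?W" "?W ! j = linv (?W ! i)"
        "\<And>l. i < l \<Longrightarrow> l < j \<Longrightarrow> (fst (?W ! i), fst (?W ! l)) \<in> E" using not_geo_pair[of ?W] by auto
      have "\<not> n \<le> i"
      proof
        assume ni: "n \<le> i"
        have "\<not> geo E (wpow u k)"
        proof (rule pair_not_geo[of "i - n" "j - n"])
          fix l assume "i - n < l" "l < j - n"
          then show "(fst (wpow u k ! (i - n)), fst (wpow u k ! l)) \<in> E"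
            using ij(4)[of "l + n"] ni ij(1) by (simp add: nth_append n_def)
        qed (use ni ij in \<open>auto simp: nth_append n_def\<close>)
        then show False using Suc by simp
      qed
      then have i: "i < n" by simp
      have "\<not> j < n"
      proof
        assume jn: "j < n"
        have "\<not> geo E u"
        proof (rule pair_not_geo[of i j])
          fix l assume "i < l" "l < j"
          then show "(fst (u ! i), fst (u ! l)) \<in> E"
            using ij(4)[of l] i jn by (simp add: nth_append n_def)
        qed (use i jn ij in \<open>auto simp: nth_append n_def\<close>)
        then show False using geo by simp
      qed
      then have jn: "n \<le> j" by simp
      then obtain k' where k': "k = Suc k'" using ij(2) by (cases k) (auto simp: n_def)
      have Wn: "?W ! (n + l) = u ! l" if "l < n" for l
        using that by (simp add: k' nth_append n_def)
      have W0: "?W ! l = u ! l" if "l < n" for l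
        using that by (simp add: nth_append n_def)
      \<comment> \<open>Position \<open>n + i\<close> carries the same letter as position
        \<open>i\<close>, which neither cancels nor commutes with itself; so the partner lies before
        it in the second copy.\<close>
      have "j \<noteq> n + i" using ij(3) Wn[OF i] W0[OF i] by auto
      moreover have "\<not> n + i < j"
        using ij(4)[of "n + i"] Wn[OF i] W0[OF i] irrefl_E i by auto
      ultimately have ji: "j - n < i" using jn by simp
      let ?j = "j - n"
      let ?a = "take ?j u" and ?b = "take (i - Suc ?j) (drop (Suc ?j) u)" and ?c = "drop (Suc i) u"
      have uj: "u ! ?j = linv (u ! i)" using ij(3) Wn[of ?j] W0[OF i] ji i jn by simp
      have u: "u = ?a @ u ! ?j # ?b @ u ! i # ?c" using split_at_two[of ?j i u] ji i by (simp add: n_def)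
      have "wcomm E [u ! i] ?a"
      proof (rule wcomm_letter_commuting)
        fix \<gamma> assume "\<gamma> \<in> set ?a"
        then obtain l where "l < ?j" "\<gamma> = u ! l" using ji i by (auto simp: in_set_conv_nth n_def)
        then show "(fst (u ! i), fst \<gamma>) \<in> E" using ij(4)[of "n + l"] Wn[of l] W0[OF i] ji i by auto
      qed
      then have "wcomm E (winv [u ! i]) ?a" by (simp only: wcomm_winv_iff)
      then have a: "raag_eq E (?a @ [linv (u ! i)]) (linv (u ! i) # ?a)"
        by (auto simp: wcomm_def intro: raag_eq_sym)
      have "wcomm E [u ! i] ?c"
      proof (rule wcomm_letter_commuting)
        fix \<gamma> assume "\<gamma> \<in> set ?c"
        then obtain l where "l < n - Suc i" "\<gamma> = u ! (Suc i + l)" by (auto simp: in_set_conv_nth n_def)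
        then show "(fst (u ! i), fst \<gamma>) \<in> E" using ij(4)[of "Suc i + l"] W0[of "Suc i + l"] W0[OF i] jn by auto
      qed
      then have c: "raag_eq E (u ! i # ?c) (?c @ [u ! i])" by (simp add: wcomm_def)
      \<comment> \<open>The two letters commute to the two ends of \<open>u\<close>, so
        \<open>u\<close> is conjugate to a word shorter by two, against minimality.\<close>
      have "raag_eq E ((?a @ [linv (u ! i)]) @ ?b @ (u ! i # ?c)) ((linv (u ! i) # ?a) @ ?b @ (?c @ [u ! i]))"
        by (intro raag_eq_append a c raag_eq_refl)
      then have "raag_eq E u (wconj [u ! i] (?a @ ?b @ ?c))"
        using u uj by (simp add: wconj_def)
      then have "raag_eq E w (wconj ([u ! i] @ h) (?a @ ?b @ ?c))"
        using raag_eq_trans[OF eq wconj_cong[OF raag_eq_refl[of E h]]] by (simp only: wconj_simps(3)[symmetric])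
      moreover have "set u = set ?a \<union> {u ! ?j} \<union> set ?b \<union> {u ! i} \<union> set ?c" by (subst u) auto
      then have "verts ([u ! i] @ h) \<subseteq> verts w" "verts (?a @ ?b @ ?c) \<subseteq> verts w"
        using vs unfolding verts_def by auto
      ultimately have "P ([u ! i] @ h, ?a @ ?b @ ?c)" by (simp add: P_def)
      then have "length u \<le> length (?a @ ?b @ ?c)" by (rule least)
      then show False using ji i by (simp add: n_def)
    qed
  qed simp
  then have "cyc_red E u" by (simp add: cyc_red_def)
  then show ?thesis using that eq vs by blast
qed

text \<open>Torsion-freeness: a power of a cyclically reduced word is geodesic, hence trivial only
  if it is empty.\<close>

lemma raag_eq_wpow_Nil: "raag_eq E (wpow g l) [] \<Longrightarrow> l > 0 \<Longrightarrow> raag_eq E g []"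
proof -
  assume g: "raag_eq E (wpow g l) []" and l: "l > 0"
  obtain h u where u: "cyc_red E u" "raag_eq E g (wconj h u)" by (rule cyc_red_exists)
  have "raag_eq E (wconj h (wpow u l)) (wpow g l)"
    using raag_eq_trans[OF wconj_wpow raag_eq_sym[OF raag_eq_wpow[OF u(2)]]] .
  then have "raag_eq E (wconj h (wpow u l)) (wconj h [])"
    using raag_eq_trans[OF _ raag_eq_trans[OF g raag_eq_sym[OF raag_eq_winv_left[of E h]]]] by (simp add: wconj_simps)
  then have "raag_eq E (wpow u l) []" by (simp only: raag_eq_wconj_iff)
  then have "wpow u l = []" using u(1) geo_eq_Nil by (auto simp: cyc_red_def)
  then have "u = []" using l by (cases l) auto
  then show ?thesis using raag_eq_trans[OF u(2), of "[]"] by (simp add: wconj_simps raag_eq_winv_left)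
qed

text \<open>Multiplying an element of the centraliser by a high power of \<open>u\<close> makes all further
  multiplications by \<open>u\<close> length-additive, so that it commutes with \<open>u\<close> already as a trace.\<close>

lemma commuting_trace:
  assumes u: "cyc_red E u" and y: "wcomm E y u"
  obtains K w where "raag_eq E w (y @ wpow u K)" "teq E (w @ u) (u @ w)"
proof -
  define len where "len K = length (nf E (y @ wpow u K))" for K
  have nf: "raag_eq E (nf E (y @ wpow u K)) (y @ wpow u K)" for K by (rule nf_raag_eq)
  \<comment> \<open>Multiplying by \<open>winv y\<close> recovers the geodesic
    \<open>wpow u K\<close>, so at most \<open>length y\<close> letters are lost.\<close>
  have lower: "K * length u \<le> length y + len K" for K
  proof -
    have "raag_eq E (winv y @ nf E (y @ wpow u K)) (winv y @ y @ wpow u K)"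
      by (rule raag_eq_append[OF raag_eq_refl nf])
    also have "raag_eq E (winv y @ y @ wpow u K) (wpow u K)"
      using raag_eq_cancel_left[of E "[]" y "wpow u K"] by simp
    finally have "length (wpow u K) \<le> length (winv y @ nf E (y @ wpow u K))"
      using u unfolding cyc_red_def geo_def by blast
    then show ?thesis by (simp add: len_def)
  qed
  have upper: "len (Suc K) \<le> len K + length u" for K
  proof -
    have "raag_eq E (nf E (y @ wpow u K) @ u) ((y @ wpow u K) @ u)"
      by (rule raag_eq_append[OF nf raag_eq_refl])
    then have "raag_eq E (nf E (y @ wpow u K) @ u) (nf E (y @ wpow u (Suc K)))"
      using raag_eq_trans[OF _ raag_eq_sym[OF nf[of "Suc K"]]] by (simp add: wpow_commutes)
    then show ?thesis using geo_nf[of "y @ wpow u (Suc K)"] unfolding geo_def len_def by force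
  qed
  \<comment> \<open>Losing a letter at every step would put the length at least
    \<open>K - length y\<close> below \<open>K * length u\<close>, while this deficit is at most
    \<open>length y\<close>; \<open>K = 2 * length y + 1\<close> is too large for both.\<close>
  have "\<exists>K. len (Suc K) = len K + length u"
  proof (rule ccontr)
    assume "\<not> ?thesis"
    then have less: "Suc (len (Suc K)) \<le> len K + length u" for K
      using upper[of K] by (metis Suc_leI le_neq_implies_less)
    have "len K + K \<le> length y + K * length u" for K
    proof (induction K)
      case 0
      then show ?case using length_nf[of y] by (simp add: len_def)
    next
      case (Suc K)
      then show ?case using less[of K] by simp
    qed
    from this[of "Suc (2 * length y)"] show False using lower[of "Suc (2 * length y)"] by linarith
  qed
  then obtain K where K: "len (Suc K) = len K + length u" by blast
  let ?w = "nf E (y @ wpow u K)"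
  have e1: "raag_eq E (?w @ u) (nf E (y @ wpow u (Suc K)))"
  proof -
    have "raag_eq E (?w @ u) ((y @ wpow u K) @ u)" by (rule raag_eq_append[OF nf raag_eq_refl])
    then show ?thesis
      using raag_eq_trans[OF _ raag_eq_sym[OF nf[of "Suc K"]]] by (simp add: wpow_commutes)
  qed
  have e2: "raag_eq E (u @ ?w) (nf E (y @ wpow u (Suc K)))"
  proof -
    have "raag_eq E (u @ ?w) (u @ y @ wpow u K)" by (rule raag_eq_append[OF raag_eq_refl nf])
    also have "raag_eq E (u @ y @ wpow u K) (y @ u @ wpow u K)"
      using raag_eq_append[OF raag_eq_sym[OF y[unfolded wcomm_def]] raag_eq_refl[of E "wpow u K"]] by simp
    finally show ?thesis using raag_eq_trans[OF _ raag_eq_sym[OF nf[of "Suc K"]]] by simp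
  qed
  \<comment> \<open>Both products have the length of the normal form of the same element, so they
    are geodesic and equal as traces.\<close>
  have "geo E (?w @ u)" "geo E (u @ ?w)"
    using geo_if_length[OF e1 geo_nf] geo_if_length[OF e2 geo_nf] K by (auto simp: len_def)
  then have "teq E (?w @ u) (u @ ?w)"
    using geo_teq raag_eq_trans[OF e1 raag_eq_sym[OF e2]] by blast
  then show ?thesis using that nf by blast
qed

text \<open>Letters of \<open>u\<close> inside and outside \<open>B\<close> commute, so a
  non-commuting pair meets \<open>u\<close> on one side only and its projection survives entirely or
  vanishes.\<close>

lemma proj_restrict_word:
  assumes "\<And>x z. x \<in> verts u \<Longrightarrow> x \<in> B \<Longrightarrow> z \<in> verts u \<Longrightarrow> z \<notin> B \<Longrightarrow> (x, z) \<in> E"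
    and "(fst \<alpha>, fst \<beta>) \<notin> E"
  shows "proj \<alpha> \<beta> (restrict_word B u) = proj \<alpha> \<beta> u \<or> proj \<alpha> \<beta> (restrict_word B u) = []"
proof (rule disjCI)
  assume "proj \<alpha> \<beta> (restrict_word B u) \<noteq> []"
  then obtain \<gamma> where \<gamma>: "\<gamma> \<in> set u" "fst \<gamma> \<in> B" "\<gamma> = \<alpha> \<or> \<gamma> = \<beta>"
    by (auto simp: proj_def restrict_word_def filter_empty_conv)
  have "fst \<delta> \<in> B" if "\<delta> \<in> set u" "\<delta> = \<alpha> \<or> \<delta> = \<beta>" for \<delta>
    using assms(1)[of "fst \<gamma>" "fst \<delta>"] \<gamma> that assms(2) edge_sym irrefl_E unfolding verts_def by blast
  then show "proj \<alpha> \<beta> (restrict_word B u) = proj \<alpha> \<beta> u"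
    unfolding proj_def restrict_word_def filter_filter by (intro filter_cong) auto
qed

lemma teq_commute_restrict:
  assumes "\<And>x z. x \<in> verts u \<Longrightarrow> x \<in> B \<Longrightarrow> z \<in> verts u \<Longrightarrow> z \<notin> B \<Longrightarrow> (x, z) \<in> E"
    and "teq E (w @ u) (u @ w)"
  shows "teq E (w @ restrict_word B u) (restrict_word B u @ w)"
  unfolding teq_def
proof (intro allI impI)
  fix \<alpha> \<beta> :: "'v \<times> bool" assume n: "(fst \<alpha>, fst \<beta>) \<notin> E"
  show "proj \<alpha> \<beta> (w @ restrict_word B u) = proj \<alpha> \<beta> (restrict_word B u @ w)"
    using proj_restrict_word[of u B \<alpha> \<beta>, OF assms(1) n] teqD[OF assms(2) n] by auto
qed

text \<open>Projections of the part over \<open>B\<close> are those of \<open>u\<close> or empty, so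
  a trace commuting with \<open>u\<close> commutes with that part; the power of \<open>u\<close>
  added by \<open>commuting_trace\<close> is then divided out.\<close>

lemma wcomm_restrict_word:
  assumes u: "cyc_red E u" and y: "wcomm E y u"
    and B: "\<And>x z. x \<in> verts u \<Longrightarrow> x \<in> B \<Longrightarrow> z \<in> verts u \<Longrightarrow> z \<notin> B \<Longrightarrow> (x, z) \<in> E"
  shows "wcomm E y (restrict_word B u)"
proof -
  obtain K w where w: "raag_eq E w (y @ wpow u K)" "teq E (w @ u) (u @ w)"
    using commuting_trace[OF u y] .
  have "wcomm E w (restrict_word B u)" "wcomm E u (restrict_word B u)"
    using teq_commute_restrict[of u B, OF B w(2)] teq_commute_restrict[of u B u, OF B]
    by (auto simp: wcomm_def intro: teq_raag_eq)
  then have "wcomm E (w @ winv (wpow u K)) (restrict_word B u)"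
    by (intro wcomm_append2) (simp_all add: wcomm_sym[of E "wpow u K"] wcomm_sym[of E u] wcomm_wpow)
  moreover have "raag_eq E (w @ winv (wpow u K)) y"
    using raag_eq_trans[OF raag_eq_append[OF w(1) raag_eq_refl, of "winv (wpow u K)"], of y]
      raag_eq_cancel_right[of E y "wpow u K" "[]"] by simp
  ultimately show ?thesis using wcomm_cong[OF _ raag_eq_refl] by blast
qed

text \<open>A power has the same centraliser as its base: after cyclic reduction commutation is an
  identity in each projection, where \<open>commuting_with_wpow\<close> removes the
  exponent.\<close>

lemma wcomm_wpow_cancel:
  assumes "wcomm E y (wpow g b)" and b: "b > 0"
  shows "wcomm E y g"
proof -
  obtain h u where u: "cyc_red E u" and g: "raag_eq E g (wconj h u)" by (rule cyc_red_exists)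
  let ?y = "wconj (winv h) y"
  have "wcomm E (wconj h (wpow u b)) y"
    using assms(1) wcomm_cong[OF raag_eq_trans[OF wconj_wpow raag_eq_sym[OF raag_eq_wpow[OF g]]] raag_eq_refl] wcomm_sym
    by blast
  then have y: "wcomm E ?y (wpow u b)" using wcomm_sym wcomm_wconj_move by blast
  obtain K w where w: "raag_eq E w (?y @ wpow (wpow u b) K)" "teq E (w @ wpow u b) (wpow u b @ w)"
    using commuting_trace[OF cyc_red_wpow[OF u] y] .
  have "teq E (w @ u) (u @ w)"
    unfolding teq_def
  proof (intro allI impI)
    fix \<alpha> \<beta> :: "'v \<times> bool" assume n: "(fst \<alpha>, fst \<beta>) \<notin> E"
    have "proj \<alpha> \<beta> (w @ wpow u b) = proj \<alpha> \<beta> (wpow u b @ w)" using teqD[OF w(2) n] .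
    then have "proj \<alpha> \<beta> w @ wpow (proj \<alpha> \<beta> u) b = wpow (proj \<alpha> \<beta> u) b @ proj \<alpha> \<beta> w"
      by (simp add: proj_def filter_wpow)
    then show "proj \<alpha> \<beta> (w @ u) = proj \<alpha> \<beta> (u @ w)" using commuting_with_wpow b by simp
  qed
  then have "wcomm E w u" by (simp add: wcomm_def teq_raag_eq)
  then have "wcomm E (w @ winv (wpow (wpow u b) K)) u"
    by (intro wcomm_append2) (simp_all add: wcomm_sym[of E _ u] wcomm_wpow)
  moreover have "raag_eq E (w @ winv (wpow (wpow u b) K)) ?y"
    using raag_eq_trans[OF raag_eq_append[OF w(1) raag_eq_refl, of "winv (wpow (wpow u b) K)"], of ?y]
      raag_eq_cancel_right[of E ?y "wpow (wpow u b) K" "[]"] by simp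
  ultimately have "wcomm E ?y u" using wcomm_cong[OF _ raag_eq_refl] by blast
  then have "wcomm E (wconj h u) y" using wcomm_sym wcomm_wconj_move by blast
  then show ?thesis using wcomm_cong[OF g raag_eq_refl] wcomm_sym by blast
qed

end

definition total_exponent :: "('v \<times> bool) list \<Rightarrow> int" where
  "total_exponent w = (\<Sum>\<alpha>\<leftarrow>w. if snd \<alpha> then 1 else -1)"

lemma raag_eq_total_exponent: "raag_eq E u w \<Longrightarrow> total_exponent u = total_exponent w"
  by (rule raag_eq_invariant[where P = "\<lambda>u w. total_exponent u = total_exponent w"])
     (auto elim!: raag_step.cases intro: reflpI sympI transpI simp: total_exponent_def)

lemma total_exponent_le: "total_exponent w \<le> int (length w)"
  by (induction w) (auto simp: total_exponent_def)

lemma total_exponent_positive: "(\<And>\<alpha>. \<alpha> \<in> set w \<Longrightarrow> snd \<alpha>) \<Longrightarrow> total_exponent w = int (length w)"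
  by (induction w) (auto simp: total_exponent_def)

text \<open>The total exponent is invariant, bounds the length from below and equals the length of a
  positive word.\<close>

lemma geo_positive: "(\<And>\<alpha>. \<alpha> \<in> set w \<Longrightarrow> snd \<alpha>) \<Longrightarrow> geo E w"
  unfolding geo_def
  using total_exponent_positive[of w] total_exponent_le raag_eq_total_exponent by (metis of_nat_le_iff)

lemma cyc_red_positive: "(\<And>\<alpha>. \<alpha> \<in> set w \<Longrightarrow> snd \<alpha>) \<Longrightarrow> cyc_red E w"
  unfolding cyc_red_def using set_wpow by (metis geo_positive subsetD)

lemma coconnected_singleton [simp]: "coconnected E {x}"
  by (auto simp: coconnected_def)

lemma in_verts_iff: "x \<in> verts w \<longleftrightarrow> (\<exists>b. (x, b) \<in> set w)"
  by (force simp: verts_def)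

section \<open>Centralisers of elements with coconnected support, and commuting blocks\<close>

context pc_graph
begin

lemma raag_eq_split:
  "(\<And>x z. x \<in> verts w \<Longrightarrow> x \<in> B \<Longrightarrow> z \<in> verts w \<Longrightarrow> z \<notin> B \<Longrightarrow> (x, z) \<in> E) \<Longrightarrow>
   raag_eq E w (restrict_word B w @ restrict_word (- B) w)"
proof (induction w)
  case (Cons \<alpha> w)
  then have IH: "raag_eq E w (restrict_word B w @ restrict_word (- B) w)" by simp
  show ?case
  proof (cases "fst \<alpha> \<in> B")
    case True
    then show ?thesis using raag_eq_Cons[OF IH] by simp
  next
    case False
    have "wcomm E [\<alpha>] (restrict_word B w)"
      by (rule wcomm_verts)
         (use False Cons.prems edge_sym in \<open>auto simp: verts_restrict_word\<close>)
    then have "raag_eq E (([\<alpha>] @ restrict_word B w) @ restrict_word (- B) w)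
        ((restrict_word B w @ [\<alpha>]) @ restrict_word (- B) w)"
      unfolding wcomm_def by (rule raag_eq_append) simp
    then show ?thesis using raag_eq_trans[OF raag_eq_Cons[OF IH, of \<alpha>]] False by simp
  qed
qed simp

text \<open>The centraliser of \<open>u\<close> is the product of a cyclic group and the subgroup on
  the link. In place of a generator of the cyclic factor, the component \<open>a\<close> of
  \<open>y\<close> is given by a positive power of it that is a power of \<open>u\<close> or of its
  inverse.\<close>

lemma centraliser_block:
  assumes u: "cyc_red E u" and co: "coconnected E (verts u)" and y: "wcomm E y u"
  obtains a t v l d where "raag_eq E y (a @ t)" "verts a \<subseteq> verts u" "verts t \<subseteq> link E (verts u)"
    "l > 0" "v = u \<or> v = winv u" "raag_eq E (wpow a l) (wpow v d)"
proof -
  let ?B = "verts u"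
  obtain K w where w: "raag_eq E w (y @ wpow u K)" and comm: "teq E (w @ u) (u @ w)"
    using commuting_trace[OF u y] .
  define cnt where "cnt = (\<lambda>v (\<alpha> :: 'v \<times> bool). length (filter ((=) \<alpha>) v))"
  have cnt_pos: "0 < cnt v \<alpha> \<longleftrightarrow> \<alpha> \<in> set v" for v \<alpha>
    by (auto simp: cnt_def filter_empty_conv)
  have pcomm: "proj \<alpha> \<beta> w @ proj \<alpha> \<beta> u = proj \<alpha> \<beta> u @ proj \<alpha> \<beta> w" if "(fst \<alpha>, fst \<beta>) \<notin> E" for \<alpha> \<beta>
    using teqD[OF comm that] by simp
  have cnt_proj: "length (filter ((=) \<alpha>) (proj \<alpha> \<beta> v)) = cnt v \<alpha>"
    "length (filter ((=) \<beta>) (proj \<alpha> \<beta> v)) = cnt v \<beta>" for \<alpha> \<beta> v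
    by (auto simp: cnt_def proj_def intro!: arg_cong[where f = length] filter_cong)
  have "u \<noteq> []" using co by (auto simp: coconnected_def)
  then obtain \<alpha>0 where \<alpha>0: "\<alpha>0 \<in> set u" using hd_in_set by blast
  \<comment> \<open>\<open>k : l\<close> is the ratio of the counts of \<open>\<alpha>0\<close> in
    \<open>w\<close> and in \<open>u\<close>; \<open>P \<alpha>\<close> says that
    \<open>\<alpha>\<close> occurs in the same ratio.\<close>
  define l where "l = cnt u \<alpha>0"
  define k where "k = cnt w \<alpha>0"
  define P where "P = (\<lambda>\<alpha>. cnt w \<alpha> * l = k * cnt u \<alpha>)"
  have l: "l > 0" using \<alpha>0 cnt_pos by (simp add: l_def)
  \<comment> \<open>The projections to a non-commuting pair are powers of one common word, so the
    ratio passes from \<open>\<alpha>\<close> to \<open>\<beta>\<close>; coconnectedness carries it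
    through the whole support.\<close>
  have step: "P \<beta>" if "\<alpha> \<in> set u" "P \<alpha>" "(fst \<alpha>, fst \<beta>) \<notin> E" for \<alpha> \<beta>
  proof -
    have "cnt w \<beta> * cnt u \<alpha> = cnt w \<alpha> * cnt u \<beta>"
      using commuting_words_count[OF pcomm[OF that(3)], of "(=) \<beta>" "(=) \<alpha>"] by (simp add: cnt_proj)
    then have "cnt u \<alpha> * (cnt w \<beta> * l) = (cnt w \<alpha> * l) * cnt u \<beta>" by (simp add: algebra_simps)
    also have "\<dots> = cnt u \<alpha> * (k * cnt u \<beta>)" using that(2) by (simp add: P_def algebra_simps)
    finally show ?thesis using that(1) cnt_pos[of u \<alpha>] by (simp add: P_def)
  qed
  define X where "X = {x \<in> ?B. \<forall>b. P (x, b)}"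
  have "P \<alpha>0" by (simp add: P_def l_def k_def)
  then have "fst \<alpha>0 \<in> X" using step[OF \<alpha>0] irrefl_E \<alpha>0 by (auto simp: X_def verts_def)
  have X: "X = ?B"
  proof (rule ccontr)
    assume "X \<noteq> ?B"
    moreover have "X \<subseteq> ?B" "X \<noteq> {}" using \<open>fst \<alpha>0 \<in> X\<close> by (auto simp: X_def)
    ultimately obtain x z where xz: "x \<in> X" "z \<in> ?B - X" "(x, z) \<notin> E" using co unfolding coconnected_def by blast
    then obtain b where "(x, b) \<in> set u" "P (x, b)" by (auto simp: X_def verts_def)
    then have "P (z, c)" for c using step[of "(x, b)" "(z, c)"] xz by simp
    then show False using xz by (simp add: X_def)
  qed
  have PB: "P \<alpha>" if "fst \<alpha> \<in> ?B" for \<alpha>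
  proof -
    have "fst \<alpha> \<in> X" using X that by simp
    then have "P (fst \<alpha>, snd \<alpha>)" unfolding X_def by blast
    then show ?thesis by simp
  qed
  have Pnon: "P \<beta>" if x: "x \<in> ?B" "(x, fst \<beta>) \<notin> E" for x \<beta>
  proof -
    obtain b where "(x, b) \<in> set u" using x(1) by (auto simp: in_verts_iff)
    then show ?thesis using step[of "(x, b)" \<beta>] PB[of "(x, b)"] x by simp
  qed
  \<comment> \<open>A letter over a vertex outside the support has count zero in \<open>u\<close>;
    if it fails to commute with some vertex of the support, the ratio makes its count in
    \<open>w\<close> zero too.\<close>
  have outside: "\<beta> \<notin> set w" if "fst \<beta> \<notin> ?B" "x \<in> ?B" "(x, fst \<beta>) \<notin> E" for x \<beta>
  proof -
    have "cnt u \<beta> = 0" using that(1) cnt_pos[of u \<beta>] by (auto simp: verts_def)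
    then have "cnt w \<beta> * l = 0" using Pnon[OF that(2,3)] by (simp add: P_def)
    then show ?thesis using l cnt_pos[of w \<beta>] by simp
  qed
  have wlink: "(x, z) \<in> E" if x: "x \<in> ?B" "z \<in> verts w" "z \<notin> ?B" for x z
  proof -
    obtain b where "(z, b) \<in> set w" using x(2) by (auto simp: in_verts_iff)
    then show ?thesis using outside[of "(z, b)" x] x by auto
  qed
  define a' where "a' = restrict_word ?B w"
  define t where "t = restrict_word (- ?B) w"
  have weq: "raag_eq E w (a' @ t)"
    unfolding a'_def t_def by (rule raag_eq_split) (use wlink in blast)
  have tlink: "verts t \<subseteq> link E ?B" using wlink by (auto simp: t_def verts_restrict_word link_def)
  have tu: "wcomm E t u"
    using wcomm_verts[of u t E] tlink by (auto simp: link_def wcomm_sym)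
  have aeq: "raag_eq E a' (w @ winv t)"
    using raag_eq_trans[OF raag_eq_append[OF weq raag_eq_refl, of "winv t"], of a']
      raag_eq_cancel_right[of E a' t "[]"] by (auto intro: raag_eq_sym)
  have "wcomm E w u" using comm by (simp add: wcomm_def teq_raag_eq)
  then have a'u: "wcomm E a' u"
    using wcomm_cong[OF aeq raag_eq_refl, of u] tu by (auto intro: wcomm_append2)
  \<comment> \<open>In each projection the two words commute and the ratio equalises the lengths of
    the two powers, so these coincide.\<close>
  have pa: "raag_eq E (wpow a' l) (wpow u k)"
  proof (rule teq_raag_eq, unfold teq_def, intro allI impI)
    have *: "proj \<alpha> \<beta> (wpow a' l) = proj \<alpha> \<beta> (wpow u k)"
      if n: "(fst \<alpha>, fst \<beta>) \<notin> E" and \<alpha>: "fst \<alpha> \<in> ?B" for \<alpha> \<beta>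
    proof -
      have "proj \<alpha> \<beta> a' = proj \<alpha> \<beta> w"
        unfolding a'_def proj_def restrict_word_def filter_filter
        by (rule filter_cong) (use outside[OF _ \<alpha> n] \<alpha> in auto)
      moreover have "length (proj \<alpha> \<beta> v) = (if \<alpha> = \<beta> then cnt v \<alpha> else cnt v \<alpha> + cnt v \<beta>)" for v
        by (induction v) (auto simp: cnt_def)
      then have "length (proj \<alpha> \<beta> w) * l = length (proj \<alpha> \<beta> u) * k"
        using PB[OF \<alpha>] Pnon[OF \<alpha> n] by (simp add: P_def algebra_simps)
      then have "wpow (proj \<alpha> \<beta> w) l = wpow (proj \<alpha> \<beta> u) k"
        by (rule commuting_words_wpow_eq[OF pcomm[OF n]])
      ultimately show ?thesis by (simp add: proj_def filter_wpow)
    qed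
    fix \<alpha> \<beta> :: "'v \<times> bool" assume n: "(fst \<alpha>, fst \<beta>) \<notin> E"
    consider "fst \<alpha> \<in> ?B" | "fst \<beta> \<in> ?B" | "fst \<alpha> \<notin> ?B" "fst \<beta> \<notin> ?B" by blast
    then show "proj \<alpha> \<beta> (wpow a' l) = proj \<alpha> \<beta> (wpow u k)"
    proof cases
      case 1
      then show ?thesis using * n by blast
    next
      case 2
      have swap: "proj \<alpha> \<beta> v = proj \<beta> \<alpha> v" for v :: "('v \<times> bool) list"
        unfolding proj_def by (rule filter_cong) auto
      have "(fst \<beta>, fst \<alpha>) \<notin> E" using n edge_sym by blast
      then show ?thesis using * 2 swap by metis
    next
      case 3
      have "proj \<alpha> \<beta> a' = []" "proj \<alpha> \<beta> u = []"
        using 3 by (auto simp: proj_def a'_def restrict_word_def verts_def filter_empty_conv)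
      then show ?thesis by (simp add: proj_def filter_wpow)
    qed
  qed
  \<comment> \<open>Removes again the \<open>K\<close> copies of \<open>u\<close> that
    \<open>commuting_trace\<close> multiplied to \<open>y\<close>.\<close>
  define a where "a = a' @ wpow (winv u) K"
  have "raag_eq E y (w @ winv (wpow u K))"
    using raag_eq_trans[OF raag_eq_append[OF w raag_eq_refl, of "winv (wpow u K)"], of y]
      raag_eq_cancel_right[of E y "wpow u K" "[]"] by (auto intro: raag_eq_sym)
  also have "raag_eq E (w @ winv (wpow u K)) ((a' @ t) @ wpow (winv u) K)"
    by (simp only: winv_wpow raag_eq_append[OF weq raag_eq_refl])
  also have "raag_eq E ((a' @ t) @ wpow (winv u) K) (a @ t)"
    using wcomm_wpow[OF wcomm_winv[OF tu], of K] by (simp add: a_def raag_eq_left_cancel wcomm_def)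
  finally have yeq: "raag_eq E y (a @ t)" .
  have "raag_eq E (wpow a l) (wpow a' l @ wpow (wpow (winv u) K) l)"
    unfolding a_def by (rule wpow_append_commuting) (use a'u in \<open>simp add: wcomm_wpow\<close>)
  also have "raag_eq E (wpow a' l @ wpow (wpow (winv u) K) l) (wpow u k @ wpow (winv u) (K * l))"
    by (simp add: wpow_mult raag_eq_append[OF pa raag_eq_refl])
  also note wpow_cancel
  finally obtain v d where "v = u \<or> v = winv u" "raag_eq E (wpow a l) (wpow v d)"
    by (metis (full_types))
  moreover have "verts a \<subseteq> ?B" using verts_wpow[of "winv u" K] by (auto simp: a_def a'_def verts_restrict_word)
  ultimately show ?thesis using that yeq tlink l by blast
qed

lemma wcomm_vertex_star:
  assumes "wcomm E y [(x, True)]"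
  obtains y' where "raag_eq E y y'" "verts y' \<subseteq> insert x (link E {x})"
proof -
  have c: "cyc_red E [(x, True)]" "coconnected E (verts [(x, True)])"
    by (auto intro: cyc_red_positive)
  obtain a t where "raag_eq E y (a @ t)" "verts a \<subseteq> verts [(x, True)]" "verts t \<subseteq> link E (verts [(x, True)])"
    by (rule centraliser_block[OF c assms])
  then show ?thesis using that[of "a @ t"] by auto
qed

text \<open>The count of \<open>x\<close> in the geodesic \<open>wpow u (r * N)\<close> would grow
  linearly in \<open>N\<close>, while on the right only the two conjugating words can contain
  \<open>x\<close>.\<close>

lemma vertex_bound:
  assumes u: "cyc_red E u" and r: "r > 0"
    and eq: "\<And>N. raag_eq E (wpow u (r * N)) (wconj a (W N))" and W: "\<And>N. x \<notin> verts (W N)"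
  shows "x \<notin> verts u"
proof
  assume x: "x \<in> verts u"
  define cnt where "cnt v = length (filter (\<lambda>\<alpha>. fst \<alpha> = x) v)" for v :: "('v \<times> bool) list"
  have pos: "cnt u \<ge> 1"
    using x by (auto simp: cnt_def verts_def Suc_le_eq filter_empty_conv)
  define N where "N = Suc (2 * length a)"
  have "cnt (wpow u (r * N)) \<le> cnt (wconj a (W N))"
    unfolding cnt_def by (rule geo_length_filter[OF _ eq]) (use u in \<open>simp add: cyc_red_def\<close>)
  also have "\<dots> \<le> 2 * length a"
  proof -
    have "cnt (W N) = 0" using W[of N] by (auto simp: cnt_def verts_def filter_empty_conv)
    moreover have "cnt (winv a) \<le> length a" "cnt a \<le> length a"
      using length_filter_le[of "\<lambda>\<alpha>. fst \<alpha> = x" "winv a"] length_filter_le[of "\<lambda>\<alpha>. fst \<alpha> = x" a]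
      by (simp_all add: cnt_def)
    moreover have "cnt (wconj a (W N)) = cnt (winv a) + cnt (W N) + cnt a"
      by (simp add: wconj_def cnt_def)
    ultimately show ?thesis by linarith
  qed
  also have "cnt (wpow u (r * N)) = r * N * cnt u" by (simp add: cnt_def filter_wpow)
  finally have "r * N * cnt u \<le> 2 * length a" .
  moreover have "N \<le> r * N * cnt u" using pos r by simp
  ultimately show False by (simp add: N_def)
qed

text \<open>The alternative is decided by the exponent \<open>d\<close> of the component of
  \<open>y\<close> along \<open>u\<close>: for \<open>d = 0\<close> that component is trivial and
  \<open>y\<close> lies over the link; otherwise growth forces the two supports to agree.\<close>

lemma commuting_with_block:
  assumes u: "cyc_red E u" "coconnected E (verts u)" and u': "cyc_red E u'" "coconnected E (verts u')"
    and y: "raag_eq E y (wconj b u')" and comm: "wcomm E y u"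
  shows "(\<exists>v l d. l > 0 \<and> d > 0 \<and> (v = u \<or> v = winv u) \<and> raag_eq E (wpow y l) (wpow v d) \<and> verts u' = verts u)
    \<or> (\<exists>t. raag_eq E y t \<and> verts t \<subseteq> link E (verts u))"
proof -
  let ?B = "verts u" and ?B' = "verts u'"
  obtain a t v l d where a: "raag_eq E y (a @ t)" "verts a \<subseteq> ?B" "verts t \<subseteq> link E ?B"
    "l > 0" "v = u \<or> v = winv u" "raag_eq E (wpow a l) (wpow v d)"
    using centraliser_block[OF u comm] .
  have at: "wcomm E a t" by (rule wcomm_verts) (use a(2,3) in \<open>auto simp: link_def\<close>)
  show ?thesis
  proof (cases "d = 0")
    case True
    then have "raag_eq E a []" using raag_eq_wpow_Nil[of a l] a by simp
    then have "raag_eq E y t" using raag_eq_trans[OF a(1) raag_eq_append[OF _ raag_eq_refl]] by fastforce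
    then show ?thesis using a(3) by blast
  next
    case False
    have v: "cyc_red E v" "verts v = ?B" using a(5) u cyc_red_winv by auto
    have star: "raag_eq E (wconj b (wpow u' (l * N))) (wpow v (d * N) @ wpow t (l * N))" for N
    proof -
      have "raag_eq E (wconj b (wpow u' (l * N))) (wpow (wconj b u') (l * N))" by (rule wconj_wpow)
      also have "raag_eq E (wpow (wconj b u') (l * N)) (wpow (a @ t) (l * N))"
        by (rule raag_eq_wpow[OF raag_eq_trans[OF raag_eq_sym[OF y] a(1)]])
      also have "raag_eq E (wpow (a @ t) (l * N)) (wpow a (l * N) @ wpow t (l * N))"
        by (rule wpow_append_commuting[OF at])
      also have "raag_eq E (wpow a (l * N) @ wpow t (l * N)) (wpow v (d * N) @ wpow t (l * N))"
        using raag_eq_append[OF raag_eq_wpow[OF a(6), of N] raag_eq_refl] by (simp add: wpow_mult)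
      finally show ?thesis .
    qed
    \<comment> \<open>\<open>vertex_bound\<close> applied to \<open>u'\<close>: suitable powers of
      \<open>y\<close> are words over \<open>?B\<close> and its link.\<close>
    have sub: "?B' \<subseteq> ?B \<union> link E ?B"
    proof
      fix x assume "x \<in> ?B'"
      then show "x \<in> ?B \<union> link E ?B"
        using vertex_bound[OF u'(1) a(4), of "winv b" "\<lambda>N. wpow v (d * N) @ wpow t (l * N)" x]
          star[unfolded raag_eq_wconj_move] a(3) v(2) verts_wpow by fastforce
    qed
    have td: "verts t \<inter> ?B = {}" using a(3) link_disjoint[of ?B] by blast
    \<comment> \<open>Retracting to \<open>?B\<close> kills \<open>t\<close>; powers of
      \<open>v\<close> are then conjugates of words over the common vertices of \<open>?B\<close>
      and \<open>?B'\<close>, and \<open>vertex_bound\<close> applies to \<open>v\<close>.\<close>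
    have "?B \<subseteq> ?B'"
    proof
      fix x assume x: "x \<in> ?B"
      show "x \<in> ?B'"
      proof (rule ccontr)
        assume nx: "x \<notin> ?B'"
        have "x \<notin> verts v"
        proof (rule vertex_bound[OF v(1), of d "restrict_word ?B b" "\<lambda>N. wpow (restrict_word ?B u') (l * N)"])
          fix N
          have "restrict_word ?B (wpow v (d * N)) = wpow v (d * N)"
            using restrict_word_id[of v ?B] v(2) by (simp add: restrict_word_wpow)
          moreover have "restrict_word ?B (wpow t (l * N)) = []"
            using restrict_word_disjoint[OF td] by (simp add: restrict_word_wpow)
          ultimately show "raag_eq E (wpow v (d * N)) (wconj (restrict_word ?B b) (wpow (restrict_word ?B u') (l * N)))"
            using raag_eq_sym[OF raag_eq_restrict_word[OF star[of N], of ?B]]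
            by (simp add: restrict_word_wconj restrict_word_wpow)
          show "x \<notin> verts (wpow (restrict_word ?B u') (l * N))"
            using nx verts_wpow[of "restrict_word ?B u'"] by (auto simp: verts_restrict_word)
        qed (use False in simp)
        then show False using x v by simp
      qed
    qed
    \<comment> \<open>A proper inclusion would give a non-edge from \<open>?B\<close> to the rest of
      \<open>?B'\<close>, but that rest lies in the link.\<close>
    moreover have "\<not> ?B \<noteq> ?B'"
    proof
      assume "?B \<noteq> ?B'"
      then obtain x z where "x \<in> ?B" "z \<in> ?B' - ?B" "(x, z) \<notin> E"
        using u'(2) u(2) \<open>?B \<subseteq> ?B'\<close> unfolding coconnected_def by (metis (no_types, lifting))
      then show False using sub by (auto simp: link_def)
    qed
    ultimately have B: "?B' = ?B" by blast
    \<comment> \<open>Retracting to the link kills both \<open>v\<close> and \<open>u'\<close> and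
      leaves the power of \<open>t\<close>.\<close>
    have "raag_eq E (wpow t l) []"
    proof -
      let ?L = "link E ?B"
      have "restrict_word ?L (wpow v (d * 1)) = []" "restrict_word ?L (wpow u' (l * 1)) = []"
        using restrict_word_disjoint[of v ?L] restrict_word_disjoint[of u' ?L] v(2) B link_disjoint[of ?B]
        by (simp_all add: restrict_word_wpow)
      moreover have "restrict_word ?L (wpow t (l * 1)) = wpow t l"
        using restrict_word_id[OF a(3)] by (simp add: restrict_word_wpow)
      ultimately have "raag_eq E (wconj (restrict_word ?L b) []) (wpow t l)"
        using raag_eq_restrict_word[OF star[of 1], of ?L] by (simp add: restrict_word_wconj)
      then show ?thesis
        using raag_eq_trans[OF raag_eq_sym raag_eq_winv_left] by (simp add: wconj_simps)
    qed
    then have "raag_eq E t []" using raag_eq_wpow_Nil a(4) by blast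
    then have "raag_eq E y a" using raag_eq_trans[OF a(1), of a] raag_eq_append[OF raag_eq_refl[of E a], of t "[]"] by simp
    then have "raag_eq E (wpow y l) (wpow v d)" using raag_eq_trans[OF raag_eq_wpow a(6)] by blast
    then show ?thesis using a(4,5) False B by blast
  qed
qed

text \<open>The second alternative is commutation of the parabolic closures, tested on generators.
  It takes \<open>commuting_with_block\<close> twice: once to replace \<open>u\<close> by a vertex
  of its support, once with the roles exchanged to replace \<open>u'\<close>.\<close>

lemma commuting_blocks:
  assumes u: "cyc_red E u" "coconnected E (verts u)" and u': "cyc_red E u'" "coconnected E (verts u')"
    and comm: "wcomm E (wconj h u) (wconj k u')"
  shows "(\<forall>z. wcomm E (wconj h u) z \<longleftrightarrow> wcomm E (wconj k u') z) \<and> verts u = verts u'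
    \<or> (\<forall>s\<in>verts u. \<forall>s'\<in>verts u'. wcomm E (wconj h [(s, True)]) (wconj k [(s', True)]))"
proof -
  let ?y = "wconj (winv h) (wconj k u')"
  have y: "raag_eq E ?y (wconj (k @ winv h) u')" by (simp add: wconj_simps)
  have yu: "wcomm E ?y u" using comm wcomm_sym wcomm_wconj_move by blast
  from commuting_with_block[OF u u' y yu]
  consider v l d where "0 < l" "0 < d" "raag_eq E (wpow ?y l) (wpow v d)" "verts u' = verts u"
      "v = u \<or> v = winv u"
    | t where "raag_eq E ?y t" "verts t \<subseteq> link E (verts u)" by blast
  then show ?thesis
  proof cases
    case (1 v l d)
    note * = 1(1-4) and v = 1(5)
    have "wcomm E (wconj h u) z \<longleftrightarrow> wcomm E (wconj k u') z" for z
    proof -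
      let ?z = "wconj (winv h) z"
      have "wcomm E (wconj h u) z \<longleftrightarrow> wcomm E ?z v"
        using v wcomm_wconj_move[of E h u z] wcomm_sym[of E u ?z] by auto
      also have "\<dots> \<longleftrightarrow> wcomm E ?z (wpow v d)"
        using wcomm_wpow wcomm_wpow_cancel *(2) by blast
      also have "\<dots> \<longleftrightarrow> wcomm E ?z (wpow ?y l)"
        using wcomm_cong[OF raag_eq_refl *(3)] by blast
      also have "\<dots> \<longleftrightarrow> wcomm E ?z ?y"
        using wcomm_wpow wcomm_wpow_cancel *(1) by blast
      also have "\<dots> \<longleftrightarrow> wcomm E (wconj k u') z"
        using wcomm_sym by (simp add: wcomm_wconj_iff) blast
      finally show ?thesis .
    qed
    then show ?thesis using *(4) by simp
  next
    case (2 t)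
    note t = 2
    have "wcomm E (wconj h [(s, True)]) (wconj k [(s', True)])"
      if s: "s \<in> verts u" and s': "s' \<in> verts u'" for s s'
    proof -
      let ?x = "wconj (winv k) (wconj h [(s, True)])"
      have "wcomm E [(s, True)] t"
        by (rule wcomm_verts) (use t(2) s in \<open>auto simp: link_def\<close>)
      then have "wcomm E [(s, True)] ?y" using wcomm_cong[OF raag_eq_refl t(1)] by blast
      then have "wcomm E (wconj h [(s, True)]) (wconj k u')" by (simp add: wcomm_wconj_move)
      then have xu: "wcomm E ?x u'" using wcomm_sym wcomm_wconj_move by blast
      have x: "raag_eq E ?x (wconj (h @ winv k) [(s, True)])" by (simp add: wconj_simps)
      have cs: "cyc_red E [(s, True)]" "coconnected E (verts [(s, True)])"
        by (auto intro: cyc_red_positive)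
      \<comment> \<open>A common power with \<open>u'\<close> would give \<open>s\<close> a nonzero
        exponent in \<open>u'\<close>, but \<open>u'\<close> is conjugate to a word over the link of
        the support of \<open>u\<close>, which avoids \<open>s\<close>.\<close>
      have "\<not> (\<exists>v l d. l > 0 \<and> d > 0 \<and> (v = u' \<or> v = winv u') \<and> raag_eq E (wpow ?x l) (wpow v d))"
      proof
        assume "\<exists>v l d. l > 0 \<and> d > 0 \<and> (v = u' \<or> v = winv u') \<and> raag_eq E (wpow ?x l) (wpow v d)"
        then obtain v l d where *: "0 < l" "0 < d" "raag_eq E (wpow ?x l) (wpow v d)" and v: "v = u' \<or> v = winv u'"
          by blast
        have "int l = int d * exponent s v"
          using raag_eq_exponent[OF *(3), of s] by simp
        then have "exponent s u' \<noteq> 0" using v *(1) by auto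
        moreover have "exponent s u' = exponent s t" using raag_eq_exponent[OF t(1), of s] by simp
        moreover have "exponent s t = 0"
        proof -
          have "s \<notin> verts t" using t(2) s irrefl_E by (auto simp: link_def)
          then show ?thesis by (induction t) auto
        qed
        ultimately show False by simp
      qed
      then obtain t' where t': "raag_eq E ?x t'" "verts t' \<subseteq> link E (verts u')"
        using commuting_with_block[OF u' cs x xu] by blast
      have "wcomm E [(s', True)] t'"
        by (rule wcomm_verts) (use t'(2) s' in \<open>auto simp: link_def\<close>)
      then have "wcomm E [(s', True)] ?x" using wcomm_cong[OF raag_eq_refl t'(1)] by blast
      then have "wcomm E (wconj k [(s', True)]) (wconj h [(s, True)])" by (simp add: wcomm_wconj_move)
      then show ?thesis by (simp add: wcomm_sym)
    qed
    then show ?thesis by blast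
  qed
qed

section \<open>Generic conjugates of a generator\<close>

text \<open>The retraction to the star of \<open>r\<close> kills \<open>s\<close> and so sends the
  conjugate of \<open>e\<close> by the power of \<open>s\<close> back to \<open>e\<close>; both
  elements lie over the star, hence they are equal.\<close>

lemma commutes_if_two_conjugates:
  assumes rs: "r \<noteq> s" "(r, s) \<notin> E" and k: "k > 0"
    and e: "wcomm E e [(r, True)]" "wcomm E (wconj (winv (wpow [(s, True)] k)) e) [(r, True)]"
  shows "wcomm E [(s, True)] e"
proof -
  let ?S = "insert r (link E {r})" and ?s = "wpow [(s, True)] k"
  obtain e' where e': "raag_eq E e e'" "verts e' \<subseteq> ?S" using wcomm_vertex_star[OF e(1)] .
  obtain f where f: "raag_eq E (wconj (winv ?s) e) f" "verts f \<subseteq> ?S" using wcomm_vertex_star[OF e(2)] .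
  have "restrict_word ?S ?s = []"
    by (simp add: restrict_word_wpow) (use rs in \<open>auto simp: link_def\<close>)
  then have "restrict_word ?S (wconj (winv ?s) e') = e'"
    using restrict_word_id[OF e'(2)] by (simp add: restrict_word_wconj restrict_word_winv wconj_simps)
  moreover have "raag_eq E (wconj (winv ?s) e') f"
    using raag_eq_trans[OF wconj_cong[OF raag_eq_refl raag_eq_sym[OF e'(1)]] f(1)] .
  ultimately have "raag_eq E e' f" using restrict_word_retract f(2) by metis
  then have "raag_eq E (wconj (winv ?s) e) e"
    using raag_eq_trans[OF f(1) raag_eq_sym[OF raag_eq_trans[OF e'(1)]]] by blast
  then have "wcomm E (winv ?s) e" by (simp only: wcomm_iff_wconj)
  then have "wcomm E e ?s" by (simp add: wcomm_sym)
  then show ?thesis using wcomm_wpow_cancel[of e "[(s, True)]" k] k wcomm_sym by blast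
qed

text \<open>For given \<open>d\<close>, at most one exponent \<open>M\<close> can make the conjugate of \<open>d\<close> by the \<open>M\<close>-th power
  of \<open>s\<close> centralise \<open>X\<close>; hence an exponent suiting all \<open>d\<close> in a finite set exists.\<close>

lemma generic_conjugate_step:
  assumes r: "r \<in> X" "r \<noteq> s" "(r, s) \<notin> E"
    and IH: "\<And>D. finite D \<Longrightarrow> (\<And>d. d \<in> D \<Longrightarrow> \<exists>z\<in>X. \<not> wcomm E d [(z, True)]) \<Longrightarrow>
      \<exists>a. verts a \<subseteq> X \<and> (\<forall>d\<in>D. \<not> wcomm E d (wconj a [(x, True)]))"
    and D: "finite D" "\<And>d. d \<in> D \<Longrightarrow> \<exists>z\<in>insert s X. \<not> wcomm E d [(z, True)]"
  shows "\<exists>a. verts a \<subseteq> insert s X \<and> (\<forall>d\<in>D. \<not> wcomm E d (wconj a [(x, True)]))"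
proof -
  let ?s = "\<lambda>M. wpow [(s, True)] M"
  define cj where "cj M d = wconj (winv (?s M)) d" for M d
  define bad where "bad d = {M. \<forall>z\<in>X. wcomm E (cj M d) [(z, True)]}" for d
  have "\<not> M1 < M2" if d: "d \<in> D" and M: "M1 \<in> bad d" "M2 \<in> bad d" for d M1 M2
  proof
    assume less: "M1 < M2"
    have "cj M2 d = wconj (winv (?s (M2 - M1))) (cj M1 d)"
      using less by (simp add: cj_def wconj_simps flip: winv_simps(2) wpow_add)
    then have sc: "wcomm E [(s, True)] (cj M1 d)"
      using commutes_if_two_conjugates[of r s "M2 - M1" "cj M1 d"] r M less by (auto simp: bad_def)
    \<comment> \<open>The conjugation by a power of \<open>s\<close> was thus without effect:
      \<open>cj M1 d\<close> is \<open>d\<close>, which then commutes with \<open>s\<close> and all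
      of \<open>X\<close>, against the assumption on \<open>D\<close>.\<close>
    then have "wcomm E (?s M1) (cj M1 d)" using wcomm_sym wcomm_wpow by blast
    then have "raag_eq E (wconj (?s M1) (cj M1 d)) (cj M1 d)" by (rule wconj_commuting)
    then have eq: "raag_eq E (cj M1 d) d"
      using raag_eq_trans[OF raag_eq_sym] wconj_winv_cancel(2)[of E "?s M1" d] by (auto simp: cj_def)
    have "wcomm E d [(z, True)]" if "z \<in> insert s X" for z
      using that sc M(1) wcomm_cong[OF eq raag_eq_refl] wcomm_sym unfolding bad_def by blast
    then show False using D(2)[OF d] by blast
  qed
  then have "finite (bad d)" if "d \<in> D" for d
    using that by (metis finite.emptyI finite.insertI finite_subset insertI1 less_linear subsetI)
  then have "finite (\<Union>d\<in>D. bad d)" using D(1) by blast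
  then obtain M where M: "M \<notin> (\<Union>d\<in>D. bad d)" using ex_new_if_finite[OF infinite_UNIV_nat] by blast
  have "\<exists>z\<in>X. \<not> wcomm E d [(z, True)]" if "d \<in> cj M ` D" for d using that M by (auto simp: bad_def)
  from IH[OF _ this] obtain a where a: "verts a \<subseteq> X" "\<forall>d\<in>cj M ` D. \<not> wcomm E d (wconj a [(x, True)])"
    using D(1) by blast
  have "\<not> wcomm E d (wconj (a @ ?s M) [(x, True)])" if "d \<in> D" for d
  proof -
    have "wcomm E d (wconj (?s M) (wconj a [(x, True)])) \<longleftrightarrow> wcomm E (cj M d) (wconj a [(x, True)])"
      using wcomm_wconj_move wcomm_sym unfolding cj_def by blast
    then show ?thesis using a(2) that by (simp add: wconj_simps)
  qed
  moreover have "verts (a @ ?s M) \<subseteq> insert s X" using a(1) verts_wpow[of "[(s, True)]" M] by auto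
  ultimately show ?thesis by blast
qed

text \<open>\<open>X\<close> grows from \<open>{x}\<close> to \<open>B\<close> one vertex at a time,
  each reached from \<open>X\<close> by a non-edge. The finite set is quantified inside
  \<open>good\<close> because \<open>generic_conjugate_step\<close> passes to conjugates of its
  elements.\<close>

lemma generic_conjugate:
  assumes B: "finite B" "coconnected E B" "x \<in> B"
    and D: "finite D" "\<And>d. d \<in> D \<Longrightarrow> \<exists>z\<in>B. \<not> wcomm E d [(z, True)]"
  shows "\<exists>a. verts a \<subseteq> B \<and> (\<forall>d\<in>D. \<not> wcomm E d (wconj a [(x, True)]))"
proof -
  define good where "good X \<longleftrightarrow> x \<in> X \<and> X \<subseteq> B \<and> (\<forall>D. finite D \<longrightarrow> (\<forall>d\<in>D. \<exists>z\<in>X. \<not> wcomm E d [(z, True)]) \<longrightarrow>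
      (\<exists>a. verts a \<subseteq> X \<and> (\<forall>d\<in>D. \<not> wcomm E d (wconj a [(x, True)]))))" for X
  have "good {x}"
    unfolding good_def using B(3) by (auto intro!: exI[of _ "[]"] simp: wconj_simps)
  moreover have "finite {X. good X}"
    by (rule finite_subset[of _ "Pow B"]) (use B(1) in \<open>auto simp: good_def\<close>)
  ultimately obtain X where X: "good X" "\<And>Y. good Y \<Longrightarrow> X \<subseteq> Y \<Longrightarrow> X = Y"
    using finite_has_maximal2[of "{X. good X}" "{x}"] by auto
  have "X = B"
  proof (rule ccontr)
    assume "X \<noteq> B"
    then obtain r s where rs: "r \<in> X" "s \<in> B - X" "(r, s) \<notin> E"
      using B(2) X(1) unfolding coconnected_def good_def by (metis empty_iff)
    have "good (insert s X)"
      unfolding good_def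
    proof (intro conjI allI impI)
      fix D assume "finite D" "\<forall>d\<in>D. \<exists>z\<in>insert s X. \<not> wcomm E d [(z, True)]"
      then show "\<exists>a. verts a \<subseteq> insert s X \<and> (\<forall>d\<in>D. \<not> wcomm E d (wconj a [(x, True)]))"
        using X(1) rs by (intro generic_conjugate_step[of r X s]) (auto simp: good_def)
    qed (use X(1) rs in \<open>auto simp: good_def\<close>)
    then show False using X(2)[of "insert s X"] rs by blast
  qed
  then show ?thesis using X(1) D unfolding good_def by blast
qed

end

section \<open>Blocks of a finite family of elements\<close>

definition cocomp :: "('v \<times> 'v) set \<Rightarrow> 'v set \<Rightarrow> 'v \<Rightarrow> 'v set" where
  "cocomp E S x = {y. (x, y) \<in> {(a, b). a \<in> S \<and> b \<in> S \<and> (a, b) \<notin> E}\<^sup>*}"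

definition some_rep :: "'v set \<Rightarrow> 'v" where
  "some_rep C = (SOME y. y \<in> C)"

text \<open>Naming a component by one of its own vertices keeps the block indices inside
  \<open>VD \<times> VG\<close>, on which the finiteness of the set of types rests.\<close>

definition block_reps :: "('v \<times> 'v) set \<Rightarrow> 'v set \<Rightarrow> 'v set" where
  "block_reps E S = some_rep ` cocomp E S ` S"

text \<open>A choice that depends on the set alone, so that \<open>block_word\<close> is determined
  by \<open>J\<close>.\<close>

definition enum_list :: "'v set \<Rightarrow> 'v list" where
  "enum_list A = (SOME xs. set xs = A \<and> distinct xs)"

lemma enum_list: "finite A \<Longrightarrow> set (enum_list A) = A \<and> distinct (enum_list A)"
  unfolding enum_list_def by (rule someI_ex) (rule finite_distinct_list)

lemma cocomp_self: "x \<in> cocomp E S x"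
  by (simp add: cocomp_def)

lemma cocomp_subset: "x \<in> S \<Longrightarrow> cocomp E S x \<subseteq> S"
proof
  fix y assume x: "x \<in> S" and "y \<in> cocomp E S x"
  then have "(x, y) \<in> {(a, b). a \<in> S \<and> b \<in> S \<and> (a, b) \<notin> E}\<^sup>*" by (simp add: cocomp_def)
  then show "y \<in> S" using x by (induction rule: rtrancl_induct) auto
qed

lemma wcomm_wconj_words:
  assumes "\<And>s s'. s \<in> verts w \<Longrightarrow> s' \<in> verts w' \<Longrightarrow> wcomm E (wconj h [(s, True)]) (wconj k [(s', True)])"
  shows "wcomm E (wconj h w) (wconj k w')"
proof -
  have 1: "wcomm E (wconj h [(s, True)]) (wconj k w')" if s: "s \<in> verts w" for s
  proof -
    have "wcomm E (wconj (winv k) (wconj h [(s, True)])) w'"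
    proof (rule wcomm_letters)
      fix \<alpha> assume "\<alpha> \<in> set w'"
      then have "wcomm E (wconj h [(s, True)]) (wconj k [(fst \<alpha>, True)])"
        using assms[OF s, of "fst \<alpha>"] by (auto simp: verts_def)
      then show "wcomm E (wconj (winv k) (wconj h [(s, True)])) [(fst \<alpha>, True)]"
        using wcomm_sym wcomm_wconj_move by blast
    qed
    then show ?thesis using wcomm_sym wcomm_wconj_move by blast
  qed
  have "wcomm E (wconj (winv h) (wconj k w')) w"
  proof (rule wcomm_letters)
    fix \<alpha> assume "\<alpha> \<in> set w"
    then have "wcomm E (wconj h [(fst \<alpha>, True)]) (wconj k w')" using 1[of "fst \<alpha>"] by (auto simp: verts_def)
    then show "wcomm E (wconj (winv h) (wconj k w')) [(fst \<alpha>, True)]"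
      using wcomm_sym wcomm_wconj_move by blast
  qed
  then show ?thesis using wcomm_sym wcomm_wconj_move by blast
qed

lemma wconj_concat: "raag_eq E (wconj h (concat ws)) (concat (map (wconj h) ws))"
proof (induction ws)
  case Nil
  then show ?case by (simp add: wconj_simps raag_eq_winv_left)
next
  case (Cons w ws)
  then show ?case
    using raag_eq_trans[OF wconj_append raag_eq_append[OF raag_eq_refl Cons.IH]] by simp
qed

lemma length_restrict_word: "length (restrict_word B w) + length (restrict_word (- B) w) = length w"
  by (induction w) auto

section \<open>Components of the complement graph and the blocks they cut out\<close>

context pc_graph
begin

lemma cocomp_sym: "y \<in> cocomp E S x \<Longrightarrow> x \<in> cocomp E S y"
proof -
  let ?r = "{(a, b). a \<in> S \<and> b \<in> S \<and> (a, b) \<notin> E}"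
  have "sym (?r\<^sup>*)" by (rule sym_rtrancl) (use edge_sym in \<open>auto simp: sym_def\<close>)
  then show "y \<in> cocomp E S x \<Longrightarrow> x \<in> cocomp E S y" by (auto simp: cocomp_def dest: symD)
qed

lemma cocomp_eq: "y \<in> cocomp E S x \<Longrightarrow> cocomp E S y = cocomp E S x"
  using cocomp_sym[of y S x] unfolding cocomp_def by (auto intro: rtrancl_trans)

lemma cocomp_closed:
  assumes "y \<in> cocomp E S x" "y \<in> S" "z \<in> S" "z \<notin> cocomp E S x"
  shows "(y, z) \<in> E"
proof (rule ccontr)
  assume "(y, z) \<notin> E"
  then have "(x, z) \<in> {(a, b). a \<in> S \<and> b \<in> S \<and> (a, b) \<notin> E}\<^sup>*"
    using assms by (auto simp: cocomp_def intro: rtrancl_into_rtrancl)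
  then show False using assms by (simp add: cocomp_def)
qed

lemma coconnected_cocomp: "coconnected E (cocomp E S x)"
  unfolding coconnected_def
proof (intro conjI allI impI)
  show "cocomp E S x \<noteq> {}" using cocomp_self by fast
  fix X assume X: "X \<subseteq> cocomp E S x \<and> X \<noteq> {} \<and> X \<noteq> cocomp E S x"
  then obtain a b where ab: "a \<in> X" "b \<in> cocomp E S x" "b \<notin> X" by blast
  show "\<exists>x'\<in>X. \<exists>y\<in>cocomp E S x - X. (x', y) \<notin> E"
  proof (rule ccontr)
    assume n: "\<not> ?thesis"
    have "cocomp E S a = cocomp E S x" using X ab cocomp_eq by blast
    then have "(a, b) \<in> {(a, b). a \<in> S \<and> b \<in> S \<and> (a, b) \<notin> E}\<^sup>*" using ab by (auto simp: cocomp_def)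
    then have "b \<in> X"
    proof (induction rule: rtrancl_induct)
      case (step y z)
      then have "z \<in> cocomp E S x"
        using X by (auto simp: cocomp_def intro: rtrancl_into_rtrancl)
      then show ?case using n step by blast
    qed (rule ab)
    then show False using ab by simp
  qed
qed

lemma some_rep_cocomp: "some_rep (cocomp E S x) \<in> cocomp E S x"
  unfolding some_rep_def by (rule someI[of _ x]) (rule cocomp_self)

lemma block_reps_subset: "block_reps E S \<subseteq> S"
proof
  fix x assume "x \<in> block_reps E S"
  then obtain y where "y \<in> S" "x = some_rep (cocomp E S y)" by (auto simp: block_reps_def)
  then show "x \<in> S" using some_rep_cocomp[of S y] cocomp_subset[of y S E] by auto
qed

lemma block_reps_rep: "x \<in> block_reps E S \<Longrightarrow> some_rep (cocomp E S x) = x"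
proof -
  assume "x \<in> block_reps E S"
  then obtain y where "x = some_rep (cocomp E S y)" by (auto simp: block_reps_def)
  then show ?thesis using cocomp_eq[OF some_rep_cocomp, of S y] by simp
qed

lemma block_reps_disjoint:
  assumes "x \<in> block_reps E S" "y \<in> block_reps E S" "x \<noteq> y"
  shows "cocomp E S x \<inter> cocomp E S y = {}"
proof (rule ccontr)
  assume "\<not> ?thesis"
  then have "cocomp E S x = cocomp E S y" using cocomp_eq by (metis disjoint_iff)
  then show False using assms block_reps_rep by metis
qed

lemma block_reps_cover: "(\<Union>x\<in>block_reps E S. cocomp E S x) = S"
proof -
  have "y \<in> (\<Union>x\<in>block_reps E S. cocomp E S x)" if "y \<in> S" for y
  proof
    show "some_rep (cocomp E S y) \<in> block_reps E S" using that by (simp add: block_reps_def)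
    show "y \<in> cocomp E S (some_rep (cocomp E S y))"
      by (rule cocomp_sym[OF some_rep_cocomp])
  qed
  moreover have "cocomp E S x \<subseteq> S" if "x \<in> block_reps E S" for x
    using that block_reps_subset[of S] cocomp_subset[of x S E] by auto
  ultimately show ?thesis by blast
qed

lemma raag_eq_concat_blocks:
  assumes "\<And>C x z. C \<in> set Cs \<Longrightarrow> x \<in> C \<Longrightarrow> x \<in> verts u \<Longrightarrow> z \<in> verts u \<Longrightarrow> z \<notin> C \<Longrightarrow> (x, z) \<in> E"
    and "distinct Cs" and "\<And>C C'. C \<in> set Cs \<Longrightarrow> C' \<in> set Cs \<Longrightarrow> C \<noteq> C' \<Longrightarrow> C \<inter> C' = {}"
    and "verts u \<subseteq> \<Union> (set Cs)"
  shows "raag_eq E u (concat (map (\<lambda>C. restrict_word C u) Cs))"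
  using assms
proof (induction Cs arbitrary: u)
  case (Cons C Cs)
  let ?u = "restrict_word (- C) u"
  have "raag_eq E u (restrict_word C u @ ?u)" by (rule raag_eq_split) (use Cons.prems(1) in auto)
  moreover have "raag_eq E ?u (concat (map (\<lambda>C. restrict_word C ?u) Cs))"
  proof (rule Cons.IH)
    fix C' x z assume "C' \<in> set Cs" "x \<in> C'" "x \<in> verts ?u" "z \<in> verts ?u" "z \<notin> C'"
    then show "(x, z) \<in> E" using Cons.prems(1)[of C' x z] by (simp add: verts_restrict_word)
  next
    show "verts ?u \<subseteq> \<Union> (set Cs)" using Cons.prems(4) by (auto simp: verts_restrict_word)
  qed (use Cons.prems in auto)
  moreover have "map (\<lambda>C. restrict_word C ?u) Cs = map (\<lambda>C. restrict_word C u) Cs"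
  proof (rule map_cong[OF refl])
    fix C' assume C': "C' \<in> set Cs"
    then have "C' \<inter> C = {}" using Cons.prems(2,3) by auto
    then show "restrict_word C' ?u = restrict_word C' u"
      unfolding restrict_word_def filter_filter by (intro filter_cong) auto
  qed
  ultimately show ?case
    using raag_eq_trans[OF _ raag_eq_append[OF raag_eq_refl]] by simp
qed simp

text \<open>\<open>wpow u k\<close> is rearranged into the \<open>k\<close>-th powers of the two
  parts without change of length, and a prefix of a geodesic is geodesic.\<close>

lemma cyc_red_restrict_word:
  assumes u: "cyc_red E u"
    and B: "\<And>x z. x \<in> verts u \<Longrightarrow> x \<in> B \<Longrightarrow> z \<in> verts u \<Longrightarrow> z \<notin> B \<Longrightarrow> (x, z) \<in> E"
  shows "cyc_red E (restrict_word B u)"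
  unfolding cyc_red_def
proof
  fix k
  let ?b = "restrict_word B u" and ?c = "restrict_word (- B) u"
  have "wcomm E ?b ?c" by (rule wcomm_verts) (use B in \<open>auto simp: verts_restrict_word\<close>)
  then have "raag_eq E (wpow u k) (wpow ?b k @ wpow ?c k)"
    using raag_eq_trans[OF raag_eq_wpow[OF raag_eq_split[of u B, OF B]] wpow_append_commuting] by blast
  moreover have "length (wpow ?b k @ wpow ?c k) \<le> length (wpow u k)"
    using length_restrict_word[of B u] by (simp flip: distrib_left)
  ultimately have "geo E (wpow ?b k @ wpow ?c k)"
    using geo_if_length[OF raag_eq_sym, of "wpow u k"] u by (simp add: cyc_red_def)
  then show "geo E (wpow ?b k)" by (rule geo_prefix)
qed

text \<open>Conjugates are chosen one after another, each against the original blocks and against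
  the conjugates already chosen. Non-commutation with all original blocks is carried along because
  it is what lets the remaining ones be treated later.\<close>

lemma generic_family:
  assumes J: "finite J" and U: "\<And>j. j \<in> J \<Longrightarrow> cyc_red E (U j) \<and> coconnected E (verts (U j))"
  obtains b x where "\<And>j. j \<in> J \<Longrightarrow> x j \<in> verts (U j)"
    and "\<And>j. j \<in> J \<Longrightarrow> \<exists>i\<in>J. verts (b j) \<subseteq> verts (U i) \<union> verts (H i)"
    and "\<And>j k. j \<in> J \<Longrightarrow> k \<in> J \<Longrightarrow> wcomm E (wconj (H j) (U j)) (wconj (H k) (U k)) \<longleftrightarrow>
      wcomm E (wconj (b j) [(x j, True)]) (wconj (b k) [(x k, True)])"
proof -
  define p where "p j = wconj (H j) (U j)" for j
  define y where "y j = some_rep (verts (U j))" for j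
  have y: "y j \<in> verts (U j)" if "j \<in> J" for j
  proof -
    have "\<exists>z. z \<in> verts (U j)" using U[OF that] by (auto simp: coconnected_def)
    then show ?thesis unfolding y_def some_rep_def by (rule someI_ex)
  qed
  have "\<exists>a. \<forall>i\<in>R. verts (a i) \<subseteq> verts (U i) \<and>
      (\<forall>k\<in>J. \<not> wcomm E (p k) (p i) \<longrightarrow> \<not> wcomm E (p k) (wconj (a i @ H i) [(y i, True)])) \<and>
      (\<forall>k\<in>R. \<not> wcomm E (p k) (p i) \<longrightarrow>
         \<not> wcomm E (wconj (a k @ H k) [(y k, True)]) (wconj (a i @ H i) [(y i, True)]))"
    if "R \<subseteq> J" for R
    using finite_subset[OF that J] that
  proof (induction R rule: finite_induct)
    case (insert i R)
    then obtain a where a: "\<And>i. i \<in> R \<Longrightarrow> verts (a i) \<subseteq> verts (U i)"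
      "\<And>i k. i \<in> R \<Longrightarrow> k \<in> J \<Longrightarrow> \<not> wcomm E (p k) (p i) \<Longrightarrow> \<not> wcomm E (p k) (wconj (a i @ H i) [(y i, True)])"
      "\<And>i k. i \<in> R \<Longrightarrow> k \<in> R \<Longrightarrow> \<not> wcomm E (p k) (p i) \<Longrightarrow>
         \<not> wcomm E (wconj (a k @ H k) [(y k, True)]) (wconj (a i @ H i) [(y i, True)])"
      by (metis insert_subset)
    define c where "c k = wconj (a k @ H k) [(y k, True)]" for k
    define D where "D = p ` {k \<in> J. \<not> wcomm E (p k) (p i)} \<union> c ` {k \<in> R. \<not> wcomm E (p k) (p i)}"
    have iJ: "i \<in> J" and RJ: "R \<subseteq> J" using insert.prems by auto
    have Di: "\<not> wcomm E d (p i)" if "d \<in> D" for d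
    proof -
      have "\<not> wcomm E (c k) (p i)" if k: "k \<in> R" "\<not> wcomm E (p k) (p i)" for k
        using a(2)[OF k(1) iJ] k(2) wcomm_sym unfolding c_def by blast
      then show ?thesis using that unfolding D_def by auto
    qed
    have "\<exists>z\<in>verts (U i). \<not> wcomm E d [(z, True)]" if d: "d \<in> wconj (winv (H i)) ` D" for d
    proof (rule ccontr)
      assume n: "\<not> ?thesis"
      obtain d' where d': "d' \<in> D" "d = wconj (winv (H i)) d'" using d by blast
      have "wcomm E d (U i)" by (rule wcomm_letters) (use n in \<open>auto simp: verts_def\<close>)
      then have "wcomm E d' (p i)" using d'(2) wcomm_sym wcomm_wconj_move unfolding p_def by blast
      then show False using Di[OF d'(1)] by simp
    qed
    moreover have "finite (wconj (winv (H i)) ` D)"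
      using J insert.hyps(1) by (simp add: D_def)
    ultimately obtain e where e: "verts e \<subseteq> verts (U i)"
      "\<And>d. d \<in> wconj (winv (H i)) ` D \<Longrightarrow> \<not> wcomm E d (wconj e [(y i, True)])"
      using generic_conjugate[OF finite_verts _ y[OF iJ]] U[OF iJ] by metis
    let ?ci = "wconj (e @ H i) [(y i, True)]"
    have De: "\<not> wcomm E d ?ci" if "d \<in> D" for d
    proof -
      have "wcomm E d (wconj (H i) (wconj e [(y i, True)])) \<longleftrightarrow>
          wcomm E (wconj (winv (H i)) d) (wconj e [(y i, True)])"
        using wcomm_sym wcomm_wconj_move by blast
      then show ?thesis using e(2) that by (simp add: wconj_simps)
    qed
    define a' where "a' = a(i := e)"
    have a'R: "a' k = a k" if "k \<in> R" for k using that insert.hyps(2) by (auto simp: a'_def)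
    have a'i: "a' i = e" by (simp add: a'_def)
    show ?case
    proof (intro exI[of _ a'] ballI conjI impI)
      fix k assume "k \<in> insert i R"
      then show "verts (a' k) \<subseteq> verts (U k)" using e(1) a(1)[of k] a'i a'R[of k] by auto
    next
      fix j k assume j: "j \<in> insert i R" and k: "k \<in> J" and n: "\<not> wcomm E (p k) (p j)"
      show "\<not> wcomm E (p k) (wconj (a' j @ H j) [(y j, True)])"
      proof (cases "j = i")
        case True
        then show ?thesis using De[of "p k"] k n a'i by (auto simp: D_def)
      next
        case False
        then show ?thesis using j a(2)[of j k] k n a'R by auto
      qed
    next
      fix j k assume j: "j \<in> insert i R" and k: "k \<in> insert i R" and n: "\<not> wcomm E (p k) (p j)"
      have n': "\<not> wcomm E (p j) (p k)" using n wcomm_sym by blast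
      consider "j = i" "k \<in> R" | "k = i" "j \<in> R" | "j \<in> R" "k \<in> R" | "j = i" "k = i" using j k by blast
      then show "\<not> wcomm E (wconj (a' k @ H k) [(y k, True)]) (wconj (a' j @ H j) [(y j, True)])"
      proof cases
        case 1
        then show ?thesis using De[of "c k"] n a'i a'R by (auto simp: D_def c_def)
      next
        case 2
        then have "\<not> wcomm E (c j) ?ci" using De[of "c j"] n' by (auto simp: D_def)
        then have "\<not> wcomm E ?ci (c j)" using wcomm_sym by blast
        then show ?thesis using 2 a'i a'R by (simp add: c_def)
      next
        case 3
        then show ?thesis using a(3)[OF _ _ n] a'R by simp
      next
        case 4
        then show ?thesis using n by simp
      qed
    qed
  qed simp
  from this[OF subset_refl] obtain a where a: "\<And>i. i \<in> J \<Longrightarrow> verts (a i) \<subseteq> verts (U i)"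
      "\<And>i k. i \<in> J \<Longrightarrow> k \<in> J \<Longrightarrow> \<not> wcomm E (p k) (p i) \<Longrightarrow>
         \<not> wcomm E (wconj (a k @ H k) [(y k, True)]) (wconj (a i @ H i) [(y i, True)])"
    by metis
  \<comment> \<open>Blocks with equal key take over the conjugate of one representative. The
    centraliser in the key preserves the commutation relations; the support keeps
    \<open>y (\<rho> j)\<close> inside \<open>verts (U j)\<close>.\<close>
  define key where "key j = ({z. wcomm E (p j) z}, verts (U j))" for j
  define \<rho> where "\<rho> j = (SOME i. i \<in> J \<and> key i = key j)" for j
  have \<rho>: "\<rho> j \<in> J \<and> key (\<rho> j) = key j" if "j \<in> J" for j
    unfolding \<rho>_def by (rule someI[of _ j]) (use that in simp)
  have \<rho>_eq: "\<rho> i = \<rho> j" if "key i = key j" for i j using that by (simp add: \<rho>_def)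
  show ?thesis
  proof
    fix j assume j: "j \<in> J"
    show "y (\<rho> j) \<in> verts (U j)" using y[of "\<rho> j"] \<rho>[OF j] by (simp add: key_def)
    show "\<exists>i\<in>J. verts (a (\<rho> j) @ H (\<rho> j)) \<subseteq> verts (U i) \<union> verts (H i)"
      using a(1)[of "\<rho> j"] \<rho>[OF j] by (intro bexI[of _ "\<rho> j"]) auto
  next
    fix j k assume j: "j \<in> J" and k: "k \<in> J"
    let ?j = "\<rho> j" and ?k = "\<rho> k"
    have j': "?j \<in> J" and k': "?k \<in> J" using \<rho> j k by auto
    have jz: "wcomm E (p j) z \<longleftrightarrow> wcomm E (p ?j) z" and kz: "wcomm E (p k) z \<longleftrightarrow> wcomm E (p ?k) z" for z
      using \<rho>[OF j] \<rho>[OF k] by (auto simp: key_def)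
    have pp: "wcomm E (p j) (p k) \<longleftrightarrow> wcomm E (p ?j) (p ?k)"
      using jz[of "p k"] kz[of "p ?j"] wcomm_sym by blast
    have "wcomm E (p ?j) (p ?k) \<longleftrightarrow> wcomm E (wconj (a ?j @ H ?j) [(y ?j, True)]) (wconj (a ?k @ H ?k) [(y ?k, True)])"
    proof
      assume w: "wcomm E (p ?j) (p ?k)"
      have Uj: "cyc_red E (U ?j)" "coconnected E (verts (U ?j))"
        and Uk: "cyc_red E (U ?k)" "coconnected E (verts (U ?k))" using U[OF j'] U[OF k'] by auto
      \<comment> \<open>With equal keys the two replacements are the same element; otherwise they
        are words in the conjugated vertices of two supports that commute elementwise.\<close>
      have "key ?j = key ?k \<or> (\<forall>s\<in>verts (U ?j). \<forall>s'\<in>verts (U ?k).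
          wcomm E (wconj (H ?j) [(s, True)]) (wconj (H ?k) [(s', True)]))"
        using commuting_blocks[OF Uj Uk w[unfolded p_def]]
        by (elim disjE conjE) (simp_all add: key_def p_def)
      then show "wcomm E (wconj (a ?j @ H ?j) [(y ?j, True)]) (wconj (a ?k @ H ?k) [(y ?k, True)])"
      proof
        assume "key ?j = key ?k"
        then have "\<rho> j = \<rho> k" using \<rho>[OF j] \<rho>[OF k] by (intro \<rho>_eq) simp
        then show ?thesis by simp
      next
        assume s: "\<forall>s\<in>verts (U ?j). \<forall>s'\<in>verts (U ?k).
          wcomm E (wconj (H ?j) [(s, True)]) (wconj (H ?k) [(s', True)])"
        have "wcomm E (wconj (H ?j) (wconj (a ?j) [(y ?j, True)])) (wconj (H ?k) (wconj (a ?k) [(y ?k, True)]))"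
        proof (rule wcomm_wconj_words)
          fix z z' assume "z \<in> verts (wconj (a ?j) [(y ?j, True)])" "z' \<in> verts (wconj (a ?k) [(y ?k, True)])"
          then have "z \<in> verts (U ?j)" "z' \<in> verts (U ?k)"
            using a(1)[OF j'] a(1)[OF k'] y[OF j'] y[OF k'] by (auto simp: verts_wconj)
          then show "wcomm E (wconj (H ?j) [(z, True)]) (wconj (H ?k) [(z', True)])" using s by blast
        qed
        then show ?thesis by (simp add: wconj_simps)
      qed
    next
      assume "wcomm E (wconj (a ?j @ H ?j) [(y ?j, True)]) (wconj (a ?k @ H ?k) [(y ?k, True)])"
      then show "wcomm E (p ?j) (p ?k)" using a(2)[OF k' j'] by blast
    qed
    then show "wcomm E (wconj (H j) (U j)) (wconj (H k) (U k)) \<longleftrightarrow>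
      wcomm E (wconj (a ?j @ H ?j) [(y ?j, True)]) (wconj (a ?k @ H ?k) [(y ?k, True)])"
      using pp by (simp add: p_def)
  qed
qed

end

context pc_graph
begin

text \<open>The blocks of one element have disjoint supports, so their vertices
  \<open>x (v, s)\<close> differ; this later separates the conjugates that belong to one
  generator.\<close>

lemma block_family:
  fixes g :: "'a \<Rightarrow> ('v \<times> bool) list"
  assumes VD: "finite VD" and g: "\<And>v. v \<in> VD \<Longrightarrow> verts (g v) \<subseteq> VG" and VG: "finite VG"
  obtains J p b x where "J \<subseteq> VD \<times> VG"
    and "\<And>v. v \<in> VD \<Longrightarrow> raag_eq E (g v) (concat (map (\<lambda>s. p (v, s)) (enum_list {s. (v, s) \<in> J})))"
    and "\<And>v w s t. (v, s) \<in> J \<Longrightarrow> (w, t) \<in> J \<Longrightarrow> wcomm E (g v) (g w) \<Longrightarrow> wcomm E (p (v, s)) (p (w, t))"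
    and "\<And>j k. j \<in> J \<Longrightarrow> k \<in> J \<Longrightarrow> wcomm E (p j) (p k) \<longleftrightarrow>
      wcomm E (wconj (b j) [(x j, True)]) (wconj (b k) [(x k, True)])"
    and "\<And>v s t. (v, s) \<in> J \<Longrightarrow> (v, t) \<in> J \<Longrightarrow> s \<noteq> t \<Longrightarrow> x (v, s) \<noteq> x (v, t)"
    and "\<And>j. j \<in> J \<Longrightarrow> verts (b j) \<subseteq> VG \<and> x j \<in> VG"
proof -
  have "\<exists>h u. cyc_red E u \<and> raag_eq E (g v) (wconj h u) \<and> verts h \<subseteq> verts (g v) \<and> verts u \<subseteq> verts (g v)" for v
    by (rule cyc_red_exists[of "g v"]) blast
  then obtain h u where hu: "\<And>v. cyc_red E (u v)" "\<And>v. raag_eq E (g v) (wconj (h v) (u v))"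
    "\<And>v. verts (h v) \<subseteq> verts (g v)" "\<And>v. verts (u v) \<subseteq> verts (g v)" by metis
  define B where "B = (\<lambda>(v, s). cocomp E (verts (u v)) s)"
  define J where "J = {(v, s). v \<in> VD \<and> s \<in> block_reps E (verts (u v))}"
  define U where "U = (\<lambda>(v, s). restrict_word (B (v, s)) (u v))"
  define H where "H = (\<lambda>(v, s :: 'v). h v)"
  define p where "p j = wconj (H j) (U j)" for j
  have closed: "(y, z) \<in> E" if "y \<in> verts (u v)" "y \<in> B (v, s)" "z \<in> verts (u v)" "z \<notin> B (v, s)" for v s y z
    using cocomp_closed that by (auto simp: B_def)
  have UB: "verts (U (v, s)) = B (v, s)" if "(v, s) \<in> J" for v s
  proof -
    have "s \<in> verts (u v)" using that block_reps_subset by (auto simp: J_def)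
    then have "B (v, s) \<subseteq> verts (u v)" using cocomp_subset[of s "verts (u v)" E] by (simp add: B_def)
    then show ?thesis by (auto simp: U_def verts_restrict_word)
  qed
  have U: "cyc_red E (U j) \<and> coconnected E (verts (U j))" if "j \<in> J" for j
  proof -
    obtain v s where j: "j = (v, s)" by fastforce
    have "cyc_red E (U j)"
      unfolding j U_def prod.case by (rule cyc_red_restrict_word[OF hu(1)]) (rule closed)
    then show ?thesis using UB[of v s] that coconnected_cocomp by (auto simp: j B_def)
  qed
  have JV: "J \<subseteq> VD \<times> VG" using block_reps_subset hu(4) g by (fastforce simp: J_def)
  then have finJ: "finite J" using VD VG by (meson finite_SigmaI finite_subset)
  obtain b x where bx: "\<And>j. j \<in> J \<Longrightarrow> x j \<in> verts (U j)"
    "\<And>j. j \<in> J \<Longrightarrow> \<exists>i\<in>J. verts (b j) \<subseteq> verts (U i) \<union> verts (H i)"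
    "\<And>j k. j \<in> J \<Longrightarrow> k \<in> J \<Longrightarrow> wcomm E (wconj (H j) (U j)) (wconj (H k) (U k)) \<longleftrightarrow>
      wcomm E (wconj (b j) [(x j, True)]) (wconj (b k) [(x k, True)])"
    using generic_family[OF finJ, of U H] U by metis
  have UV: "verts (U j) \<union> verts (H j) \<subseteq> VG" if "j \<in> J" for j
  proof -
    obtain v s where j: "j = (v, s)" by fastforce
    then have "v \<in> VD" using that by (simp add: J_def)
    then show ?thesis using g[of v] hu(3)[of v] hu(4)[of v] by (auto simp: j U_def H_def verts_restrict_word)
  qed
  \<comment> \<open>What commutes with \<open>g v\<close> commutes with each of its blocks, by
    \<open>wcomm_restrict_word\<close> after removal of the conjugator \<open>h v\<close>.\<close>
  have half: "wcomm E y (p (v, s))" if "wcomm E y (g v)" for y v s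
  proof -
    have "wcomm E (wconj (winv (h v)) y) (u v)"
      using that wcomm_cong[OF raag_eq_refl hu(2)[of v]] wcomm_sym wcomm_wconj_move by blast
    then have "wcomm E (wconj (winv (h v)) y) (U (v, s))"
      unfolding U_def prod.case by (rule wcomm_restrict_word[OF hu(1)]) (rule closed)
    then have "wcomm E y (wconj (h v) (U (v, s)))" using wcomm_sym wcomm_wconj_move by blast
    then show ?thesis by (simp add: p_def H_def)
  qed
  show ?thesis
  proof (rule that[of J p b x])
    show "J \<subseteq> VD \<times> VG" by (rule JV)
  next
    fix v assume v: "v \<in> VD"
    let ?S = "verts (u v)"
    let ?xs = "enum_list {s. (v, s) \<in> J}"
    have JB: "{s. (v, s) \<in> J} = block_reps E ?S" using v by (auto simp: J_def)
    have "finite (block_reps E ?S)" by (rule finite_subset[OF block_reps_subset]) simp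
    then have xs: "set ?xs = block_reps E ?S" "distinct ?xs" using enum_list JB by auto
    have "inj_on (cocomp E ?S) (block_reps E ?S)"
      by (rule inj_onI) (metis block_reps_rep)
    then have "raag_eq E (u v) (concat (map (\<lambda>C. restrict_word C (u v)) (map (cocomp E ?S) ?xs)))"
    proof (intro raag_eq_concat_blocks)
      fix C y z assume "C \<in> set (map (cocomp E ?S) ?xs)" "y \<in> C" "y \<in> ?S" "z \<in> ?S" "z \<notin> C"
      then show "(y, z) \<in> E" using cocomp_closed by auto
    next
      fix C C' assume "C \<in> set (map (cocomp E ?S) ?xs)" "C' \<in> set (map (cocomp E ?S) ?xs)" "C \<noteq> C'"
      then show "C \<inter> C' = {}" using block_reps_disjoint xs(1) by auto
    qed (use xs block_reps_cover[of ?S] in \<open>auto simp: distinct_map\<close>)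
    then have "raag_eq E (wconj (h v) (u v)) (concat (map (wconj (h v)) (map (\<lambda>C. restrict_word C (u v)) (map (cocomp E ?S) ?xs))))"
      using raag_eq_trans[OF wconj_cong[OF raag_eq_refl] wconj_concat] by blast
    moreover have "map (wconj (h v)) (map (\<lambda>C. restrict_word C (u v)) (map (cocomp E ?S) ?xs)) = map (\<lambda>s. p (v, s)) ?xs"
      by (simp add: p_def H_def U_def B_def)
    ultimately show "raag_eq E (g v) (concat (map (\<lambda>s. p (v, s)) ?xs))"
      using raag_eq_trans[OF hu(2)[of v]] by metis
  next
    fix v w s t assume "wcomm E (g v) (g w)"
    then have "wcomm E (p (w, t)) (g v)" using half wcomm_sym by blast
    then show "wcomm E (p (v, s)) (p (w, t))" using half wcomm_sym by blast
  next
    fix j k assume "j \<in> J" "k \<in> J"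
    then show "wcomm E (p j) (p k) \<longleftrightarrow> wcomm E (wconj (b j) [(x j, True)]) (wconj (b k) [(x k, True)])"
      using bx(3) by (simp add: p_def)
  next
    fix v s t assume *: "(v, s) \<in> J" "(v, t) \<in> J" "s \<noteq> t"
    then have "cocomp E (verts (u v)) s \<inter> cocomp E (verts (u v)) t = {}"
      using block_reps_disjoint by (auto simp: J_def)
    then show "x (v, s) \<noteq> x (v, t)" using bx(1)[OF *(1)] bx(1)[OF *(2)] UB * by (auto simp: B_def)
  next
    fix j assume j: "j \<in> J"
    then show "verts (b j) \<subseteq> VG \<and> x j \<in> VG" using bx(1,2)[OF j] UV by blast
  qed
qed

end

section \<open>Cyclic covers\<close>

text \<open>The kernel of the homomorphism onto the cyclic group of order \<open>m\<close> that sends the generator \<open>v\<close>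
  to a generator and all others to 0 is again a partially commutative group, on the graph
  \<open>cover_E E v\<close> obtained by gluing \<open>m\<close> copies of the graph along the star of \<open>v\<close>; the vertex \<open>v\<close> of
  the new graph stands for the \<open>m\<close>-th power of \<open>v\<close>. The word \<open>lft E v m i w\<close> rewrites \<open>w\<close>, read from the
  sheet \<open>i\<close>, in the new generators.\<close>

definition node :: "(('v \<times> nat) \<times> ('v \<times> nat)) set \<Rightarrow> 'v \<times> nat \<Rightarrow> 'v \<times> nat \<Rightarrow> nat \<Rightarrow> 'v \<times> nat" where
  "node E v q i = (fst q, prod_encode (snd q, if q = v \<or> (v, q) \<in> E then 0 else i))"

definition cover_E :: "(('v \<times> nat) \<times> ('v \<times> nat)) set \<Rightarrow> 'v \<times> nat \<Rightarrow> (('v \<times> nat) \<times> ('v \<times> nat)) set" where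
  "cover_E E v = {(node E v q i, node E v r i) | q r i. (q, r) \<in> E}"

definition sheet :: "'v \<times> nat \<Rightarrow> nat \<Rightarrow> nat \<Rightarrow> ('v \<times> nat) \<times> bool \<Rightarrow> nat" where
  "sheet v m i \<alpha> = (if fst \<alpha> \<noteq> v then i else if snd \<alpha> then (if Suc i = m then 0 else Suc i)
     else (if i = 0 then m - 1 else i - 1))"

text \<open>\<open>v\<close> yields the new generator for its \<open>m\<close>-th power only when
  the counter wraps around between \<open>m - 1\<close> and \<open>0\<close>; its other crossings
  leave no letter.\<close>

definition lift_letter ::
  "(('v \<times> nat) \<times> ('v \<times> nat)) set \<Rightarrow> 'v \<times> nat \<Rightarrow> nat \<Rightarrow> nat \<Rightarrow> ('v \<times> nat) \<times> bool \<Rightarrow> (('v \<times> nat) \<times> bool) list" where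
  "lift_letter E v m i \<alpha> = (if fst \<alpha> \<noteq> v then [(node E v (fst \<alpha>) i, snd \<alpha>)]
     else if (if snd \<alpha> then Suc i = m else i = 0) then [(node E v v 0, snd \<alpha>)] else [])"

text \<open>Reidemeister-Schreier rewriting for the transversal of the powers v^i with
  \<open>i < m\<close>.\<close>

fun lft ::
  "(('v \<times> nat) \<times> ('v \<times> nat)) set \<Rightarrow> 'v \<times> nat \<Rightarrow> nat \<Rightarrow> nat \<Rightarrow> (('v \<times> nat) \<times> bool) list \<Rightarrow> (('v \<times> nat) \<times> bool) list" where
  "lft E v m i [] = []"
| "lft E v m i (\<alpha> # w) = lift_letter E v m i \<alpha> @ lft E v m (sheet v m i \<alpha>) w"

abbreviation end_sheet :: "'v \<times> nat \<Rightarrow> nat \<Rightarrow> nat \<Rightarrow> (('v \<times> nat) \<times> bool) list \<Rightarrow> nat" where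
  "end_sheet v m i w \<equiv> foldl (sheet v m) i w"

lemma wpow_letter_Cons: "wpow [a] k @ a # z = a # wpow [a] k @ z"
  by (induction k) auto

lemma node_inj: "node E v q i = node E v r j \<Longrightarrow> q = r"
  by (auto simp: node_def prod_eq_iff)

lemma lft_append: "lft E v m i (u @ w) = lft E v m i u @ lft E v m (end_sheet v m i u) w"
  by (induction u arbitrary: i) auto

lemma sheet_less: "i < m \<Longrightarrow> sheet v m i \<alpha> < m"
  by (auto simp: sheet_def)

lemma end_sheet_less: "i < m \<Longrightarrow> end_sheet v m i w < m"
  by (induction w arbitrary: i) (auto simp: sheet_less)

lemma sheet_linv: "i < m \<Longrightarrow> sheet v m (sheet v m i \<alpha>) (linv \<alpha>) = i"
  by (auto simp: sheet_def linv_def)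

lemma lift_letter_linv: "i < m \<Longrightarrow> lift_letter E v m (sheet v m i \<alpha>) (linv \<alpha>) = winv (lift_letter E v m i \<alpha>)"
  by (auto simp: sheet_def lift_letter_def linv_def)

lemma lft_winv:
  "i < m \<Longrightarrow> lft E v m (end_sheet v m i w) (winv w) = winv (lft E v m i w) \<and>
     end_sheet v m (end_sheet v m i w) (winv w) = i"
proof (induction w arbitrary: i)
  case (Cons \<alpha> w)
  then show ?case
    using Cons.IH[OF sheet_less[OF Cons.prems, of v \<alpha>]] sheet_linv[OF Cons.prems, of v \<alpha>]
      lift_letter_linv[OF Cons.prems, of E v \<alpha>]
    by (simp add: lft_append)
qed simp

lemma lft_raag_eq:
  assumes graph: "pc_graph E" and eq: "raag_eq E u w" and i: "i < m"
  shows "raag_eq (cover_E E v) (lft E v m i u) (lft E v m i w)" "end_sheet v m i u = end_sheet v m i w"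
proof -
  define P where "P u w \<longleftrightarrow> (\<forall>i<m. raag_eq (cover_E E v) (lft E v m i u) (lft E v m i w) \<and>
      end_sheet v m i u = end_sheet v m i w)" for u w
  have core: "P (u @ a @ w) (u @ c @ w)" if "P a c" for u a c w
    unfolding P_def
  proof (intro allI impI)
    fix i assume i: "i < m"
    let ?i = "end_sheet v m i u"
    have "?i < m" using end_sheet_less[OF i] .
    then have "raag_eq (cover_E E v) (lft E v m ?i a) (lft E v m ?i c)" "end_sheet v m ?i a = end_sheet v m ?i c"
      using that by (auto simp: P_def)
    then show "raag_eq (cover_E E v) (lft E v m i (u @ a @ w)) (lft E v m i (u @ c @ w)) \<and>
      end_sheet v m i (u @ a @ w) = end_sheet v m i (u @ c @ w)"
      by (simp add: lft_append raag_eq_context)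
  qed
  have cancel: "P [(x, b), (x, \<not> b)] []" for x b
    unfolding P_def
  proof (intro allI impI)
    fix i assume i: "i < m"
    show "raag_eq (cover_E E v) (lft E v m i [(x, b), (x, \<not> b)]) (lft E v m i []) \<and>
      end_sheet v m i [(x, b), (x, \<not> b)] = end_sheet v m i []"
      using lift_letter_linv[OF i, of E v "(x, b)"] sheet_linv[OF i, of v "(x, b)"] raag_eq_winv_right
      by simp
  qed
  have commute: "P [(x, b), (y, c)] [(y, c), (x, b)]" if e: "(x, y) \<in> E" for x y b c
    unfolding P_def
  proof (intro allI impI)
    fix i assume i: "i < m"
    have e': "(y, x) \<in> E" using e pc_graph.sym_E[OF graph] by (auto dest: symD)
    have xy: "x \<noteq> y" using e pc_graph.irrefl_E[OF graph] by metis
    have edge: "(node E v x i, node E v y i) \<in> cover_E E v" for i using e unfolding cover_E_def by blast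
    have st: "sheet v m (sheet v m i (x, b)) (y, c) = sheet v m (sheet v m i (y, c)) (x, b)"
      using xy by (auto simp: sheet_def)
    \<comment> \<open>A neighbour of \<open>v\<close> has the same node on every sheet, so a
      crossing by \<open>v\<close> does not change its lift.\<close>
    have star: "node E v x j = node E v x k" if "y = v" for j k using e' that by (simp add: node_def)
    have star': "node E v y j = node E v y k" if "x = v" for j k using e that by (simp add: node_def)
    have nv: "node E v v j = node E v v k" for j k by (simp add: node_def)
    show "raag_eq (cover_E E v) (lft E v m i [(x, b), (y, c)]) (lft E v m i [(y, c), (x, b)]) \<and>
      end_sheet v m i [(x, b), (y, c)] = end_sheet v m i [(y, c), (x, b)]"
    proof -
      have "wcomm (cover_E E v) (lift_letter E v m i (x, b)) (lift_letter E v m i (y, c))"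
        by (rule wcomm_verts) (use edge[of i] edge[of 0] star[of 0 i] star'[of 0 i] xy in
          \<open>auto simp: lift_letter_def split: if_splits\<close>)
      moreover have "lift_letter E v m (sheet v m i (x, b)) (y, c) = lift_letter E v m i (y, c)"
        using xy star' by (auto simp: lift_letter_def sheet_def)
      moreover have "lift_letter E v m (sheet v m i (y, c)) (x, b) = lift_letter E v m i (x, b)"
        using xy star by (auto simp: lift_letter_def sheet_def)
      ultimately show ?thesis using st by (simp add: wcomm_def)
    qed
  qed
  have "P u w"
  proof (rule raag_eq_invariant[OF eq])
    fix u w assume "raag_step E u w"
    then show "P u w"
    proof cases
      case (cancel u' x b w')
      then show ?thesis using core[OF \<open>\<And>x b. P [(x, b), (x, \<not> b)] []\<close>, of u' x b w'] by simp
    next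
      case (commute x y u' b c w')
      then show ?thesis using core[OF \<open>\<And>x y b c. (x, y) \<in> E \<Longrightarrow> P [(x, b), (y, c)] [(y, c), (x, b)]\<close>, of x y u' b c w'] by simp
    qed
  qed (auto simp: P_def intro!: reflpI sympI transpI intro: raag_eq_sym raag_eq_trans)
  then show "raag_eq (cover_E E v) (lft E v m i u) (lft E v m i w)" "end_sheet v m i u = end_sheet v m i w"
    using i by (auto simp: P_def)
qed

text \<open>The homomorphism from the cover group back to the group: the copy of \<open>r\<close> on
  sheet \<open>i\<close> goes to v^i r v^-i. Star vertices are stored with sheet 0 and stay
  unconjugated.\<close>

definition unlift :: "'v \<times> nat \<Rightarrow> nat \<Rightarrow> 'v \<times> nat \<Rightarrow> (('v \<times> nat) \<times> bool) list" where
  "unlift v m q = (let r = (fst q, fst (prod_decode (snd q))) in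
     if r = v then wpow [(v, True)] m
     else wconj (winv (wpow [(v, True)] (snd (prod_decode (snd q))))) [(r, True)])"

section \<open>The cover group inside the original group\<close>

context
  fixes E :: "(('v \<times> nat) \<times> ('v \<times> nat)) set"
  assumes graph: "pc_graph E"
begin

interpretation pc_graph E by (rule graph)

lemma pc_graph_cover: "pc_graph (cover_E E v)"
proof
  show "sym (cover_E E v)" unfolding sym_def cover_E_def using edge_sym by blast
  show "(x, x) \<notin> cover_E E v" for x
    using irrefl_E node_inj[of E v] unfolding cover_E_def by (auto, metis)
qed

text \<open>On the star of \<open>v\<close> the node forgets \<open>i\<close>, but there conjugation
  by a power of \<open>v\<close> has no effect.\<close>

lemma unlift_node:
  "raag_eq E (unlift v m (node E v q i)) (wconj (winv (wpow [(v, True)] i)) (if q = v then wpow [(v, True)] m else [(q, True)]))"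
proof -
  let ?v = "[(v, True)]"
  have triv: "raag_eq E z (wconj (winv (wpow ?v i)) z)" if "wcomm E ?v z" for z
    using wconj_commuting[of E "winv (wpow ?v i)" z] that wcomm_sym wcomm_wpow raag_eq_sym by (metis wcomm_winv_iff(2))
  consider "q = v" | "q \<noteq> v" "(v, q) \<in> E" | "q \<noteq> v" "(v, q) \<notin> E" by blast
  then show ?thesis
  proof cases
    case 1
    then have "unlift v m (node E v q i) = wpow ?v m" by (simp add: unlift_def node_def)
    then show ?thesis using 1 triv[OF wcomm_wpow[OF wcomm_refl]] by simp
  next
    case 2
    then have "unlift v m (node E v q i) = [(q, True)]" by (simp add: unlift_def node_def wconj_simps)
    then show ?thesis using 2 triv[OF wcomm_edge[OF 2(2)]] by simp
  next
    case 3
    then have "unlift v m (node E v q i) = wconj (winv (wpow ?v i)) [(q, True)]"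
      by (simp add: unlift_def node_def)
    then show ?thesis using 3 by simp
  qed
qed

lemma unlift_hom:
  assumes "(q, r) \<in> cover_E E v"
  shows "wcomm E (unlift v m q) (unlift v m r)"
proof -
  obtain q' r' i where qr: "q = node E v q' i" "r = node E v r' i" "(q', r') \<in> E"
    using assms by (auto simp: cover_E_def)
  have "wcomm E (if q' = v then wpow [(v, True)] m else [(q', True)]) (if r' = v then wpow [(v, True)] m else [(r', True)])"
    using qr(3) wcomm_edge[of q' r' E True True] wcomm_wpow2[of E "[(q', True)]" "[(r', True)]"]
    by (auto intro: wcomm_wpow) (metis wcomm_sym wcomm_wpow)
  then show ?thesis
    unfolding qr using wcomm_cong[OF unlift_node unlift_node] by (simp add: wcomm_wconj_iff)
qed

lemma unlift_letter:
  assumes i: "i < m"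
  shows "raag_eq E (wsubst (unlift v m) (lift_letter E v m i \<alpha>))
    (wpow [(v, True)] i @ [\<alpha>] @ winv (wpow [(v, True)] (sheet v m i \<alpha>)))"
proof -
  let ?v = "[(v, True)]"
  obtain q b where \<alpha>: "\<alpha> = (q, b)" by fastforce
  show ?thesis
  proof (cases "q = v")
    case False
    have "raag_eq E (unlift v m (node E v q i)) (wconj (winv (wpow ?v i)) [(q, True)])"
      using unlift_node[of v m q i] False by simp
    moreover from raag_eq_winv[OF this]
    have "raag_eq E (winv (unlift v m (node E v q i))) (wconj (winv (wpow ?v i)) [(q, False)])"
      by (simp add: wconj_simps)
    ultimately show ?thesis using False \<alpha> by (auto simp: lift_letter_def sheet_def wconj_def)
  next
    case True
    have un: "unlift v m (node E v v 0) = wpow ?v m" by (simp add: unlift_def node_def)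
    have c: "raag_eq E [] (wpow ?v (Suc k) @ wpow [(v, False)] (Suc k))" for k
      using raag_eq_sym[OF raag_eq_winv_right[of E "wpow ?v (Suc k)"]] by (simp only: winv_wpow) simp
    show ?thesis
    proof (cases b)
      case b: True
      then show ?thesis using True \<alpha> un c[of i]
        by (auto simp: lift_letter_def sheet_def winv_wpow wpow_letter_Cons)
    next
      case b: False
      show ?thesis
      proof (cases i)
        case 0
        then obtain m' where "m = Suc m'" using i by (cases m) auto
        then show ?thesis using b 0 True \<alpha> un by (simp add: lift_letter_def sheet_def winv_wpow wpow_letter_Cons)
      next
        case (Suc i')
        then show ?thesis using b True \<alpha> c[of i']
          by (simp add: lift_letter_def sheet_def winv_wpow wpow_letter_Cons)
      qed
    qed
  qed
qed

text \<open>By \<open>unlift_letter\<close> each letter carries v^i in front and v^-j behind, where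
  \<open>j\<close> is the next sheet; the product telescopes.\<close>

lemma unlift_lft:
  "i < m \<Longrightarrow> raag_eq E (wsubst (unlift v m) (lft E v m i w)) (wpow [(v, True)] i @ w @ winv (wpow [(v, True)] (end_sheet v m i w)))"
proof (induction w arbitrary: i)
  case Nil
  then show ?case by (simp add: raag_eq_winv_right raag_eq_sym)
next
  case (Cons \<alpha> w)
  let ?v = "wpow [(v, True)]" and ?j = "sheet v m i \<alpha>"
  have "raag_eq E (wsubst (unlift v m) (lft E v m i (\<alpha> # w)))
      ((?v i @ [\<alpha>] @ winv (?v ?j)) @ (?v ?j @ w @ winv (?v (end_sheet v m ?j w))))"
    using raag_eq_append[OF unlift_letter[OF Cons.prems, of v \<alpha>] Cons.IH[OF sheet_less[OF Cons.prems], of v \<alpha>]] by simp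
  also have "raag_eq E \<dots> ((?v i @ [\<alpha>]) @ (w @ winv (?v (end_sheet v m ?j w))))"
    using raag_eq_cancel_left[of E "?v i @ [\<alpha>]" "?v ?j" "w @ winv (?v (end_sheet v m ?j w))"] by simp
  finally show ?case by simp
qed

lemma unlift_loop:
  assumes "i < m" "end_sheet v m i w = i"
  shows "raag_eq E (wsubst (unlift v m) (lft E v m i w)) (wconj (winv (wpow [(v, True)] i)) w)"
  using unlift_lft[OF assms(1), of v w] assms(2) by (simp add: wconj_def)

text \<open>With at least \<open>length w\<close> sheets on either side of \<open>i\<close> the
  counter never wraps, so every letter \<open>v\<close> is lost in the lift.\<close>

lemma lft_no_wrap:
  "length w \<le> i \<Longrightarrow> i + length w < m \<Longrightarrow> length (lft E v m i w) = length (filter (\<lambda>\<alpha>. fst \<alpha> \<noteq> v) w)"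
proof (induction w arbitrary: i)
  case (Cons \<alpha> w)
  have "length (lft E v m (sheet v m i \<alpha>) w) = length (filter (\<lambda>\<alpha>. fst \<alpha> \<noteq> v) w)"
    by (rule Cons.IH) (use Cons.prems in \<open>auto simp: sheet_def\<close>)
  then show ?case using Cons.prems by (auto simp: lift_letter_def)
qed simp

lemma lft_run: "i + k < m \<Longrightarrow> lft E v m i (wpow [(v, True)] k) = [] \<and> end_sheet v m i (wpow [(v, True)] k) = i + k"
  by (induction k arbitrary: i) (auto simp: lift_letter_def sheet_def)

lemma lft_full_turn:
  assumes "i < m"
  shows "lft E v m i (wpow [(v, True)] m) = [(node E v v 0, True)] \<and> end_sheet v m i (wpow [(v, True)] m) = i"
proof -
  let ?v = "wpow [(v, True)]"
  have "?v m = ?v (m - 1 - i) @ [(v, True)] @ ?v i"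
  proof -
    have "m = (m - 1 - i) + (1 + i)" using assms by simp
    then have "?v m = ?v (m - 1 - i) @ ?v (1 + i)" using wpow_add by metis
    then show ?thesis by simp
  qed
  moreover have "sheet v m (m - 1) (v, True) = 0" "lift_letter E v m (m - 1) (v, True) = [(node E v v 0, True)]"
    using assms by (auto simp: sheet_def lift_letter_def)
  ultimately show ?thesis
    using lft_run[of i "m - 1 - i" m v] lft_run[of 0 i m v] assms by (simp add: lft_append)
qed

end

section \<open>Powers of conjugates of generators\<close>

lemma wsubst_letters: "wsubst (\<lambda>j. [(j, True)]) w = w"
  by (induction w) (auto simp: prod_eq_iff)

context pc_graph
begin

text \<open>Roots are unique here: exponents identify the vertex, and then the quotient of the
  conjugators centralises a power of it, hence the vertex itself.\<close>

lemma vertex_conjugates_eq: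
  assumes e: "e > 0" "f > 0" and ef: "x = y \<Longrightarrow> e = f"
    and eq: "raag_eq E (wconj b (wpow [(x, True)] e)) (wconj c (wpow [(y, True)] f))"
  shows "raag_eq E (wconj b [(x, True)]) (wconj c [(y, True)])"
proof -
  have "x = y" using raag_eq_exponent[OF eq, of x] e by (auto split: if_splits)
  then have "e = f" by (rule ef)
  note eq = eq[folded \<open>x = y\<close> \<open>e = f\<close>]
  have "raag_eq E (wconj (winv c) (wconj b (wpow [(x, True)] e))) (wconj (winv c) (wconj c (wpow [(x, True)] e)))"
    using eq by (rule wconj_cong[OF raag_eq_refl])
  also have "raag_eq E (wconj (winv c) (wconj c (wpow [(x, True)] e))) (wpow [(x, True)] e)"
    by (rule wconj_winv_cancel)
  finally have "wcomm E (b @ winv c) (wpow [(x, True)] e)"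
    by (simp only: wcomm_iff_wconj wconj_simps(3))
  then have "wcomm E (b @ winv c) [(x, True)]" using wcomm_wpow_cancel e(1) by blast
  then have "raag_eq E (wconj (winv c) (wconj b [(x, True)])) [(x, True)]"
    by (simp only: wcomm_iff_wconj wconj_simps(3))
  then have "raag_eq E (wconj b [(x, True)]) (wconj (winv (winv c)) [(x, True)])"
    using raag_eq_wconj_move by blast
  then show ?thesis using \<open>x = y\<close> by simp
qed

lemma wcomm_wpow_iff: "e > 0 \<Longrightarrow> f > 0 \<Longrightarrow> wcomm E (wpow u e) (wpow w f) \<longleftrightarrow> wcomm E u w"
  using wcomm_wpow_cancel[of "wpow u e" w f] wcomm_wpow_cancel[of w u e] wcomm_wpow2[of E u w e f]
    wcomm_sym[of E w "wpow u e"] wcomm_sym[of E w u] by blast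

end

text \<open>Passing to the cyclic cover at a vertex \<open>v\<close> removes all letters \<open>v\<close> from the conjugating
  words, so that after finitely many steps all conjugators are trivial.\<close>

theorem powers_of_vertex_conjugates:
  fixes E :: "(('v \<times> nat) \<times> ('v \<times> nat)) set" and J :: "'j set"
  assumes "pc_graph E" and J: "finite J"
    and "\<And>j k. j \<in> J \<Longrightarrow> k \<in> J \<Longrightarrow> j \<noteq> k \<Longrightarrow>
      \<not> raag_eq E (wconj (b j) [(x j, True)]) (wconj (b k) [(x k, True)])"
  shows "\<exists>e. (\<forall>j. e j > 0) \<and> (\<forall>w. verts w \<subseteq> J \<longrightarrow>
      raag_eq E (wsubst (\<lambda>j. wpow (wconj (b j) [(x j, True)]) (e j)) w) [] \<longrightarrow>
      raag_eq {(j, k). j \<in> J \<and> k \<in> J \<and> j \<noteq> k \<and>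
        wcomm E (wconj (b j) [(x j, True)]) (wconj (b k) [(x k, True)])} w [])"
  using assms(1,3)
proof (induction "\<Sum>j\<in>J. length (b j)" arbitrary: E b x rule: less_induct)
  case less
  interpret pc_graph E by (rule less.prems)
  define c where "c j = wconj (b j) [(x j, True)]" for j
  define R where "R = {(j, k). j \<in> J \<and> k \<in> J \<and> j \<noteq> k \<and> wcomm E (c j) (c k)}"
  have goal: ?case if "\<exists>e. (\<forall>j. e j > 0) \<and> (\<forall>w. verts w \<subseteq> J \<longrightarrow>
      raag_eq E (wsubst (\<lambda>j. wpow (c j) (e j)) w) [] \<longrightarrow> raag_eq R w [])"
    using that unfolding R_def c_def .
  show ?case
  proof (cases "\<forall>j\<in>J. b j = []")
    case True
    then have cj: "c j = [(x j, True)]" if "j \<in> J" for j using that by (simp add: c_def wconj_simps)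
    have inj: "inj_on x J"
    proof (rule inj_onI)
      fix j k assume jk: "j \<in> J" "k \<in> J" "x j = x k"
      show "j = k"
      proof (rule ccontr)
        assume "j \<noteq> k"
        then show False using less.prems(2)[OF jk(1,2)] cj[OF jk(1)] cj[OF jk(2)] jk(3) by (simp add: c_def)
      qed
    qed
    \<comment> \<open>With trivial conjugators the elements are distinct vertices. Killing all other
      vertices and renaming inverts the substitution, so all exponents can be 1.\<close>
    define \<tau> where "\<tau> q = (if q \<in> x ` J then [(the_inv_into J x q, True)] else [])" for q
    have \<tau>: "\<tau> (x j) = [(j, True)]" if "j \<in> J" for j
      using that inj by (simp add: \<tau>_def the_inv_into_f_f)
    have hom: "wcomm R (\<tau> q) (\<tau> r)" if e: "(q, r) \<in> E" for q r
    proof (cases "q \<in> x ` J \<and> r \<in> x ` J")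
      case True
      then obtain j k where jk: "j \<in> J" "k \<in> J" "q = x j" "r = x k" by blast
      have "j \<noteq> k" using e irrefl_E jk by metis
      then have "(j, k) \<in> R" using jk cj wcomm_edge[OF e] by (simp add: R_def)
      then show ?thesis using jk \<tau> by (simp add: wcomm_edge)
    qed (auto simp: \<tau>_def)
    show ?thesis
    proof (rule goal, intro exI[of _ "\<lambda>_. 1"] conjI allI impI)
      fix w assume w: "verts w \<subseteq> J" and eq: "raag_eq E (wsubst (\<lambda>j. wpow (c j) 1) w) []"
      have "wsubst \<tau> (wsubst (\<lambda>j. wpow (c j) 1) w) = wsubst (\<lambda>j. [(j, True)]) w"
        unfolding wsubst_wsubst by (rule wsubst_cong) (use w cj \<tau> in \<open>auto simp: subset_iff\<close>)
      then show "raag_eq R w []"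
        using raag_eq_wsubst[of E R \<tau>, OF hom eq] by (simp add: wsubst_letters)
    qed simp
  next
    case False
    then obtain j0 where j0: "j0 \<in> J" "b j0 \<noteq> []" by blast
    \<comment> \<open>A letter that occurs in some conjugator, so that the cover at \<open>v\<close>
      strictly shortens the total length.\<close>
    define v where "v = fst (hd (b j0))"
    define M where "M = (\<Sum>j\<in>J. length (b j))"
    \<comment> \<open>From the middle sheet \<open>M\<close> of \<open>2 * M + 1\<close> no
      conjugator can reach the place where the counter wraps.\<close>
    define m where "m = 2 * M + 1"
    let ?E = "cover_E E v" and ?L = "lft E v m M"
    have M: "M < m" by (simp add: m_def)
    have bM: "length (b j) \<le> M" if "j \<in> J" for j
      unfolding M_def by (rule member_le_sum[OF that]) (use J in auto)
    \<comment> \<open>The sheet reached from \<open>M\<close> by the inverse conjugator. There the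
      power of the vertex runs in a loop and \<open>b j\<close> leads back to \<open>M\<close>, so
      the whole conjugate lifts to a loop at \<open>M\<close>.\<close>
    define i where "i j = end_sheet v m M (winv (b j))" for j
    define b' where "b' j = winv (?L (winv (b j)))" for j
    \<comment> \<open>A conjugate of \<open>v\<close> closes up only after its \<open>m\<close>-th
      power, which is a generator of the cover. The exponent depends on the vertex alone, as
      \<open>vertex_conjugates_eq\<close> requires.\<close>
    define e1 where "e1 j = (if x j = v then m else 1)" for j
    define x' where "x' j = node E v (x j) (i j)" for j
    define C where "C j = wconj (b j) (wpow [(x j, True)] (e1 j))" for j
    define c' where "c' j = wconj (b' j) [(x' j, True)]" for j
    have e1: "e1 j > 0" for j by (simp add: e1_def m_def)
    have Cc: "raag_eq E (C j) (wpow (c j) (e1 j))" for j unfolding C_def c_def by (rule wconj_wpow)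
    have im: "i j < m" for j unfolding i_def by (rule end_sheet_less[OF M])
    have lb: "lft E v m (i j) (b j) = b' j" "end_sheet v m (i j) (b j) = M" for j
      using lft_winv[OF M, of E v "winv (b j)"] by (auto simp: i_def b'_def)
    have lx: "lft E v m (i j) (wpow [(x j, True)] (e1 j)) = [(x' j, True)]"
      "end_sheet v m (i j) (wpow [(x j, True)] (e1 j)) = i j" for j
    proof -
      have "node E v v (i j) = node E v v 0" by (simp add: node_def)
      then have "lft E v m (i j) (wpow [(x j, True)] (e1 j)) = [(x' j, True)] \<and>
          end_sheet v m (i j) (wpow [(x j, True)] (e1 j)) = i j"
        using lft_full_turn[OF pc_graph_axioms im, of v j]
        by (auto simp: e1_def x'_def lift_letter_def sheet_def)
      then show "lft E v m (i j) (wpow [(x j, True)] (e1 j)) = [(x' j, True)]"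
        "end_sheet v m (i j) (wpow [(x j, True)] (e1 j)) = i j" by auto
    qed
    have LC: "?L (C j) = c' j" "end_sheet v m M (C j) = M" for j
      using lb[of j] lx[of j] by (simp_all add: C_def c'_def wconj_def lft_append b'_def flip: i_def)
    have unL: "raag_eq E (wsubst (unlift v m) (c' j)) (wconj (winv (wpow [(v, True)] M)) (C j))" for j
      using unlift_loop[OF pc_graph_axioms M LC(2)[of j]] LC(1)[of j] by simp
    \<comment> \<open>Commutation goes up by lifting and comes down by \<open>unlift\<close>, so the
      cover shows the same commutation graph.\<close>
    have comm: "wcomm ?E (c' j) (c' k) \<longleftrightarrow> wcomm E (c j) (c k)" for j k
    proof -
      have CC: "wcomm E (C j) (C k) \<longleftrightarrow> wcomm E (c j) (c k)"
        using wcomm_cong[OF Cc[of j] Cc[of k]] wcomm_wpow_iff[OF e1[of j] e1[of k]] by simp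
      have "wcomm ?E (c' j) (c' k)" if "wcomm E (C j) (C k)"
        using lft_raag_eq(1)[OF pc_graph_axioms that[unfolded wcomm_def] M, of v] LC[of j] LC[of k]
        by (simp add: lft_append wcomm_def)
      moreover have "wcomm E (C j) (C k)" if "wcomm ?E (c' j) (c' k)"
      proof -
        have "wcomm E (wsubst (unlift v m) (c' j)) (wsubst (unlift v m) (c' k))"
          by (rule wcomm_wsubst[OF _ that]) (rule unlift_hom[OF pc_graph_axioms])
        then show ?thesis using wcomm_cong[OF unL[of j] unL[of k]] by (simp add: wcomm_wconj_iff)
      qed
      ultimately show ?thesis using CC by blast
    qed
    have distinct: "\<not> raag_eq ?E (c' j) (c' k)" if jk: "j \<in> J" "k \<in> J" "j \<noteq> k" for j k
    proof
      assume "raag_eq ?E (c' j) (c' k)"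
      then have "raag_eq E (wsubst (unlift v m) (c' j)) (wsubst (unlift v m) (c' k))"
        by (rule raag_eq_wsubst[rotated]) (rule unlift_hom[OF pc_graph_axioms])
      then have "raag_eq E (wconj (winv (wpow [(v, True)] M)) (C j)) (wconj (winv (wpow [(v, True)] M)) (C k))"
        using unL[of j] unL[of k] by (meson raag_eq_sym raag_eq_trans)
      then have "raag_eq E (C j) (C k)" by (simp only: raag_eq_wconj_iff)
      then have "raag_eq E (c j) (c k)"
        unfolding C_def c_def by (rule vertex_conjugates_eq[OF e1 e1, rotated]) (simp add: e1_def)
      then show False using less.prems(2)[OF jk] by (simp add: c_def)
    qed
    have len: "length (b' j) = length (filter (\<lambda>\<alpha>. fst \<alpha> \<noteq> v) (b j))" if "j \<in> J" for j
    proof -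
      have "length (?L (winv (b j))) = length (filter (\<lambda>\<alpha>. fst \<alpha> \<noteq> v) (winv (b j)))"
        by (rule lft_no_wrap[OF pc_graph_axioms]) (use bM[OF that] in \<open>auto simp: m_def\<close>)
      also have "\<dots> = length (filter (\<lambda>\<alpha>. fst \<alpha> \<noteq> v) (b j))"
        by (simp add: winv_def filter_map o_def flip: rev_filter)
      finally show ?thesis by (simp add: b'_def)
    qed
    have "(\<Sum>j\<in>J. length (b' j)) < (\<Sum>j\<in>J. length (b j))"
    proof (rule sum_strict_mono_ex1[OF J])
      show "\<forall>j\<in>J. length (b' j) \<le> length (b j)" using len by simp
      have "hd (b j0) \<in> set (b j0)" using j0(2) by simp
      then have "length (filter (\<lambda>\<alpha>. fst \<alpha> \<noteq> v) (b j0)) < length (b j0)"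
        by (intro length_filter_less[of "hd (b j0)"]) (auto simp: v_def)
      then show "\<exists>j\<in>J. length (b' j) < length (b j)" using j0(1) len by auto
    qed
    from less.hyps[OF this pc_graph_cover[OF pc_graph_axioms, of v], of x'] distinct
    obtain e' where e': "\<And>j. e' j > 0" and inj: "\<And>w. verts w \<subseteq> J \<Longrightarrow>
        raag_eq ?E (wsubst (\<lambda>j. wpow (c' j) (e' j)) w) [] \<Longrightarrow>
        raag_eq {(j, k). j \<in> J \<and> k \<in> J \<and> j \<noteq> k \<and> wcomm ?E (c' j) (c' k)} w []"
      unfolding c'_def by blast
    have R': "{(j, k). j \<in> J \<and> k \<in> J \<and> j \<noteq> k \<and> wcomm ?E (c' j) (c' k)} = R"
      unfolding R_def comm ..
    have Lpow: "?L (wpow (C j) n) = wpow (c' j) n \<and> end_sheet v m M (wpow (C j) n) = M" for j n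
      by (induction n) (auto simp: lft_append LC)
    have Lsubst: "?L (wsubst (\<lambda>j. wpow (C j) (e' j)) w) = wsubst (\<lambda>j. wpow (c' j) (e' j)) w \<and>
        end_sheet v m M (wsubst (\<lambda>j. wpow (C j) (e' j)) w) = M" for w
    proof (induction w)
      case (Cons \<alpha> w)
      let ?p = "wpow (C (fst \<alpha>)) (e' (fst \<alpha>))"
      have "?L (winv ?p) = winv (wpow (c' (fst \<alpha>)) (e' (fst \<alpha>))) \<and> end_sheet v m M (winv ?p) = M"
        using lft_winv[OF M, of E v ?p] Lpow[of "fst \<alpha>" "e' (fst \<alpha>)"] by simp
      then show ?case using Cons Lpow[of "fst \<alpha>" "e' (fst \<alpha>)"] by (simp add: lft_append)
    qed simp
    show ?thesis
    proof (rule goal, intro exI[of _ "\<lambda>j. e1 j * e' j"] conjI allI impI)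
      fix j show "0 < e1 j * e' j" using e1 e' by simp
    next
      fix w assume w: "verts w \<subseteq> J" and eq: "raag_eq E (wsubst (\<lambda>j. wpow (c j) (e1 j * e' j)) w) []"
      have "raag_eq E (wsubst (\<lambda>j. wpow (C j) (e' j)) w) (wsubst (\<lambda>j. wpow (c j) (e1 j * e' j)) w)"
        by (rule wsubst_raag_eq_cong) (simp add: wpow_mult raag_eq_wpow[OF Cc])
      from raag_eq_trans[OF this eq]
      have "raag_eq ?E (?L (wsubst (\<lambda>j. wpow (C j) (e' j)) w)) (?L [])"
        by (rule lft_raag_eq(1)[OF pc_graph_axioms _ M])
      then have "raag_eq ?E (wsubst (\<lambda>j. wpow (c' j) (e' j)) w) []" using Lsubst by simp
      then show "raag_eq R w []" using inj[OF w] R' by simp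
    qed
  qed
qed

section \<open>Inflations\<close>

lemma simple_graph_pc_graph: "simple_graph V E \<Longrightarrow> pc_graph E"
  by (simp add: simple_graph_def pc_graph_def)

lemma pc_graph_inflation: "simple_graph V E \<Longrightarrow> pc_graph (inflation_E V E n)"
  by (auto simp: simple_graph_def pc_graph_def inflation_E_def sym_def)

lemma in_inflation_E:
  "((v, i), (w, j)) \<in> inflation_E V E n \<longleftrightarrow>
     v \<in> V \<and> w \<in> V \<and> i \<in> {1..n} \<and> j \<in> {1..n} \<and> (v = w \<and> i \<noteq> j \<or> v \<noteq> w \<and> (v, w) \<in> E)"
  by (auto simp: inflation_E_def inflation_V_def)

lemma wcomm_single_vertex:
  assumes "verts u \<subseteq> {x}" "verts w \<subseteq> {x}"
  shows "wcomm E u w"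
proof -
  have "wcomm E [(x, True)] u"
    by (rule wcomm_letters) (use assms(1) in \<open>auto simp: verts_def\<close>)
  then have *: "wcomm E u [(x, True)]" using wcomm_sym by blast
  show ?thesis by (rule wcomm_letters) (use assms(2) * in \<open>auto simp: verts_def\<close>)
qed

lemma raag_eq_single_vertex_exponent_one:
  assumes "verts u \<subseteq> {x}" and "exponent x u = 1"
  shows "raag_eq E u [(x, True)]"
proof -
  let ?x = "[(x, True)]"
  have "\<exists>i j. raag_eq E u (wpow ?x i @ wpow (winv ?x) j)"
    using assms(1)
  proof (induction u)
    case Nil
    show ?case by (intro exI[of _ 0]) simp
  next
    case (Cons \<alpha> u)
    then obtain i j where ij: "raag_eq E u (wpow ?x i @ wpow (winv ?x) j)" by auto
    have x: "fst \<alpha> = x" using Cons.prems by simp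
    show ?case
    proof (cases "snd \<alpha>")
      case True
      then have "\<alpha> = (x, True)" using x by (simp add: prod_eq_iff)
      then show ?thesis using raag_eq_Cons[OF ij, of \<alpha>] by (intro exI[of _ "Suc i"] exI[of _ j]) simp
    next
      case False
      then have \<alpha>: "\<alpha> = (x, False)" using x by (simp add: prod_eq_iff)
      have "raag_eq E ([\<alpha>] @ wpow ?x i @ wpow (winv ?x) j) (wpow ?x i @ [\<alpha>] @ wpow (winv ?x) j)"
        using raag_eq_append[OF wcomm_single_vertex[unfolded wcomm_def, of "[\<alpha>]" x "wpow ?x i"] raag_eq_refl]
          verts_wpow[of ?x i] \<alpha> by simp
      then show ?thesis
        using raag_eq_trans[OF raag_eq_Cons[OF ij, of \<alpha>]] \<alpha> by (intro exI[of _ i] exI[of _ "Suc j"]) simp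
    qed
  qed
  then obtain i j where ij: "raag_eq E u (wpow ?x i @ wpow (winv ?x) j)" by blast
  then have "i = Suc j" using raag_eq_exponent[OF ij, of x] assms(2) by simp
  then show ?thesis using raag_eq_trans[OF ij wpow_cancel] by simp
qed

text \<open>The image of \<open>v\<close> under the diagonal homomorphism into the inflation, the
  product of all its copies.\<close>

definition diag :: "nat \<Rightarrow> 'v \<Rightarrow> (('v \<times> nat) \<times> bool) list" where
  "diag n v = map (\<lambda>i. ((v, i), True)) [1..<Suc n]"

definition copy_conj :: "nat \<Rightarrow> ('v \<times> bool) list \<Rightarrow> 'v \<Rightarrow> nat \<Rightarrow> (('v \<times> nat) \<times> bool) list" where
  "copy_conj n b x i = wconj (wsubst (diag n) b) [((x, i), True)]"

lemma verts_diag: "verts (diag n v) = {v} \<times> {1..n}"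
  by (auto simp: diag_def verts_def image_iff)

lemma diag_hom:
  assumes "simple_graph V E" "(v, w) \<in> E"
  shows "wcomm (inflation_E V E n) (diag n v) (diag n w)"
proof (rule wcomm_verts)
  fix p q assume "p \<in> verts (diag n v)" "q \<in> verts (diag n w)"
  then obtain i j where "p = (v, i)" "q = (w, j)" "i \<in> {1..n}" "j \<in> {1..n}" by (auto simp: verts_diag)
  moreover have "v \<noteq> w" "v \<in> V" "w \<in> V" using assms by (auto simp: simple_graph_def)
  ultimately show "(p, q) \<in> inflation_E V E n" using assms(2) by (simp add: in_inflation_E)
qed

lemma restrict_diag: "i \<in> {1..n} \<Longrightarrow> restrict_word {(x, i)} (diag n x) = [((x, i), True)]"
proof -
  assume i: "i \<in> {1..n}"
  have "restrict_word {(x, i)} (map (\<lambda>i. ((x, i), True)) xs) = (if i \<in> set xs then [((x, i), True)] else [])"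
    if "distinct xs" for xs
    using that by (induction xs) auto
  from this[of "[1..<Suc n]"] show ?thesis using i by (auto simp: diag_def)
qed

text \<open>The diagonal image of a conjugate of \<open>x\<close> has the conjugates of the copies of \<open>x\<close> as blocks.\<close>

lemma wcomm_copy_conj:
  assumes G: "simple_graph V E" and x: "x \<in> V" "i \<in> {1..n}" and y: "y \<in> V" "j \<in> {1..n}"
    and comm: "wcomm E (wconj b [(x, True)]) (wconj c [(y, True)])"
  shows "wcomm (inflation_E V E n) (copy_conj n b x i) (copy_conj n c y j)"
proof -
  let ?F = "inflation_E V E n"
  interpret pc_graph ?F by (rule pc_graph_inflation[OF G])
  \<comment> \<open>The copy \<open>(x, i)\<close> is a block of \<open>diag n x\<close>, so
    \<open>wcomm_restrict_word\<close> extracts it; this is applied to each side in turn.\<close>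
  have half: "wcomm ?F z (copy_conj n b x i)"
    if xi: "x \<in> V" "i \<in> {1..n}" and z: "wcomm ?F z (wsubst (diag n) (wconj b [(x, True)]))" for z b x i
  proof -
    have "wcomm ?F z (wconj (wsubst (diag n) b) (diag n x))" using z by (simp add: wsubst_wconj)
    then have "wcomm ?F (wconj (winv (wsubst (diag n) b)) z) (diag n x)"
      using wcomm_sym wcomm_wconj_move by blast
    then have "wcomm ?F (wconj (winv (wsubst (diag n) b)) z) (restrict_word {(x, i)} (diag n x))"
    proof (rule wcomm_restrict_word[rotated])
      show "cyc_red ?F (diag n x)" by (rule cyc_red_positive) (auto simp: diag_def)
      fix p q assume "p \<in> verts (diag n x)" "p \<in> {(x, i)}" "q \<in> verts (diag n x)" "q \<notin> {(x, i)}"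
      then show "(p, q) \<in> ?F" using xi by (auto simp: verts_diag in_inflation_E)
    qed
    then have "wcomm ?F (wconj (winv (wsubst (diag n) b)) z) [((x, i), True)]"
      using xi(2) by (simp add: restrict_diag)
    then show ?thesis unfolding copy_conj_def using wcomm_sym wcomm_wconj_move by blast
  qed
  have "wcomm ?F (wsubst (diag n) (wconj c [(y, True)])) (wsubst (diag n) (wconj b [(x, True)]))"
    by (rule wcomm_wsubst[OF diag_hom[OF G] wcomm_sym[THEN iffD1, OF comm]])
  then have "wcomm ?F (copy_conj n b x i) (wsubst (diag n) (wconj c [(y, True)]))"
    using half[OF x] wcomm_sym by blast
  then show ?thesis using half[OF y] by blast
qed

text \<open>Any weights on the copies of each vertex that sum to 1 define a retraction of the diagonal;
  the weights are chosen nonzero on \<open>(x, i)\<close> and \<open>(y, j)\<close>.\<close>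

lemma wcomm_copy_conjD:
  assumes G: "simple_graph V E" and x: "x \<in> V" "i \<in> {1..n}" and y: "y \<in> V" "j \<in> {1..n}"
    and comm: "wcomm (inflation_E V E n) (copy_conj n b x i) (copy_conj n c y j)"
  shows "wcomm E (wconj b [(x, True)]) (wconj c [(y, True)])"
proof -
  let ?F = "inflation_E V E n"
  interpret pc_graph E by (rule simple_graph_pc_graph[OF G])
  \<comment> \<open>Two copies of one vertex must both get nonzero weight, which 2 and -1 with sum 1
    achieve; a vertex other than \<open>x\<close> and \<open>y\<close> puts its weight 1 on copy
    \<open>i\<close> merely because that index is in range.\<close>
  define wt :: "'a \<Rightarrow> nat \<Rightarrow> int" where "wt = (\<lambda>v k. if v = x \<and> x = y \<and> i \<noteq> j then (if k = i then 2 else if k = j then -1 else 0)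
      else if v = x then (if k = i then 1 else 0) else if v = y then (if k = j then 1 else 0)
      else if k = i then 1 else 0)"
  define \<pi> where "\<pi> = (\<lambda>(v, k). if wt v k = 2 then [(v, True), (v, True)] else if wt v k = 1 then [(v, True)]
      else if wt v k = -1 then [(v, False)] else [])"
  have v\<pi>: "verts (\<pi> (v, k)) \<subseteq> {v}" for v k by (auto simp: \<pi>_def)
  have e\<pi>: "exponent v (\<pi> (v, k)) = wt v k" for v k by (auto simp: \<pi>_def wt_def)
  have sum1: "(\<Sum>k\<leftarrow>[1..<Suc n]. wt v k) = 1" for v
  proof -
    have single: "(\<Sum>k\<leftarrow>[1..<Suc n]. if k = a then z else (0::int)) = z" if "a \<in> {1..n}" for a z
    proof -
      have "(\<Sum>k\<leftarrow>[1..<Suc n]. if k = a then z else (0::int)) = (\<Sum>k\<in>{1..<Suc n}. if k = a then z else 0)"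
        by (subst sum_list_distinct_conv_sum_set) auto
      then show ?thesis using that by auto
    qed
    show ?thesis
    proof (cases "v = x \<and> x = y \<and> i \<noteq> j")
      case True
      then have "wt v k = (if k = i then 2 else 0) + (if k = j then -1 else 0)" for k by (auto simp: wt_def)
      then have "(\<Sum>k\<leftarrow>[1..<Suc n]. wt v k) =
          (\<Sum>k\<leftarrow>[1..<Suc n]. if k = i then 2 else 0) + (\<Sum>k\<leftarrow>[1..<Suc n]. if k = j then -1 else 0)"
        by (simp only: sum_list_addf)
      then show ?thesis using single[OF x(2), of 2] single[OF y(2), of "-1"] by simp
    next
      case False
      define a where "a = (if v = y \<and> v \<noteq> x then j else i)"
      have "a \<in> {1..n}" using x(2) y(2) by (simp add: a_def)
      moreover have "wt v = (\<lambda>k. if k = a then 1 else 0)" using False by (auto simp: wt_def a_def)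
      ultimately show ?thesis using single[of a 1] by simp
    qed
  qed
  have hom: "wcomm E (\<pi> p) (\<pi> q)" if e: "(p, q) \<in> ?F" for p q
  proof -
    obtain v k w l where pq: "p = (v, k)" "q = (w, l)" by fastforce
    show ?thesis
    proof (cases "v = w")
      case True
      then show ?thesis using v\<pi> pq wcomm_single_vertex by metis
    next
      case False
      then have "(v, w) \<in> E" using e pq by (simp add: in_inflation_E)
      then show ?thesis using v\<pi>[of v k] v\<pi>[of w l] pq by (intro wcomm_verts) blast
    qed
  qed
  have retract: "raag_eq E (wsubst \<pi> (diag n v)) [(v, True)]" for v
  proof (rule raag_eq_single_vertex_exponent_one)
    have *: "verts (wsubst \<pi> (map (\<lambda>i. ((v, i), True)) ks)) \<subseteq> {v} \<and>
       exponent v (wsubst \<pi> (map (\<lambda>i. ((v, i), True)) ks)) = (\<Sum>k\<leftarrow>ks. wt v k)" for ks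
      by (induction ks) (use v\<pi> e\<pi> in auto)
    show "verts (wsubst \<pi> (diag n v)) \<subseteq> {v}" "exponent v (wsubst \<pi> (diag n v)) = 1"
      using *[of "[1..<Suc n]"] sum1[of v] by (auto simp: diag_def)
  qed
  have "raag_eq E (wsubst \<pi> (wsubst (diag n) d)) d" for d
    using wsubst_raag_eq_cong[of d E "\<lambda>v. wsubst \<pi> (diag n v)" "\<lambda>v. [(v, True)]"] retract
    by (simp add: wsubst_wsubst wsubst_letters)
  then have image: "raag_eq E (wsubst \<pi> (copy_conj n d z k)) (wconj d (\<pi> (z, k)))" for d z k
    by (simp add: copy_conj_def wsubst_wconj wconj_cong)
  have "wcomm E (wsubst \<pi> (copy_conj n b x i)) (wsubst \<pi> (copy_conj n c y j))"
    by (rule wcomm_wsubst[OF hom comm])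
  then have w: "wcomm E (wconj b (\<pi> (x, i))) (wconj c (\<pi> (y, j)))"
    using wcomm_cong[OF image image] by blast
  have nz: "wt x i \<in> {1, 2}" "wt y j \<in> {1, -1}" by (auto simp: wt_def)
  \<comment> \<open>The two copies map to nonzero powers of the vertices, and a nonzero power has
    the centraliser of its base.\<close>
  have powers: "wcomm E (wconj d (\<pi> (z, k))) g \<Longrightarrow> wcomm E (wconj d [(z, True)]) g" if wz: "wt z k \<in> {1, 2, -1}" for d z k g
  proof -
    assume a: "wcomm E (wconj d (\<pi> (z, k))) g"
    consider "\<pi> (z, k) = wpow [(z, True)] 2" | "\<pi> (z, k) = wpow [(z, True)] 1" | "\<pi> (z, k) = winv [(z, True)]"
      using wz by (auto simp: \<pi>_def numeral_2_eq_2)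
    then show ?thesis
    proof cases
      case 3
      then have "wcomm E (winv (wconj d [(z, True)])) g" using a by (simp add: wconj_simps)
      then show ?thesis by (simp only: wcomm_winv_iff)
    next
      case 2
      then show ?thesis using a by simp
    next
      case 1
      then have "wcomm E (wconj (winv d) g) (wpow [(z, True)] 2)" using a wcomm_sym wcomm_wconj_move by metis
      then have "wcomm E (wconj (winv d) g) [(z, True)]" by (rule wcomm_wpow_cancel) simp
      then show ?thesis using wcomm_sym wcomm_wconj_move by metis
    qed
  qed
  have "wcomm E (wconj b [(x, True)]) (wconj c (\<pi> (y, j)))" using powers[OF _ w] nz(1) by blast
  then have "wcomm E (wconj c (\<pi> (y, j))) (wconj b [(x, True)])" using wcomm_sym by blast
  then have "wcomm E (wconj c [(y, True)]) (wconj b [(x, True)])" using powers[of y j c] nz(2) by blast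
  then show ?thesis using wcomm_sym by blast
qed

lemma verts_copy_conj:
  assumes "verts b \<subseteq> V" "x \<in> V" "i \<in> {1..n}"
  shows "verts (copy_conj n b x i) \<subseteq> inflation_V V n" "verts (wsubst (diag n) b) \<subseteq> inflation_V V n"
proof -
  show *: "verts (wsubst (diag n) b) \<subseteq> inflation_V V n"
    using verts_wsubst[of "diag n" b] assms(1) by (auto simp: verts_diag inflation_V_def)
  show "verts (copy_conj n b x i) \<subseteq> inflation_V V n"
    using * assms by (auto simp: copy_conj_def verts_wconj inflation_V_def)
qed

text \<open>The vertex \<open>(x, i)\<close> has exponent 1 in the left word, and in the right one a
  nonzero exponent only if it is \<open>(y, j)\<close>.\<close>

lemma copy_conj_distinct:
  assumes "raag_eq E (copy_conj n b x i) (copy_conj n c y j)"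
  shows "x = y \<and> i = j"
  using raag_eq_exponent[OF assms, of "(x, i)"] by (auto simp: copy_conj_def split: if_splits)

section \<open>Words and elements of the group\<close>

definition wclass :: "'v set \<Rightarrow> ('v \<times> 'v) set \<Rightarrow> ('v \<times> bool) list \<Rightarrow> ('v \<times> bool) list set" where
  "wclass V E w = raag_rel V E `` {w}"

lemma raag_rel_iff: "(u, w) \<in> raag_rel V E \<longleftrightarrow> verts u \<subseteq> V \<and> verts w \<subseteq> V \<and> raag_eq E u w"
  by (simp add: raag_rel_def raag_eq_def verts_subset_lists)

lemma in_wclass: "u \<in> wclass V E w \<longleftrightarrow> verts w \<subseteq> V \<and> verts u \<subseteq> V \<and> raag_eq E w u"
  by (simp add: wclass_def raag_rel_iff)

lemma wclass_eq_iff: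
  assumes "verts u \<subseteq> V" "verts w \<subseteq> V"
  shows "wclass V E u = wclass V E w \<longleftrightarrow> raag_eq E u w"
proof
  assume "wclass V E u = wclass V E w"
  moreover have "w \<in> wclass V E w" using assms by (simp add: in_wclass)
  ultimately show "raag_eq E u w" using in_wclass by metis
next
  assume eq: "raag_eq E u w"
  show "wclass V E u = wclass V E w"
    by (rule Set.set_eqI) (use assms raag_eq_trans[OF eq] raag_eq_trans[OF raag_eq_sym[OF eq]] in \<open>auto simp: in_wclass\<close>)
qed

lemma raag_carrier: "carrier (RAAG V E) = wclass V E ` {w. verts w \<subseteq> V}"
proof -
  have "lists (V \<times> UNIV) = {w :: ('a \<times> bool) list. verts w \<subseteq> V}" using verts_subset_lists by blast
  then show ?thesis by (auto simp: RAAG_def quotient_def wclass_def)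
qed

lemma wclass_in_carrier [simp]: "verts w \<subseteq> V \<Longrightarrow> wclass V E w \<in> carrier (RAAG V E)"
  by (auto simp: raag_carrier)

lemma raag_one: "\<one>\<^bsub>RAAG V E\<^esub> = wclass V E []"
  by (simp add: RAAG_def wclass_def)

lemma raag_gen_wclass: "raag_gen V E v = wclass V E [(v, True)]"
  by (simp add: raag_gen_def wclass_def)

lemma raag_mult:
  assumes "verts u \<subseteq> V" "verts w \<subseteq> V"
  shows "wclass V E u \<otimes>\<^bsub>RAAG V E\<^esub> wclass V E w = wclass V E (u @ w)"
proof -
  have "wclass V E u \<otimes>\<^bsub>RAAG V E\<^esub> wclass V E w = raag_rel V E `` {a @ b | a b. a \<in> wclass V E u \<and> b \<in> wclass V E w}"
    by (simp add: RAAG_def)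
  also have "\<dots> = wclass V E (u @ w)"
  proof (intro Set.set_eqI iffI)
    fix c assume "c \<in> raag_rel V E `` {a @ b | a b. a \<in> wclass V E u \<and> b \<in> wclass V E w}"
    then obtain a b where ab: "a \<in> wclass V E u" "b \<in> wclass V E w" "(a @ b, c) \<in> raag_rel V E" by blast
    then have "raag_eq E (u @ w) (a @ b)" "raag_eq E (a @ b) c" "verts c \<subseteq> V"
      by (auto simp: in_wclass raag_rel_iff intro: raag_eq_append)
    then show "c \<in> wclass V E (u @ w)" using assms raag_eq_trans[of E "u @ w" "a @ b" c] by (simp add: in_wclass)
  next
    fix c assume "c \<in> wclass V E (u @ w)"
    moreover have "u \<in> wclass V E u" "w \<in> wclass V E w" using assms by (auto simp: in_wclass)
    ultimately show "c \<in> raag_rel V E `` {a @ b | a b. a \<in> wclass V E u \<and> b \<in> wclass V E w}"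
      unfolding wclass_def[of V E "u @ w"] by blast
  qed
  finally show ?thesis .
qed

lemma group_raag: "group (RAAG V E)"
proof (rule groupI)
  fix x y z assume "x \<in> carrier (RAAG V E)" "y \<in> carrier (RAAG V E)" "z \<in> carrier (RAAG V E)"
  then obtain u v w where *: "x = wclass V E u" "y = wclass V E v" "z = wclass V E w"
    and V: "verts u \<subseteq> V" "verts v \<subseteq> V" "verts w \<subseteq> V" by (auto simp: raag_carrier)
  show "x \<otimes>\<^bsub>RAAG V E\<^esub> y \<in> carrier (RAAG V E)" using * V by (simp add: raag_mult)
  show "x \<otimes>\<^bsub>RAAG V E\<^esub> y \<otimes>\<^bsub>RAAG V E\<^esub> z = x \<otimes>\<^bsub>RAAG V E\<^esub> (y \<otimes>\<^bsub>RAAG V E\<^esub> z)"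
    using * V by (simp add: raag_mult)
next
  show "\<one>\<^bsub>RAAG V E\<^esub> \<in> carrier (RAAG V E)" by (simp add: raag_one)
next
  fix x assume "x \<in> carrier (RAAG V E)"
  then obtain u where x: "x = wclass V E u" and V: "verts u \<subseteq> V" by (auto simp: raag_carrier)
  show "\<one>\<^bsub>RAAG V E\<^esub> \<otimes>\<^bsub>RAAG V E\<^esub> x = x" using V by (simp add: raag_one x raag_mult)
  have "wclass V E (winv u) \<otimes>\<^bsub>RAAG V E\<^esub> x = \<one>\<^bsub>RAAG V E\<^esub>"
    using V by (simp add: x raag_mult raag_one wclass_eq_iff raag_eq_winv_left)
  then show "\<exists>y\<in>carrier (RAAG V E). y \<otimes>\<^bsub>RAAG V E\<^esub> x = \<one>\<^bsub>RAAG V E\<^esub>"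
    using V by (intro bexI[of _ "wclass V E (winv u)"]) auto
qed

lemma raag_inv:
  assumes "verts w \<subseteq> V"
  shows "inv\<^bsub>RAAG V E\<^esub> (wclass V E w) = wclass V E (winv w)"
  by (rule group.inv_equality[OF group_raag])
     (use assms in \<open>simp_all add: raag_mult raag_one wclass_eq_iff raag_eq_winv_left\<close>)

lemma raag_pow:
  assumes "verts w \<subseteq> V"
  shows "wclass V E w [^]\<^bsub>RAAG V E\<^esub> (int k) = wclass V E (wpow w k)"
proof -
  interpret group "RAAG V E" by (rule group_raag)
  have pV: "verts (wpow w k) \<subseteq> V" for k by (rule subset_trans[OF verts_wpow assms])
  have "wclass V E w [^]\<^bsub>RAAG V E\<^esub> k = wclass V E (wpow w k)"
  proof (induction k)
    case (Suc k)
    have "wclass V E w [^]\<^bsub>RAAG V E\<^esub> Suc k = wclass V E (wpow w k) \<otimes>\<^bsub>RAAG V E\<^esub> wclass V E w"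
      using Suc by (simp only: nat_pow_Suc)
    then show ?case using raag_mult[OF pV assms] wpow_commutes[of w k] by (simp only: wpow_simps)
  qed (simp add: raag_one)
  then show ?thesis by (simp only: int_pow_int)
qed

lemma verts_concat: "verts (concat ws) = (\<Union>w\<in>set ws. verts w)"
  by (induction ws) auto

lemma raag_foldr_mult:
  assumes "\<And>j. j \<in> set js \<Longrightarrow> verts (f j) \<subseteq> V" and "\<And>j. j \<in> set js \<Longrightarrow> y j = wclass V E (f j)"
  shows "foldr (\<lambda>j acc. y j \<otimes>\<^bsub>RAAG V E\<^esub> acc) js \<one>\<^bsub>RAAG V E\<^esub> = wclass V E (concat (map f js))"
  using assms
proof (induction js)
  case (Cons j js)
  then have "verts (concat (map f js)) \<subseteq> V" by (auto simp: verts_concat)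
  then show ?case using Cons by (simp add: raag_mult)
qed (simp add: raag_one)

section \<open>Existential sentences\<close>

fun word_term :: "('v \<Rightarrow> nat) \<Rightarrow> ('v \<times> bool) list \<Rightarrow> gterm" where
  "word_term \<iota> [] = One"
| "word_term \<iota> (\<alpha> # w) = Mul (if snd \<alpha> then Var (\<iota> (fst \<alpha>)) else Inv (Var (\<iota> (fst \<alpha>)))) (word_term \<iota> w)"

fun conj_list :: "qf list \<Rightarrow> qf" where
  "conj_list [] = Eq One One"
| "conj_list (p # ps) = Conj p (conj_list ps)"

lemma qf_holds_conj_list: "qf_holds G a (conj_list ps) \<longleftrightarrow> (\<forall>p\<in>set ps. qf_holds G a p)"
  by (induction ps) auto

lemma teval_word_term:
  assumes "\<And>v. v \<in> verts w \<Longrightarrow> verts (\<sigma> v) \<subseteq> V \<and> a (\<iota> v) = wclass V E (\<sigma> v)"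
  shows "verts (wsubst \<sigma> w) \<subseteq> V \<and> teval (RAAG V E) a (word_term \<iota> w) = wclass V E (wsubst \<sigma> w)"
  using assms
proof (induction w)
  case (Cons \<alpha> w)
  then show ?case using Cons.prems[of "fst \<alpha>"] by (auto simp: raag_mult raag_inv)
qed (simp add: raag_one)

text \<open>One sentence with a variable per vertex states the commutations along edges and the
  nontriviality of each of the finitely many nontrivial words of length at most \<open>N\<close>; a
  solution in the group of \<Gamma> is read as \<open>g\<close>.\<close>

lemma Th_ex_approximation:
  assumes VD: "simple_graph VD ED" and Th: "Th_ex (RAAG VD ED) \<subseteq> Th_ex (RAAG VG EG)"
  obtains g where "\<And>v. v \<in> VD \<Longrightarrow> verts (g v) \<subseteq> VG"
    and "\<And>v w. (v, w) \<in> ED \<Longrightarrow> wcomm EG (g v) (g w)"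
    and "\<And>w. verts w \<subseteq> VD \<Longrightarrow> length w \<le> N \<Longrightarrow> raag_eq EG (wsubst g w) [] \<Longrightarrow> raag_eq ED w []"
proof -
  have fin: "finite VD" and ED: "ED \<subseteq> VD \<times> VD" using VD by (auto simp: simple_graph_def)
  obtain \<iota> :: "'a \<Rightarrow> nat" where \<iota>: "inj_on \<iota> VD" using finite_imp_inj_to_nat_seg[OF fin] by blast
  define W where "W = {w. verts w \<subseteq> VD \<and> length w \<le> N \<and> \<not> raag_eq ED w []}"
  have "finite W"
    by (rule finite_subset[OF _ finite_lists_length_le[of "VD \<times> UNIV" N]])
       (use fin in \<open>auto simp: W_def verts_def subset_iff\<close>)
  define comm where "comm = (\<lambda>(v, w). Eq (Mul (Var (\<iota> v)) (Var (\<iota> w))) (Mul (Var (\<iota> w)) (Var (\<iota> v))))"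
  define F where "F = comm ` ED \<union> (\<lambda>w. Neg (Eq (word_term \<iota> w) One)) ` W"
  have "finite F" unfolding F_def using \<open>finite W\<close> finite_subset[OF ED] fin by blast
  then obtain fs where fs: "set fs = F" using finite_list by blast
  \<comment> \<open>\<open>ex_holds\<close> asks for a value in the carrier at every index, so
    indices that stand for no vertex get the identity.\<close>
  define a where "a i = (if i \<in> \<iota> ` VD then wclass VD ED [(the_inv_into VD \<iota> i, True)] else wclass VD ED [])" for i
  have a: "a (\<iota> v) = wclass VD ED [(v, True)]" if "v \<in> VD" for v
    using that \<iota> by (simp add: a_def the_inv_into_f_f)
  have "a i \<in> carrier (RAAG VD ED)" for i
    using \<iota> by (auto simp: a_def the_inv_into_f_f)
  moreover have "qf_holds (RAAG VD ED) a p" if "p \<in> F" for p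
    using that unfolding F_def
  proof (elim UnE imageE)
    fix e assume e: "e \<in> ED" "p = comm e"
    then obtain v w where vw: "e = (v, w)" "v \<in> VD" "w \<in> VD" "(v, w) \<in> ED" using ED by auto
    then have "raag_eq ED [(v, True), (w, True)] [(w, True), (v, True)]"
      using wcomm_edge[of v w ED True True] by (simp add: wcomm_def)
    then show "qf_holds (RAAG VD ED) a p" using vw e a by (simp add: comm_def raag_mult wclass_eq_iff)
  next
    fix w assume w: "w \<in> W" "p = Neg (Eq (word_term \<iota> w) One)"
    have "teval (RAAG VD ED) a (word_term \<iota> w) = wclass VD ED (wsubst (\<lambda>v. [(v, True)]) w)"
      using teval_word_term[of w "\<lambda>v. [(v, True)]" VD a \<iota> ED] w a by (auto simp: W_def)
    then show "qf_holds (RAAG VD ED) a p"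
      using w by (simp add: wsubst_letters raag_one wclass_eq_iff W_def)
  qed
  ultimately have "conj_list fs \<in> Th_ex (RAAG VD ED)"
    unfolding Th_ex_def ex_holds_def using fs by (auto simp: qf_holds_conj_list)
  then have "conj_list fs \<in> Th_ex (RAAG VG EG)" using Th by blast
  then obtain c where c: "\<And>i. c i \<in> carrier (RAAG VG EG)" "\<And>p. p \<in> F \<Longrightarrow> qf_holds (RAAG VG EG) c p"
    unfolding Th_ex_def ex_holds_def using fs by (auto simp: qf_holds_conj_list)
  have "\<exists>u. verts u \<subseteq> VG \<and> c i = wclass VG EG u" for i using c(1)[of i] by (auto simp: raag_carrier)
  then obtain u where u: "\<And>i. verts (u i) \<subseteq> VG" "\<And>i. c i = wclass VG EG (u i)" by metis
  show ?thesis
  proof (rule that[of "\<lambda>v. u (\<iota> v)"])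
    show "verts (u (\<iota> v)) \<subseteq> VG" for v by (rule u)
  next
    fix v w assume "(v, w) \<in> ED"
    then have "qf_holds (RAAG VG EG) c (comm (v, w))" using c(2) by (auto simp: F_def)
    then show "wcomm EG (u (\<iota> v)) (u (\<iota> w))"
      using u by (simp add: comm_def raag_mult wclass_eq_iff wcomm_def)
  next
    fix w assume w: "verts w \<subseteq> VD" "length w \<le> N" "raag_eq EG (wsubst (\<lambda>v. u (\<iota> v)) w) []"
    show "raag_eq ED w []"
    proof (rule ccontr)
      assume "\<not> raag_eq ED w []"
      then have "qf_holds (RAAG VG EG) c (Neg (Eq (word_term \<iota> w) One))"
        using w by (intro c(2)) (simp add: F_def W_def)
      moreover have "verts (wsubst (\<lambda>v. u (\<iota> v)) w) \<subseteq> VG \<and>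
          teval (RAAG VG EG) c (word_term \<iota> w) = wclass VG EG (wsubst (\<lambda>v. u (\<iota> v)) w)"
        by (rule teval_word_term) (use u in auto)
      ultimately show False using w(3) by (simp add: raag_one wclass_eq_iff)
    qed
  qed
qed

section \<open>The tame embedding\<close>

text \<open>The image of \<open>v\<close> in the group on the commutation graph of the
  blocks.\<close>

definition block_word :: "('a \<times> 'b) set \<Rightarrow> 'a \<Rightarrow> (('a \<times> 'b) \<times> bool) list" where
  "block_word J v = map (\<lambda>s. ((v, s), True)) (enum_list {s. (v, s) \<in> J})"

text \<open>A type records which blocks occur and which of them commute; it is realised by conjugates of
  generators with the same commutation relations. There are only finitely many types.\<close>

definition realised_type ::
  "'a set \<Rightarrow> ('a \<times> 'a) set \<Rightarrow> 'b set \<Rightarrow> ('b \<times> 'b) set \<Rightarrow> ('a \<times> 'b) set \<Rightarrow> (('a \<times> 'b) \<times> ('a \<times> 'b)) set \<Rightarrow>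
   ('a \<times> 'b \<Rightarrow> ('b \<times> bool) list) \<Rightarrow> ('a \<times> 'b \<Rightarrow> 'b) \<Rightarrow> bool" where
  "realised_type VD ED VG EG J R b x \<longleftrightarrow> J \<subseteq> VD \<times> VG \<and>
     R = {(j, k). j \<in> J \<and> k \<in> J \<and> j \<noteq> k \<and> wcomm EG (wconj (b j) [(x j, True)]) (wconj (b k) [(x k, True)])} \<and>
     (\<forall>j\<in>J. verts (b j) \<subseteq> VG \<and> x j \<in> VG) \<and>
     (\<forall>v s t. (v, s) \<in> J \<longrightarrow> (v, t) \<in> J \<longrightarrow> s \<noteq> t \<longrightarrow> x (v, s) \<noteq> x (v, t)) \<and>
     (\<forall>v w s t. (v, s) \<in> J \<longrightarrow> (w, t) \<in> J \<longrightarrow> (v, w) \<in> ED \<or> v = w \<and> s \<noteq> t \<longrightarrow> ((v, s), (w, t)) \<in> R)"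

lemma wsubst_block_word: "wsubst f (block_word J v) = concat (map (\<lambda>s. f (v, s)) (enum_list {s. (v, s) \<in> J}))"
proof -
  have "wsubst f (map (\<lambda>s. ((v, s), True)) xs) = concat (map (\<lambda>s. f (v, s)) xs)" for xs
    by (induction xs) auto
  then show ?thesis by (simp add: block_word_def)
qed

lemma verts_block_word: "finite J \<Longrightarrow> verts (block_word J v) = {v} \<times> {s. (v, s) \<in> J}"
proof -
  assume "finite J"
  then have "finite {s. (v, s) \<in> J}" by (rule finite_subset[rotated, OF finite_imageI[of J snd]]) force
  then show ?thesis using enum_list by (force simp: block_word_def verts_def)
qed

text \<open>\<open>g\<close> factors as \<open>block_word J\<close> followed by the blocks
  \<open>p\<close>, and \<open>p\<close> respects \<open>R\<close>; so whatever dies in the group on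
  \<open>R\<close> dies under \<open>g\<close>.\<close>

lemma type_exists:
  assumes D: "simple_graph VD ED" and G: "simple_graph VG EG"
    and Th: "Th_ex (RAAG VD ED) \<subseteq> Th_ex (RAAG VG EG)"
  shows "\<exists>J R b x. realised_type VD ED VG EG J R b x \<and>
    (\<forall>w. verts w \<subseteq> VD \<longrightarrow> length w \<le> N \<longrightarrow> raag_eq R (wsubst (block_word J) w) [] \<longrightarrow> raag_eq ED w [])"
proof -
  interpret pc_graph EG by (rule simple_graph_pc_graph[OF G])
  have fin: "finite VD" "finite VG" and loop: "(v, v) \<notin> ED" for v
    using D G by (auto simp: simple_graph_def)
  obtain g where g: "\<And>v. v \<in> VD \<Longrightarrow> verts (g v) \<subseteq> VG" "\<And>v w. (v, w) \<in> ED \<Longrightarrow> wcomm EG (g v) (g w)"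
    "\<And>w. verts w \<subseteq> VD \<Longrightarrow> length w \<le> N \<Longrightarrow> raag_eq EG (wsubst g w) [] \<Longrightarrow> raag_eq ED w []"
    using Th_ex_approximation[OF D Th, of N] by blast
  obtain J p b x where J: "J \<subseteq> VD \<times> VG"
    and p: "\<And>v. v \<in> VD \<Longrightarrow> raag_eq EG (g v) (concat (map (\<lambda>s. p (v, s)) (enum_list {s. (v, s) \<in> J})))"
    and gp: "\<And>v w s t. (v, s) \<in> J \<Longrightarrow> (w, t) \<in> J \<Longrightarrow> wcomm EG (g v) (g w) \<Longrightarrow> wcomm EG (p (v, s)) (p (w, t))"
    and pc: "\<And>j k. j \<in> J \<Longrightarrow> k \<in> J \<Longrightarrow> wcomm EG (p j) (p k) \<longleftrightarrow>
      wcomm EG (wconj (b j) [(x j, True)]) (wconj (b k) [(x k, True)])"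
    and xs: "\<And>v s t. (v, s) \<in> J \<Longrightarrow> (v, t) \<in> J \<Longrightarrow> s \<noteq> t \<Longrightarrow> x (v, s) \<noteq> x (v, t)"
    and bx: "\<And>j. j \<in> J \<Longrightarrow> verts (b j) \<subseteq> VG \<and> x j \<in> VG"
    using block_family[of VD g VG, OF fin(1) g(1) fin(2)] by blast
  \<comment> \<open>Read off from the generic conjugates, which realise it; by \<open>pc\<close> it
    is the commutation graph of the blocks as well.\<close>
  define R where "R = {(j, k). j \<in> J \<and> k \<in> J \<and> j \<noteq> k \<and>
    wcomm EG (wconj (b j) [(x j, True)]) (wconj (b k) [(x k, True)])}"
  have Rp: "(j, k) \<in> R \<longleftrightarrow> j \<in> J \<and> k \<in> J \<and> j \<noteq> k \<and> wcomm EG (p j) (p k)" for j k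
    using pc[of j k] by (auto simp: R_def)
  have "realised_type VD ED VG EG J R b x"
    unfolding realised_type_def
  proof (intro conjI allI impI)
    fix v w s t assume *: "(v, s) \<in> J" "(w, t) \<in> J" "(v, w) \<in> ED \<or> v = w \<and> s \<noteq> t"
    then have "wcomm EG (g v) (g w)" using g(2) by auto
    then have "wcomm EG (p (v, s)) (p (w, t))" using gp *(1,2) by blast
    moreover have "(v, s) \<noteq> (w, t)" using *(3) loop by auto
    ultimately show "((v, s), (w, t)) \<in> R" using Rp *(1,2) by blast
  qed (use J bx xs R_def in auto)
  moreover have "raag_eq ED w []"
    if w: "verts w \<subseteq> VD" "length w \<le> N" "raag_eq R (wsubst (block_word J) w) []" for w
  proof (rule g(3)[OF w(1,2)])
    have "raag_eq EG (wsubst p (wsubst (block_word J) w)) (wsubst p [])"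
      by (rule raag_eq_wsubst[OF _ w(3)]) (use Rp in blast)
    moreover have "raag_eq EG (wsubst g w) (wsubst p (wsubst (block_word J) w))"
      unfolding wsubst_wsubst wsubst_block_word by (rule wsubst_raag_eq_cong) (use p w(1) in blast)
    ultimately show "raag_eq EG (wsubst g w) []" using raag_eq_trans by fastforce
  qed
  ultimately show ?thesis by blast
qed

text \<open>Pigeonhole: the conditions \<open>I N\<close> grow stronger with \<open>N\<close>, so if
  each of the finitely many types failed some \<open>N\<close>, none would satisfy the largest of
  these. The realising \<open>b\<close> and \<open>x\<close> may change with \<open>N\<close>, since
  injectivity concerns only \<open>J\<close> and \<open>R\<close>.\<close>

lemma injective_type_exists:
  fixes VD :: "'a set" and VG :: "'b set"
  assumes D: "simple_graph VD ED" and G: "simple_graph VG EG"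
    and Th: "Th_ex (RAAG VD ED) \<subseteq> Th_ex (RAAG VG EG)"
  obtains J R b x where "realised_type VD ED VG EG J R b x"
    and "\<And>w. verts w \<subseteq> VD \<Longrightarrow> raag_eq R (wsubst (block_word J) w) [] \<Longrightarrow> raag_eq ED w []"
proof -
  have fin: "finite VD" "finite VG" using D G by (auto simp: simple_graph_def)
  define T where "T = {(J, R). \<exists>b x. realised_type VD ED VG EG J R b x}"
  have "T \<subseteq> Pow (VD \<times> VG) \<times> Pow ((VD \<times> VG) \<times> (VD \<times> VG))"
    by (auto simp: T_def realised_type_def)
  then have finT: "finite T" by (rule finite_subset) (use fin in auto)
  define I where "I N = (\<lambda>(J :: ('a \<times> 'b) set, R). \<forall>w. verts w \<subseteq> VD \<longrightarrow> length w \<le> N \<longrightarrow>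
    raag_eq R (wsubst (block_word J) w) [] \<longrightarrow> raag_eq ED w [])" for N
  have ex: "\<exists>\<tau>\<in>T. I N \<tau>" for N
    using type_exists[OF D G Th, of N] by (fastforce simp: T_def I_def)
  have mono: "I M \<tau>" if "I N \<tau>" "M \<le> N" for M N \<tau> using that by (auto simp: I_def)
  have "\<exists>\<tau>\<in>T. \<forall>N. I N \<tau>"
  proof (rule ccontr)
    assume "\<not> ?thesis"
    then obtain N where N: "\<And>\<tau>. \<tau> \<in> T \<Longrightarrow> \<not> I (N \<tau>) \<tau>" by metis
    obtain \<tau> where \<tau>: "\<tau> \<in> T" "I (Max (N ` T)) \<tau>" using ex by blast
    then have "N \<tau> \<le> Max (N ` T)" using finT by simp
    then show False using mono \<tau> N by blast
  qed
  then obtain \<tau> where \<tau>: "\<tau> \<in> T" "\<And>N. I N \<tau>" by blast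
  obtain J R where JR: "\<tau> = (J, R)" by fastforce
  then obtain b x where "realised_type VD ED VG EG J R b x" using \<tau>(1) by (auto simp: T_def)
  moreover have "raag_eq ED w []" if "verts w \<subseteq> VD" "raag_eq R (wsubst (block_word J) w) []" for w
    using \<tau>(2)[of "length w"] that by (simp add: I_def JR)
  ultimately show ?thesis using that by blast
qed

text \<open>\<open>v\<close> goes to the product of suitable powers of the conjugates for its
  blocks, taken in copy \<open>ix v\<close>. This is \<open>block_word J\<close> followed by the
  substitution of powers, and each of the two has trivial kernel.\<close>

lemma tame_embedding_of_type:
  assumes D: "simple_graph VD ED" and G: "simple_graph VG EG" and n: "n = card VD"
    and type: "realised_type VD ED VG EG J R b x"
    and inj: "\<And>w. verts w \<subseteq> VD \<Longrightarrow> raag_eq R (wsubst (block_word J) w) [] \<Longrightarrow> raag_eq ED w []"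
  shows "\<exists>\<phi>. tame_embedding VD ED (inflation_V VG n) (inflation_E VG EG n) \<phi>"
proof -
  let ?VL = "inflation_V VG n" and ?EL = "inflation_E VG EG n"
  let ?L = "RAAG ?VL ?EL" and ?D = "RAAG VD ED"
  have fin: "finite VD" "finite VG" and ED: "ED \<subseteq> VD \<times> VD" using D G by (auto simp: simple_graph_def)
  obtain ix0 where "bij_betw ix0 VD {0..<n}" using ex_bij_betw_finite_nat[OF fin(1)] n by blast
  \<comment> \<open>The copies in the inflation are numbered from 1.\<close>
  define ix where "ix v = Suc (ix0 v)" for v
  have ix: "inj_on ix VD" "\<And>v. v \<in> VD \<Longrightarrow> ix v \<in> {1..n}"
    using \<open>bij_betw ix0 VD {0..<n}\<close> by (force simp: ix_def bij_betw_def inj_on_def)+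
  have J: "J \<subseteq> VD \<times> VG" and R: "R = {(j, k). j \<in> J \<and> k \<in> J \<and> j \<noteq> k \<and>
      wcomm EG (wconj (b j) [(x j, True)]) (wconj (b k) [(x k, True)])}"
    and bx: "\<And>j. j \<in> J \<Longrightarrow> verts (b j) \<subseteq> VG \<and> x j \<in> VG"
    and xs: "\<And>v s t. (v, s) \<in> J \<Longrightarrow> (v, t) \<in> J \<Longrightarrow> s \<noteq> t \<Longrightarrow> x (v, s) \<noteq> x (v, t)"
    and RE: "\<And>v w s t. (v, s) \<in> J \<Longrightarrow> (w, t) \<in> J \<Longrightarrow> (v, w) \<in> ED \<or> v = w \<and> s \<noteq> t \<Longrightarrow> ((v, s), (w, t)) \<in> R"
    using type unfolding realised_type_def by blast+
  have finJ: "finite J" by (rule finite_subset[OF J]) (use fin in auto)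
  have ixJ: "ix (fst j) \<in> {1..n}" if "j \<in> J" for j using that J ix(2) by auto
  define c where "c j = copy_conj n (b j) (x j) (ix (fst j))" for j
  have comm: "wcomm ?EL (c j) (c k) \<longleftrightarrow> wcomm EG (wconj (b j) [(x j, True)]) (wconj (b k) [(x k, True)])"
    if jk: "j \<in> J" "k \<in> J" for j k
    using wcomm_copy_conj[OF G, of "x j" "ix (fst j)" n "x k" "ix (fst k)" "b j" "b k"]
      wcomm_copy_conjD[OF G, of "x j" "ix (fst j)" n "x k" "ix (fst k)" "b j" "b k"]
      bx[OF jk(1)] bx[OF jk(2)] ixJ[OF jk(1)] ixJ[OF jk(2)] unfolding c_def by blast
  have cR: "wcomm ?EL (c j) (c k)" if "(j, k) \<in> R" for j k using that comm[of j k] by (simp add: R)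
  \<comment> \<open>Equal conjugates have equal copy numbers, hence belong to one generator
    \<open>v\<close>, and there the vertices \<open>x (v, s)\<close> differ.\<close>
  have distinct: "\<not> raag_eq ?EL (c j) (c k)" if jk: "j \<in> J" "k \<in> J" "j \<noteq> k" for j k
  proof
    assume "raag_eq ?EL (c j) (c k)"
    from copy_conj_distinct[OF this[unfolded c_def]]
    have eq: "x j = x k" "ix (fst j) = ix (fst k)" by auto
    obtain v s w t where vw: "j = (v, s)" "k = (w, t)" by fastforce
    then have "v = w" using eq(2) ix(1) jk J by (auto dest: inj_onD)
    then show False using xs[of v s t] eq(1) jk vw by auto
  qed
  have cV: "verts (c j) \<subseteq> ?VL" "verts (wsubst (diag n) (b j)) \<subseteq> ?VL" if "j \<in> J" for j
    using verts_copy_conj[of "b j" VG "x j" "ix (fst j)" n] bx[OF that] ixJ[OF that] by (auto simp: c_def)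
  obtain e where e: "\<And>j. e j > 0" and KK: "\<And>w. verts w \<subseteq> J \<Longrightarrow>
      raag_eq ?EL (wsubst (\<lambda>j. wpow (c j) (e j)) w) [] \<Longrightarrow>
      raag_eq {(j, k). j \<in> J \<and> k \<in> J \<and> j \<noteq> k \<and> wcomm ?EL (c j) (c k)} w []"
    using powers_of_vertex_conjugates[OF pc_graph_inflation[OF G, of n] finJ, of "\<lambda>j. wsubst (diag n) (b j)" "\<lambda>j. (x j, ix (fst j))"]
      distinct unfolding c_def copy_conj_def by blast
  have R': "{(j, k). j \<in> J \<and> k \<in> J \<and> j \<noteq> k \<and> wcomm ?EL (c j) (c k)} = R"
  proof (intro equalityI subrelI)
    fix j k assume "(j, k) \<in> {(j, k). j \<in> J \<and> k \<in> J \<and> j \<noteq> k \<and> wcomm ?EL (c j) (c k)}"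
    then show "(j, k) \<in> R" using comm[of j k] by (simp add: R)
  next
    fix j k assume "(j, k) \<in> R"
    then show "(j, k) \<in> {(j, k). j \<in> J \<and> k \<in> J \<and> j \<noteq> k \<and> wcomm ?EL (c j) (c k)}"
      using comm[of j k] by (simp add: R)
  qed
  define q where "q j = wpow (c j) (e j)" for j
  have qV: "verts (q j) \<subseteq> ?VL" if "j \<in> J" for j
    unfolding q_def by (rule subset_trans[OF verts_wpow cV(1)[OF that]])
  have qR: "wcomm ?EL (q j) (q k)" if "(j, k) \<in> R" for j k
    unfolding q_def by (rule wcomm_wpow2[OF cR[OF that]])
  define F where "F v = wsubst q (block_word J v)" for v
  have bw: "verts (block_word J v) = {v} \<times> {s. (v, s) \<in> J}" for v by (rule verts_block_word[OF finJ])
  have FV: "verts (F v) \<subseteq> ?VL" for v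
    using verts_wsubst[of q "block_word J v"] qV unfolding F_def bw by blast
  have wFV: "verts (wsubst F w) \<subseteq> ?VL" for w
    using verts_wsubst[of F w] FV by blast
  have Fhom: "wcomm ?EL (F v) (F w)" if e: "(v, w) \<in> ED" for v w
  proof -
    have "wcomm R (block_word J v) (block_word J w)"
      by (rule wcomm_verts) (use RE e in \<open>auto simp: bw\<close>)
    then show ?thesis unfolding F_def by (rule wcomm_wsubst[OF qR, rotated])
  qed
  have Feq: "raag_eq ?EL (wsubst F u) (wsubst F w)" if "raag_eq ED u w" for u w
    by (rule raag_eq_wsubst[OF Fhom that])
  have Finj: "raag_eq ED w []" if w: "verts w \<subseteq> VD" "raag_eq ?EL (wsubst F w) []" for w
  proof (rule inj[OF w(1)])
    have "verts (wsubst (block_word J) w) \<subseteq> J" using verts_wsubst[of "block_word J" w] unfolding bw by blast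
    then show "raag_eq R (wsubst (block_word J) w) []"
      using KK[of "wsubst (block_word J) w"] w(2) R' by (simp add: F_def[abs_def] wsubst_wsubst q_def[abs_def])
  qed
  \<comment> \<open>An arbitrary word is picked from the class; \<open>Feq\<close> makes the value
    independent of it.\<close>
  define \<phi> where "\<phi> A = wclass ?VL ?EL (wsubst F (SOME w. w \<in> A))" for A
  have \<phi>: "\<phi> (wclass VD ED w) = wclass ?VL ?EL (wsubst F w)" if w: "verts w \<subseteq> VD" for w
  proof -
    have "w \<in> wclass VD ED w" using w by (simp add: in_wclass)
    then have "(SOME u. u \<in> wclass VD ED w) \<in> wclass VD ED w" by (rule someI)
    then have "raag_eq ED (SOME u. u \<in> wclass VD ED w) w"
      using in_wclass[of "SOME u. u \<in> wclass VD ED w"] raag_eq_sym by metis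
    then show ?thesis unfolding \<phi>_def by (simp add: wclass_eq_iff[OF wFV wFV] Feq)
  qed
  have "\<phi> \<in> hom ?D ?L"
  proof (rule homI)
    fix A assume "A \<in> carrier ?D"
    then show "\<phi> A \<in> carrier ?L" using \<phi> wFV by (auto simp: raag_carrier)
  next
    fix A B assume "A \<in> carrier ?D" "B \<in> carrier ?D"
    then obtain u w where "A = wclass VD ED u" "B = wclass VD ED w" "verts u \<subseteq> VD" "verts w \<subseteq> VD"
      by (auto simp: raag_carrier)
    then show "\<phi> (A \<otimes>\<^bsub>?D\<^esub> B) = \<phi> A \<otimes>\<^bsub>?L\<^esub> \<phi> B" by (simp add: raag_mult \<phi> wFV)
  qed
  moreover have "inj_on \<phi> (carrier ?D)"
  proof (rule inj_onI)
    fix A B assume "A \<in> carrier ?D" "B \<in> carrier ?D" and eq: "\<phi> A = \<phi> B"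
    then obtain u w where AB: "A = wclass VD ED u" "B = wclass VD ED w" and uw: "verts u \<subseteq> VD" "verts w \<subseteq> VD"
      by (auto simp: raag_carrier)
    then have "raag_eq ?EL (wsubst F u) (wsubst F w)" using eq \<phi> wclass_eq_iff[OF wFV wFV] by simp
    then have "raag_eq ?EL (wsubst F (winv u @ w)) []"
      by (simp add: wsubst_winv raag_eq_iff_cancel)
    then have "raag_eq ED (winv u @ w) []" using uw by (intro Finj) auto
    then show "A = B" using AB uw by (simp add: raag_eq_iff_cancel wclass_eq_iff)
  qed
  moreover
  \<comment> \<open>Positions in this list turn the blocks of \<open>v\<close> into the indices
    below \<open>r v\<close> that \<open>tame_embedding\<close> counts with.\<close>
  define xl where "xl v = enum_list {s. (v, s) \<in> J}" for v
  define r where "r v = length (xl v)" for v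
  define jj where "jj v i = (v, xl v ! i)" for v i
  have xl: "set (xl v) = {s. (v, s) \<in> J}" "List.distinct (xl v)" for v
  proof -
    have "finite {s. (v, s) \<in> J}" by (rule finite_subset[of _ VG]) (use J fin in auto)
    then show "set (xl v) = {s. (v, s) \<in> J}" "List.distinct (xl v)" unfolding xl_def using enum_list by auto
  qed
  have jJ: "jj v i \<in> J" if "i < r v" for v i
    using that xl(1)[of v] nth_mem[of i "xl v"] by (auto simp: r_def jj_def)
  define x' where "x' v i = (x (jj v i), ix v)" for v i
  define k where "k v i = int (e (jj v i))" for v i
  define g where "g v i = wclass ?VL ?EL (wsubst (diag n) (b (jj v i)))" for v i
  define y where "y v i = inv\<^bsub>?L\<^esub> (g v i) \<otimes>\<^bsub>?L\<^esub> (raag_gen ?VL ?EL (x' v i) [^]\<^bsub>?L\<^esub> k v i) \<otimes>\<^bsub>?L\<^esub> g v i" for v i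
  define d where "d v i = inv\<^bsub>?L\<^esub> (g v i) \<otimes>\<^bsub>?L\<^esub> raag_gen ?VL ?EL (x' v i) \<otimes>\<^bsub>?L\<^esub> g v i" for v i
  have x'V: "x' v i \<in> ?VL" if "v \<in> VD" "i < r v" for v i
    using bx[OF jJ[OF that(2)]] ix(2)[OF that(1)] by (simp add: x'_def inflation_V_def)
  have yd: "y v i = wclass ?VL ?EL (q (jj v i))" "d v i = wclass ?VL ?EL (c (jj v i))"
    if vi: "v \<in> VD" "i < r v" for v i
  proof -
    let ?b = "wsubst (diag n) (b (jj v i))" and ?x = "[(x' v i, True)]"
    have bV: "verts ?b \<subseteq> ?VL" using cV(2)[OF jJ[OF vi(2)]] .
    have xV: "verts ?x \<subseteq> ?VL" using x'V[OF vi] by simp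
    have pV: "verts (wpow ?x m) \<subseteq> ?VL" for m by (rule subset_trans[OF verts_wpow xV])
    have cx: "c (jj v i) = wconj ?b ?x" by (simp add: c_def copy_conj_def x'_def jj_def)
    show "d v i = wclass ?VL ?EL (c (jj v i))"
      using bV xV by (simp add: d_def g_def raag_gen_wclass raag_inv raag_mult cx wconj_def)
    have "y v i = wclass ?VL ?EL (wconj ?b (wpow ?x (e (jj v i))))"
      using bV pV by (simp add: y_def g_def k_def raag_gen_wclass raag_inv raag_mult raag_pow[OF xV] wconj_def)
    also have "\<dots> = wclass ?VL ?EL (q (jj v i))"
      using bV pV qV[OF jJ[OF vi(2)]] by (subst wclass_eq_iff) (auto simp: verts_wconj q_def cx wconj_wpow)
    finally show "y v i = wclass ?VL ?EL (q (jj v i))" .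
  qed
  have "\<phi> (raag_gen VD ED v) = foldr (\<lambda>j acc. y v j \<otimes>\<^bsub>?L\<^esub> acc) [0..<r v] \<one>\<^bsub>?L\<^esub>" if v: "v \<in> VD" for v
  proof -
    have "foldr (\<lambda>j acc. y v j \<otimes>\<^bsub>?L\<^esub> acc) [0..<r v] \<one>\<^bsub>?L\<^esub> = wclass ?VL ?EL (concat (map (\<lambda>i. q (jj v i)) [0..<r v]))"
      by (rule raag_foldr_mult) (use qV jJ yd(1) v in auto)
    also have "map (\<lambda>i. q (jj v i)) [0..<r v] = map (\<lambda>s. q (v, s)) (xl v)"
      by (rule nth_equalityI) (auto simp: r_def jj_def)
    also have "concat \<dots> = F v" by (simp add: F_def wsubst_block_word xl_def)
    finally show ?thesis using \<phi>[of "[(v, True)]"] v by (simp add: raag_gen_wclass)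
  qed
  moreover have "y v i \<otimes>\<^bsub>?L\<^esub> y v i' = y v i' \<otimes>\<^bsub>?L\<^esub> y v i" if v: "v \<in> VD" and i: "i < r v" "i' < r v" for v i i'
  proof -
    have "wcomm ?EL (q (jj v i)) (q (jj v i'))"
    proof (cases "i = i'")
      case False
      then have "xl v ! i \<noteq> xl v ! i'" using i xl(2)[of v] by (simp add: r_def nth_eq_iff_index_eq)
      then show ?thesis using qR RE jJ[OF i(1)] jJ[OF i(2)] by (simp add: jj_def)
    qed simp
    then show ?thesis
      using yd(1)[OF v i(1)] yd(1)[OF v i(2)] qV[OF jJ[OF i(1)]] qV[OF jJ[OF i(2)]]
      by (simp add: raag_mult wclass_eq_iff wcomm_def)
  qed
  moreover have "inj_on (\<lambda>(v, j). d v j) {(v, j). v \<in> VD \<and> j < r v}"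
  proof (rule inj_onI, clarify)
    fix v i w l assume vi: "v \<in> VD" "i < r v" and wl: "w \<in> VD" "l < r w" and eq: "d v i = d w l"
    have "raag_eq ?EL (c (jj v i)) (c (jj w l))"
      using eq yd(2)[OF vi] yd(2)[OF wl] cV(1)[OF jJ[OF vi(2)]] cV(1)[OF jJ[OF wl(2)]] by (simp add: wclass_eq_iff)
    then have "jj v i = jj w l" using distinct jJ vi wl by blast
    then show "v = w \<and> i = l" using vi wl xl(2)[of v] by (auto simp: jj_def r_def nth_eq_iff_index_eq)
  qed
  moreover have "x' v i \<in> ?VL \<and> g v i \<in> carrier ?L" if "v \<in> VD" "i < r v" for v i
    using x'V[OF that] cV(2)[OF jJ[OF that(2)]] by (simp add: g_def)
  ultimately have "tame_embedding VD ED ?VL ?EL \<phi>"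
    unfolding tame_embedding_def Let_def y_def d_def by blast
  then show ?thesis by blast
qed

theorem theorem4p12:
  fixes VD :: "'a set" and ED :: "('a \<times> 'a) set"
    and VG :: "'b set" and EG :: "('b \<times> 'b) set" and n :: nat
  assumes "simple_graph VD ED" and "simple_graph VG EG"
    and "n = card VD"
    and "Th_ex (RAAG VD ED) \<subseteq> Th_ex (RAAG VG EG)"
  shows "\<exists>\<phi>. tame_embedding VD ED (inflation_V VG n) (inflation_E VG EG n) \<phi>"
  by (rule injective_type_exists[OF assms(1,2,4)]) (rule tame_embedding_of_type[OF assms(1-3)])

end
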